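(* Let $r^{(s)}=(r^{(s)}_n)_{n\ge1}$, $s\ge1$, be a sequence of vectors of real numbers (fixed, i.e. independent of the point of $\mathbb T^\infty$) such that for every $n\ge1$ \[ 0\le r_n^{(1)}\le r_n^{(2)}\le\cdots\quad\text{and}\quad r_n^{(s)}\uparrow1\ \text{ as } s\to\infty. \] Then, for every $1<p<\infty$ and every $g\in L^p(\mathbb T^\infty)$, \[ \Bigl\|\sup_{s\ge1}|P_{r^{(s)}}g|\Bigr\|_p\le\frac{p}{p-1}\,\|g\|_p , \] and $P_{r^{(s)}}g\to g$ as $s\to\infty$, both $m_\infty$-almost everywhere and in $L^p(\mathbb T^\infty)$.
   Context: $\mathbb T$ is the unit circle with normalized Haar measure $m$, $\mathbb T^\infty=\prod_{n\ge1}\mathbb T$ (a compact abelian group under coordinatewise multiplication) and $m_\infty=\bigotimes_{n\ge1}m$ is its normalized Haar measure; $L^p(\mathbb T^\infty)=L^p(\mathbb T^\infty,m_\infty)$ with norm $\|\cdot\|_p$. For $r=(r_n)_{n\ge1}\in[0,1]^\infty$, $\nu_r$ denotes the product probability measure on $\mathbb T^\infty$ whose $n$th factor is the Poisson measure $\frac{1-r_n^2}{|1-r_n\zeta|^2}\,dm(\zeta)$ on $\mathbb T$ if $r_n<1$, and the point mass at $1\in\mathbb T$ if $r_n=1$. Equivalently, its Fourier coefficients are $\widehat{\nu_r}(\gamma)=\prod_{n\ge1}r_n^{|\gamma_n|}$ for all finitely supported $\gamma=(\gamma_n)\in\mathbb Z^\infty$ (with $0^0=1$). For $g\in L^p(\mathbb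 T^\infty)$, $P_rg:=\nu_r*g$, i.e. $(P_rg)(x)=\int_{\mathbb T^\infty}g(xy^{-1})\,d\nu_r(y)$. *)

theory Defs
  imports "HOL-Probability.Probability"
begin

text \<open>Normalized Haar measure on the unit circle: arc length, as the image of Lebesgue measure
  on \<open>[0,1)\<close> under \<open>t \<mapsto> exp (2 \<pi> i t)\<close>.\<close>

definition circle_haar :: "complex measure" where
  "circle_haar = distr (restrict_space lborel {0..<1})
     (restrict_space borel (sphere 0 1)) (\<lambda>t. cis (2 * pi * t))"

text \<open>Points of the infinite torus are sequences of unit complex numbers; coordinates are numbered
  from 0. The product of the Borel sigma-algebras is the Borel sigma-algebra of the torus, since
  there are countably many second countable factors.\<close>

definition torus_haar :: "(nat \<Rightarrow> complex) measure" where
  "torus_haar = (\<Pi>\<^sub>M n\<in>UNIV. circle_haar)"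

text \<open>Only used for \<open>0 \<le> r \<le> 1\<close>.\<close>

definition poisson_measure :: "real \<Rightarrow> complex measure" where
  "poisson_measure r =
     (if r < 1
      then density circle_haar
             (\<lambda>\<zeta>. ennreal ((1 - r\<^sup>2) / (cmod (1 - complex_of_real r * \<zeta>))\<^sup>2))
      else return circle_haar 1)"

definition torus_poisson :: "(nat \<Rightarrow> real) \<Rightarrow> (nat \<Rightarrow> complex) measure" where
  "torus_poisson r = (\<Pi>\<^sub>M n\<in>UNIV. poisson_measure (r n))"

text \<open>Convolution is defined almost everywhere for an integrable \<open>g\<close>; at points where the integrand
  is not integrable, the Bochner integral has the value 0.\<close>

definition torus_convolution ::
  "(nat \<Rightarrow> complex) measure \<Rightarrow> ((nat \<Rightarrow> complex) \<Rightarrow> complex) \<Rightarrow> (nat \<Rightarrow> complex) \<Rightarrow> complex" where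
  "torus_convolution \<nu> g x = (\<integral>y. g (\<lambda>n. x n * inverse (y n)) \<partial>\<nu>)"

definition poisson_op ::
  "(nat \<Rightarrow> real) \<Rightarrow> ((nat \<Rightarrow> complex) \<Rightarrow> complex) \<Rightarrow> (nat \<Rightarrow> complex) \<Rightarrow> complex" where
  "poisson_op r = torus_convolution (torus_poisson r)"

text \<open>Real powers on \<open>[0,\<infinity>]\<close>, for positive exponents only.\<close>

definition ennreal_powr :: "ennreal \<Rightarrow> real \<Rightarrow> ennreal" where
  "ennreal_powr x a = (if x = \<top> then \<top> else ennreal (enn2real x powr a))"

text \<open>The norm is taken of \<open>[0,\<infinity>]\<close>-valued functions, so that it also applies to suprema
  that are not known to be finite; a complex function \<open>f\<close> enters through \<open>ennreal (cmod (f x))\<close>.\<close>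

definition Lp_norm :: "'a measure \<Rightarrow> real \<Rightarrow> ('a \<Rightarrow> ennreal) \<Rightarrow> ennreal" where
  "Lp_norm M p F = ennreal_powr (\<integral>\<^sup>+x. ennreal_powr (F x) p \<partial>M) (1 / p)"

definition Lp_space :: "'a measure \<Rightarrow> real \<Rightarrow> ('a \<Rightarrow> complex) set" where
  "Lp_space M p =
     {f \<in> borel_measurable M. Lp_norm M p (\<lambda>x. ennreal (cmod (f x))) < \<top>}"

definition tendsto_Lp ::
  "'a measure \<Rightarrow> real \<Rightarrow> (nat \<Rightarrow> 'a \<Rightarrow> complex) \<Rightarrow> ('a \<Rightarrow> complex) \<Rightarrow> bool" where
  "tendsto_Lp M p F f \<longleftrightarrow>
     (\<forall>s. F s \<in> Lp_space M p) \<and> f \<in> Lp_space M p \<and>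
     (\<lambda>s. Lp_norm M p (\<lambda>x. ennreal (cmod (F s x - f x)))) \<longlonglongrightarrow> 0"

end

theory Submission
  imports Defs
begin

text \<open>
  The maximal inequality follows Rota's dilation argument. Poisson measures form a semigroup,
  \<open>\<nu>\<^sub>a * \<nu>\<^sub>b = \<nu>\<^sub>a\<^sub>b\<close>, and are symmetric. For finitely many radii \<open>r\<^sub>0 \<le> \<dots> \<le> r\<^sub>N\<^sub>-\<^sub>1\<close> let \<open>\<rho>\<^sub>k = sqrt r\<^sub>k\<close>,
  \<open>\<rho>\<^sub>N = 1\<close>, and let \<open>X\<^sub>0, \<dots>, X\<^sub>N\<close> be the random walk on the torus that starts from Haar measure and
  whose \<open>k\<close>th step has the law \<open>\<nu>\<close> with radii \<open>\<rho>\<^sub>k / \<rho>\<^sub>k\<^sub>+\<^sub>1\<close>. For \<open>g \<ge> 0\<close> the values \<open>f\<^sub>k(X\<^sub>k)\<close>, where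
  \<open>f\<^sub>k = P\<^bsub>\<rho>(k)\<^esub> g\<close>, form a martingale ending in \<open>g(X\<^sub>N)\<close>, and by reversibility
  \<open>P\<^bsub>r(k)\<^esub> g(X\<^sub>N)\<close> is the conditional expectation of \<open>f\<^sub>k(X\<^sub>k)\<close> given \<open>X\<^sub>N\<close>. So the maximum of the
  \<open>P\<^bsub>r(k)\<^esub> g(X\<^sub>N)\<close> is at most the conditional expectation of the maximum of the martingale, and Doob's
  inequality gives the constant \<open>p / (p - 1)\<close>. By the maximal inequality, the functions with almost
  everywhere convergence are closed under dominated limits; they include the products of Lipschitz
  functions of finitely many coordinates, hence indicators of open boxes, hence (by Dynkin's lemma)
  all indicators, hence all of \<open>L\<^sup>p\<close>.
\<close>

section \<open>Haar measure and Poisson measures on the circle\<close>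

text \<open>\<open>torus_poisson r\<close> need not have a density with respect to Haar measure, so
  no pointwise kernel bound is at hand, and the estimate must not see the number of coordinates; the
  martingale argument does not. The square roots are forced: \<open>f k\<close> contributes the
  radii \<open>\<rho> k\<close> once and the way back from time \<open>N\<close> contributes them a
  second time, so \<open>r = \<rho>^2\<close>. Monotonicity in \<open>s\<close> keeps the step radii
  \<open>\<rho> k / \<rho> (Suc k)\<close> in \<open>[0,1]\<close>. Conditional expectations are
  never formed. The walk is recorded only as the joint law of position and running maximum, and
  conditioning on the last position is replaced by integration against arbitrary nonnegative
  functions of it. As these integrals take values in \<open>[0,\<infinity>]\<close>, where terms
  cancel only if finite, \<open>g\<close> is bounded at first; monotone convergence then removes the
  bound and the finiteness of the set of radii. The constant is that of Doob's inequality: passing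
  to the last position costs a factor 1. Convergence on Lipschitz products rests on the second
  moment \<open>2 - 2 * r\<close> of the distance to 1, and convergence in \<open>L^p\<close>
  follows from almost everywhere convergence, with the maximal function as majorant.\<close>

abbreviation circle_borel :: "complex measure" where
  "circle_borel \<equiv> restrict_space borel (sphere 0 1)"

lemma measurable_cis_interval [measurable]:
  "(\<lambda>t. cis (2 * pi * t)) \<in> borel \<rightarrow>\<^sub>M circle_borel"
  by (intro measurable_restrict_space2 borel_measurable_continuous_onI continuous_intros) auto

lemma sets_circle_haar [simp, measurable_cong]: "sets circle_haar = sets circle_borel"
  by (simp add: circle_haar_def)

lemma space_circle_haar [simp]: "space circle_haar = sphere 0 1"
  by (simp add: circle_haar_def space_restrict_space)

lemma prob_space_circle_haar: "prob_space circle_haar"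
proof -
  interpret prob_space "restrict_space lborel {0..<1::real}"
    by (rule prob_space_restrict_space) auto
  show ?thesis
    unfolding circle_haar_def by (intro prob_space_distr measurable_restrict_space1) simp
qed

lemma nn_integral_circle_haar:
  assumes [measurable]: "f \<in> borel_measurable circle_borel"
  shows "integral\<^sup>N circle_haar f = (\<integral>\<^sup>+t. f (cis (2 * pi * t)) * indicator {0..<1} t \<partial>lborel)"
proof -
  have "integral\<^sup>N circle_haar f = (\<integral>\<^sup>+t. f (cis (2 * pi * t)) \<partial>restrict_space lborel {0..<1})"
    unfolding circle_haar_def
    by (subst nn_integral_distr) (auto intro!: measurable_restrict_space1)
  also have "\<dots> = (\<integral>\<^sup>+t. f (cis (2 * pi * t)) * indicator {0..<1} t \<partial>lborel)"
    by (subst nn_integral_restrict_space) auto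
  finally show ?thesis .
qed

lemma unit_complex_cis:
  assumes "cmod w = 1"
  obtains a where "0 \<le> a" "a < 1" "w = cis (2 * pi * a)"
proof -
  have "0 \<le> Arg2pi w / (2 * pi)" "Arg2pi w / (2 * pi) < 1"
    using Arg2pi[of w] by (simp_all add: divide_less_eq)
  moreover have "w = cis (2 * pi * (Arg2pi w / (2 * pi)))"
    using Arg2pi[of w] assms by (simp add: cis_conv_exp is_Arg_def)
  ultimately show ?thesis using that by blast
qed

lemma measurable_circle_mult [measurable]:
  "(\<lambda>(x, y). x * y) \<in> circle_borel \<Otimes>\<^sub>M circle_borel \<rightarrow>\<^sub>M circle_borel"
proof (rule measurable_restrict_space2)
  have [measurable]: "(\<lambda>x. x) \<in> circle_borel \<rightarrow>\<^sub>M borel"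
    by (rule measurable_restrict_space1) simp
  show "(\<lambda>(x, y). x * y) \<in> borel_measurable (circle_borel \<Otimes>\<^sub>M circle_borel)"
    by measurable
qed (auto simp: space_pair_measure space_restrict_space norm_mult)

lemma measurable_circle_times [measurable (raw)]:
  "f \<in> M \<rightarrow>\<^sub>M circle_borel \<Longrightarrow> g \<in> M \<rightarrow>\<^sub>M circle_borel \<Longrightarrow> (\<lambda>x. f x * g x) \<in> M \<rightarrow>\<^sub>M circle_borel"
  using measurable_compose[OF measurable_Pair measurable_circle_mult, of f M g] by simp

lemma measurable_circle_inverse [measurable]:
  "inverse \<in> circle_borel \<rightarrow>\<^sub>M circle_borel"
proof (rule measurable_restrict_space2)
  have [measurable]: "(\<lambda>x. x) \<in> circle_borel \<rightarrow>\<^sub>M borel"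
    by (rule measurable_restrict_space1) simp
  show "inverse \<in> borel_measurable circle_borel"
    by measurable
qed (auto simp: space_restrict_space norm_inverse)

text \<open>In the angle parameter a rotation is the translation by \<open>a\<close>; the part of
  \<open>[a, a+1)\<close> beyond 1 is moved back by periodicity.\<close>

lemma nn_integral_circle_rotate:
  assumes [measurable]: "f \<in> borel_measurable circle_borel" and w: "cmod w = 1"
  shows "(\<integral>\<^sup>+z. f (w * z) \<partial>circle_haar) = integral\<^sup>N circle_haar f"
proof -
  obtain a where a: "0 \<le> a" "a < 1" "w = cis (2 * pi * a)"
    using unit_complex_cis[OF w] .
  define \<phi> where "\<phi> t = f (cis (2 * pi * t))" for t :: real
  have [measurable]: "\<phi> \<in> borel_measurable borel"
    unfolding \<phi>_def by measurable
  have per: "\<phi> (1 + t) = \<phi> t" for t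
    by (simp add: \<phi>_def cis_conv_exp algebra_simps exp_add)
  have [measurable]: "(\<lambda>z. w * z) \<in> circle_borel \<rightarrow>\<^sub>M circle_borel"
    using w by (intro measurable_circle_times measurable_const) (auto simp: space_restrict_space)
  have "(\<integral>\<^sup>+z. f (w * z) \<partial>circle_haar) = (\<integral>\<^sup>+t. \<phi> (a + t) * indicator {0..<1} t \<partial>lborel)"
    by (subst nn_integral_circle_haar)
       (auto simp: \<phi>_def a cis_mult algebra_simps intro!: nn_integral_cong)
  also have "\<dots> = (\<integral>\<^sup>+t. \<phi> t * indicator {a..<a+1} t \<partial>lborel)"
    by (subst (2) nn_integral_real_affine[where c=1 and t=a])
       (auto intro!: nn_integral_cong simp: indicator_def)
  also have "\<dots> = (\<integral>\<^sup>+t. \<phi> t * indicator {a..<1} t + \<phi> t * indicator {1..<a+1} t \<partial>lborel)"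
    using a by (intro nn_integral_cong) (auto simp: indicator_def)
  also have "\<dots> = (\<integral>\<^sup>+t. \<phi> t * indicator {a..<1} t \<partial>lborel) + (\<integral>\<^sup>+t. \<phi> t * indicator {1..<a+1} t \<partial>lborel)"
    by (rule nn_integral_add) auto
  also have "(\<integral>\<^sup>+t. \<phi> t * indicator {1..<a+1} t \<partial>lborel) = (\<integral>\<^sup>+t. \<phi> t * indicator {0..<a} t \<partial>lborel)"
    by (subst nn_integral_real_affine[where c=1 and t=1])
       (auto intro!: nn_integral_cong simp: indicator_def per)
  also have "(\<integral>\<^sup>+t. \<phi> t * indicator {a..<1} t \<partial>lborel) + \<dots> =
      (\<integral>\<^sup>+t. \<phi> t * indicator {a..<1} t + \<phi> t * indicator {0..<a} t \<partial>lborel)"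
    by (rule nn_integral_add[symmetric]) auto
  also have "\<dots> = (\<integral>\<^sup>+t. \<phi> t * indicator {0..<1} t \<partial>lborel)"
    using a by (intro nn_integral_cong) (auto simp: indicator_def)
  also have "\<dots> = integral\<^sup>N circle_haar f"
    by (subst nn_integral_circle_haar) (auto simp: \<phi>_def)
  finally show ?thesis .
qed

text \<open>Inversion becomes \<open>t \<mapsto> 1 - t\<close> in the angle parameter, again by
  periodicity.\<close>

lemma nn_integral_circle_inverse:
  assumes [measurable]: "f \<in> borel_measurable circle_borel"
  shows "(\<integral>\<^sup>+z. f (inverse z) \<partial>circle_haar) = integral\<^sup>N circle_haar f"
proof -
  define \<phi> where "\<phi> t = f (cis (2 * pi * t))" for t :: real
  have [measurable]: "\<phi> \<in> borel_measurable borel"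
    unfolding \<phi>_def by measurable
  have inv: "f (cis (- (2 * pi * t))) = \<phi> (1 - t)" for t
    by (simp add: \<phi>_def cis_conv_exp algebra_simps exp_diff exp_minus divide_inverse)
  have "(\<integral>\<^sup>+z. f (inverse z) \<partial>circle_haar) = (\<integral>\<^sup>+t. \<phi> (1 - t) * indicator {0..<1} t \<partial>lborel)"
    by (subst nn_integral_circle_haar) (auto simp: inv)
  also have "\<dots> = (\<integral>\<^sup>+t. \<phi> t * indicator {0<..1} t \<partial>lborel)"
    by (subst (2) nn_integral_real_affine[where c="-1" and t=1])
       (auto intro!: nn_integral_cong simp: indicator_def)
  \<comment> \<open>The reflection turns \<open>[0,1)\<close> into \<open>(0,1]\<close>; the two
    differ by a null set.\<close>
  also have "\<dots> = (\<integral>\<^sup>+t. \<phi> t * indicator {0..<1} t \<partial>lborel)"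
    by (intro nn_integral_cong_AE AE_I'[where N="{0, 1}"] finite_imp_null_set_lborel)
       (auto simp: indicator_def split: if_splits)
  also have "\<dots> = integral\<^sup>N circle_haar f"
    by (subst nn_integral_circle_haar) (auto simp: \<phi>_def)
  finally show ?thesis .
qed

lemma distr_circle_rotate:
  assumes "cmod w = 1"
  shows "distr circle_haar circle_borel (\<lambda>z. w * z) = circle_haar"
proof (rule measure_eqI)
  have [measurable]: "(\<lambda>z. w * z) \<in> circle_borel \<rightarrow>\<^sub>M circle_borel"
    using assms by (intro measurable_circle_times measurable_const) (auto simp: space_restrict_space)
  fix A assume "A \<in> sets (distr circle_haar circle_borel (\<lambda>z. w * z))"
  then have [measurable]: "A \<in> sets circle_borel" by simp
  have "emeasure (distr circle_haar circle_borel (\<lambda>z. w * z)) A = (\<integral>\<^sup>+z. indicator A (w * z) \<partial>circle_haar)"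
    by (subst nn_integral_indicator[symmetric], simp, subst nn_integral_distr) auto
  also have "\<dots> = emeasure circle_haar A"
    using nn_integral_circle_rotate[of "indicator A" w] assms by simp
  finally show "emeasure (distr circle_haar circle_borel (\<lambda>z. w * z)) A = emeasure circle_haar A" .
qed simp

lemma distr_circle_inverse: "distr circle_haar circle_borel inverse = circle_haar"
proof (rule measure_eqI)
  fix A assume "A \<in> sets (distr circle_haar circle_borel inverse)"
  then have [measurable]: "A \<in> sets circle_borel" by simp
  have "emeasure (distr circle_haar circle_borel inverse) A = (\<integral>\<^sup>+z. indicator A (inverse z) \<partial>circle_haar)"
    by (subst nn_integral_indicator[symmetric], simp, subst nn_integral_distr) auto
  also have "\<dots> = emeasure circle_haar A"
    using nn_integral_circle_inverse[of "indicator A"] by simp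
  finally show "emeasure (distr circle_haar circle_borel inverse) A = emeasure circle_haar A" .
qed simp

lemma measurable_circle_id [measurable]: "(\<lambda>z. z) \<in> borel_measurable circle_borel"
  by (rule measurable_restrict_space1) simp

lemma circle_integrable_bounded:
  fixes f :: "complex \<Rightarrow> complex"
  assumes "f \<in> borel_measurable circle_borel" "\<And>z. cmod z = 1 \<Longrightarrow> cmod (f z) \<le> B"
  shows "integrable circle_haar f"
proof -
  interpret prob_space circle_haar by (rule prob_space_circle_haar)
  show ?thesis
  proof (rule integrable_const_bound[where B=B])
    show "f \<in> borel_measurable circle_haar" using assms(1) by measurable
  qed (auto intro!: AE_I2 assms(2))
qed

lemma integral_circle_rotate:
  fixes f :: "complex \<Rightarrow> complex"
  assumes [measurable]: "f \<in> borel_measurable circle_borel" and "cmod w = 1"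
  shows "(\<integral>z. f (w * z) \<partial>circle_haar) = integral\<^sup>L circle_haar f"
proof -
  have [measurable]: "(\<lambda>z. w * z) \<in> circle_borel \<rightarrow>\<^sub>M circle_borel"
    using assms by (intro measurable_circle_times measurable_const) (auto simp: space_restrict_space)
  have "integral\<^sup>L circle_haar f = integral\<^sup>L (distr circle_haar circle_borel (\<lambda>z. w * z)) f"
    by (simp add: distr_circle_rotate assms)
  also have "\<dots> = (\<integral>z. f (w * z) \<partial>circle_haar)"
    by (rule integral_distr) auto
  finally show ?thesis by simp
qed

lemma integral_circle_inverse:
  fixes f :: "complex \<Rightarrow> complex"
  assumes [measurable]: "f \<in> borel_measurable circle_borel"
  shows "(\<integral>z. f (inverse z) \<partial>circle_haar) = integral\<^sup>L circle_haar f"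
proof -
  have "integral\<^sup>L circle_haar f = integral\<^sup>L (distr circle_haar circle_borel inverse) f"
    by (simp add: distr_circle_inverse)
  also have "\<dots> = (\<integral>z. f (inverse z) \<partial>circle_haar)"
    by (rule integral_distr) auto
  finally show ?thesis by simp
qed

lemma measurable_power_int_complex [measurable]:
  "(\<lambda>z. z powi k) \<in> borel_measurable (circle_borel :: complex measure)"
  by (cases "k \<ge> 0") (simp_all add: power_int_def)

lemma norm_power_int_circle [simp]: "cmod z = 1 \<Longrightarrow> cmod (z powi k) = 1"
  by (simp add: norm_power_int)

text \<open>For \<open>k\<close> other than 0, rotation by some \<open>w\<close> with
  \<open>w^k = -1\<close> preserves the integral and also reverses its sign.\<close>

lemma integral_circle_power_int:
  "(\<integral>z. z powi k \<partial>circle_haar) = (if k = 0 then 1 else 0)"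
proof (cases "k = 0")
  case True
  interpret prob_space circle_haar by (rule prob_space_circle_haar)
  show ?thesis using True by (simp add: prob_space[simplified])
next
  case False
  define w where "w = cis (pi / k)"
  have w: "w powi k = -1" "cmod w = 1"
    using False by (simp_all add: w_def cis_power_int)
  have "(\<integral>z. z powi k \<partial>circle_haar) = (\<integral>z. (w * z) powi k \<partial>circle_haar)"
    using integral_circle_rotate[of "\<lambda>z. z powi k" w] w by simp
  also have "\<dots> = - (\<integral>z. z powi k \<partial>circle_haar)"
    by (simp add: power_int_mult_distrib w)
  finally show ?thesis using False by simp
qed

section \<open>Fourier expansion of the Poisson kernel\<close>

text \<open>Real-valued, so that it can enter the complex Bochner integrals in which Fourier
  coefficients are computed; the density in \<open>poisson_measure\<close> is its image under
  \<open>ennreal\<close>.\<close>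

definition poisson_kernel :: "real \<Rightarrow> complex \<Rightarrow> real" where
  "poisson_kernel r z = (1 - r\<^sup>2) / (cmod (1 - complex_of_real r * z))\<^sup>2"

lemma measurable_poisson_kernel [measurable]:
  "poisson_kernel r \<in> borel_measurable circle_borel"
  unfolding poisson_kernel_def by measurable

lemma poisson_kernel_nonneg: "0 \<le> r \<Longrightarrow> r < 1 \<Longrightarrow> 0 \<le> poisson_kernel r z"
  by (simp add: poisson_kernel_def power_le_one)

text \<open>On the circle \<open>cnj z = inverse z\<close>, so the denominator factors as
  \<open>(1 - r * z) * (1 - r * inverse z)\<close>, and partial fractions leave two geometric
  series. Removing the constant term and pairing the orders \<open>k\<close> and \<open>-k\<close>
  gives a series over \<open>nat\<close> instead of \<open>int\<close>.\<close>

lemma poisson_kernel_sums: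
  assumes r: "0 \<le> r" "r < 1" and z: "cmod z = 1"
  shows "(\<lambda>n. complex_of_real r ^ Suc n * (z powi int (Suc n) + z powi - int (Suc n)))
    sums (complex_of_real (poisson_kernel r z) - 1)"
proof -
  let ?r = "complex_of_real r"
  have geo: "(\<lambda>n. (?r * u) ^ Suc n) sums (?r * u / (1 - ?r * u))" if "cmod u = 1" for u
  proof -
    have "cmod (?r * u) < 1" using r that by (simp add: norm_mult)
    from sums_mult[OF geometric_sums[OF this], of "?r * u"] show ?thesis by simp
  qed
  have z0: "z \<noteq> 0" using z by auto
  have iz: "cmod (inverse z) = 1" using z by (simp add: norm_inverse)
  have cz: "cnj z = inverse z"
    using z z0 by (simp add: field_simps complex_norm_square[symmetric] mult.commute)
  have ne: "1 - ?r * z \<noteq> 0" "1 - ?r * inverse z \<noteq> 0"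
  proof -
    have "cmod (?r * z) \<noteq> cmod 1" "cmod (?r * inverse z) \<noteq> cmod 1"
      using r z iz by (simp_all add: norm_mult)
    then show "1 - ?r * z \<noteq> 0" "1 - ?r * inverse z \<noteq> 0" by auto
  qed
  have "complex_of_real ((cmod (1 - ?r * z))\<^sup>2) = (1 - ?r * z) * (1 - ?r * inverse z)"
    unfolding complex_norm_square by (simp add: cz)
  then have "complex_of_real (poisson_kernel r z) = (1 - ?r\<^sup>2) / ((1 - ?r * z) * (1 - ?r * inverse z))"
    unfolding poisson_kernel_def of_real_divide by simp
  then have "complex_of_real (poisson_kernel r z) - 1 =
      ((1 - ?r\<^sup>2) - (1 - ?r * z) * (1 - ?r * inverse z)) / ((1 - ?r * z) * (1 - ?r * inverse z))"
    using ne by (simp only: diff_divide_distrib) simp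
  also have "(1 - ?r\<^sup>2) - (1 - ?r * z) * (1 - ?r * inverse z) =
      ?r * z * (1 - ?r * inverse z) + ?r * inverse z * (1 - ?r * z)"
  proof -
    have "z * inverse z = 1" using z0 by simp
    then show ?thesis by algebra
  qed
  also have "(?r * z * (1 - ?r * inverse z) + ?r * inverse z * (1 - ?r * z)) / ((1 - ?r * z) * (1 - ?r * inverse z)) =
      ?r * z / (1 - ?r * z) + ?r * inverse z / (1 - ?r * inverse z)"
    by (rule add_frac_eq[symmetric]) (rule ne)+
  finally have "complex_of_real (poisson_kernel r z) - 1 =
      ?r * z / (1 - ?r * z) + ?r * inverse z / (1 - ?r * inverse z)" .
  moreover have "(\<lambda>n. (?r * z) ^ Suc n + (?r * inverse z) ^ Suc n)
      sums (?r * z / (1 - ?r * z) + ?r * inverse z / (1 - ?r * inverse z))"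
    by (intro sums_add geo z iz)
  moreover have "(?r * z) ^ Suc n + (?r * inverse z) ^ Suc n =
      ?r ^ Suc n * (z powi int (Suc n) + z powi - int (Suc n))" for n
    by (simp only: power_mult_distrib power_int_minus power_int_of_nat power_inverse distrib_left)
  ultimately show ?thesis by simp
qed

lemma poisson_kernel_bounded:
  assumes "0 \<le> r" "r < 1" "cmod z = 1"
  shows "poisson_kernel r z \<le> (1 - r\<^sup>2) / (1 - r)\<^sup>2"
proof -
  have "1 - r \<le> cmod (1 - complex_of_real r * z)"
    using norm_triangle_ineq2[of 1 "complex_of_real r * z"] assms by (simp add: norm_mult)
  then show ?thesis
    unfolding poisson_kernel_def using assms
    by (intro divide_left_mono mult_pos_pos power_mono) (auto simp: power_le_one)
qed

text \<open>Termwise integration of the expansion, with the summable majorant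
  \<open>2 * B * r ^ Suc n\<close>. With \<open>F\<close> a power it yields the moments, with
  \<open>F\<close> a translated kernel the semigroup law.\<close>

lemma integral_poisson_kernel_sums:
  fixes F :: "complex \<Rightarrow> complex"
  assumes r: "0 \<le> r" "r < 1" and [measurable]: "F \<in> borel_measurable circle_borel"
    and B: "\<And>z. cmod z = 1 \<Longrightarrow> cmod (F z) \<le> B"
  shows "(\<lambda>n. complex_of_real r ^ Suc n *
      ((\<integral>z. F z * z powi int (Suc n) \<partial>circle_haar) + (\<integral>z. F z * z powi - int (Suc n) \<partial>circle_haar)))
    sums ((\<integral>z. F z * poisson_kernel r z \<partial>circle_haar) - (\<integral>z. F z \<partial>circle_haar))"
proof -
  interpret prob_space circle_haar by (rule prob_space_circle_haar)
  let ?g = "\<lambda>n z. F z * (complex_of_real r ^ Suc n * (z powi int (Suc n) + z powi - int (Suc n)))"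
  have B0: "0 \<le> B" by (rule order_trans[OF norm_ge_zero B[of 1]]) simp
  have int1: "integrable circle_haar (\<lambda>z. F z * z powi k)" for k
    by (rule circle_integrable_bounded[where B=B]) (auto simp: norm_mult B)
  have intF: "integrable circle_haar F"
    by (rule circle_integrable_bounded[where B=B]) (auto simp: B)
  have intP: "integrable circle_haar (\<lambda>z. F z * poisson_kernel r z)"
  proof (rule circle_integrable_bounded)
    show "cmod (F z * poisson_kernel r z) \<le> B * ((1 - r\<^sup>2) / (1 - r)\<^sup>2)" if "cmod z = 1" for z
      unfolding norm_mult using that
      by (intro mult_mono B B0) (auto simp: poisson_kernel_nonneg poisson_kernel_bounded r)
  qed measurable
  have bound: "cmod (?g n z) \<le> 2 * B * r ^ Suc n" if "cmod z = 1" for n z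
  proof -
    have "cmod (z powi int (Suc n) + z powi - int (Suc n)) \<le> 2"
      using norm_triangle_ineq[of "z powi int (Suc n)" "z powi - int (Suc n)"] that
      by (simp del: power_int_of_nat power_int_minus)
    then have "cmod (?g n z) \<le> B * (r ^ Suc n * 2)"
      unfolding norm_mult using r that B[OF that]
      by (intro mult_mono B B0) (auto simp: norm_mult norm_power)
    then show ?thesis by (simp add: mult_ac)
  qed
  have intg: "integrable circle_haar (?g n)" for n
  proof (rule circle_integrable_bounded)
    show "?g n \<in> borel_measurable circle_borel" by measurable
  qed (rule bound)
  have summ: "summable (\<lambda>n. 2 * B * r ^ Suc n)"
    using r by (intro summable_mult summable_Suc_iff[THEN iffD2] summable_geometric) auto
  have "(\<lambda>n. integral\<^sup>L circle_haar (?g n)) sums (\<integral>z. (\<Sum>n. ?g n z) \<partial>circle_haar)"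
  proof (rule sums_integral[OF intg])
    show "AE z in circle_haar. summable (\<lambda>n. cmod (?g n z))"
      using bound by (intro AE_I2 summable_comparison_test'[OF summ, of 0]) auto
    show "summable (\<lambda>n. \<integral>z. cmod (?g n z) \<partial>circle_haar)"
    proof (rule summable_comparison_test'[OF summ, of 0])
      fix n
      have "(\<integral>z. cmod (?g n z) \<partial>circle_haar) \<le> 2 * B * r ^ Suc n"
        using intg bound by (intro integral_le_const integrable_norm AE_I2) auto
      then show "norm (\<integral>z. cmod (?g n z) \<partial>circle_haar) \<le> 2 * B * r ^ Suc n"
        by simp
    qed
  qed
  moreover have "(\<integral>z. (\<Sum>n. ?g n z) \<partial>circle_haar) = (\<integral>z. F z * poisson_kernel r z - F z \<partial>circle_haar)"
  proof (rule Bochner_Integration.integral_cong[OF refl])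
    fix z assume "z \<in> space circle_haar"
    then show "(\<Sum>n. ?g n z) = F z * poisson_kernel r z - F z"
      using sums_unique[OF sums_mult[OF poisson_kernel_sums[OF r, of z], of "F z"]]
      by (simp add: algebra_simps del: power_int_of_nat power_int_minus)
  qed
  moreover have "integral\<^sup>L circle_haar (?g n) = complex_of_real r ^ Suc n *
      ((\<integral>z. F z * z powi int (Suc n) \<partial>circle_haar) + (\<integral>z. F z * z powi - int (Suc n) \<partial>circle_haar))" for n
  proof -
    have "?g n = (\<lambda>z. complex_of_real r ^ Suc n * (F z * z powi int (Suc n) + F z * z powi - int (Suc n)))"
      by (simp only: distrib_left mult.left_commute)
    then show ?thesis
      using int1 by (simp del: power_int_of_nat power_int_minus power_Suc of_nat_Suc)
  qed
  ultimately show ?thesis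
    using intF intP by (simp del: power_int_of_nat power_int_minus power_Suc of_nat_Suc)
qed

text \<open>By orthogonality of the powers, at most one term of the integrated expansion
  survives.\<close>

lemma poisson_kernel_moment:
  assumes r: "0 \<le> r" "r < 1"
  shows "(\<integral>z. z powi k * poisson_kernel r z \<partial>circle_haar) = complex_of_real r ^ nat \<bar>k\<bar>"
proof -
  let ?t = "\<lambda>n. complex_of_real r ^ Suc n * ((if k + int (Suc n) = 0 then 1 else 0) + (if k + - int (Suc n) = 0 then 1 else 0))"
  have mult: "(\<integral>z. z powi k * z powi j \<partial>circle_haar) = (if k + j = 0 then 1 else 0)" for j
  proof -
    have "(\<integral>z. z powi k * z powi j \<partial>circle_haar) = (\<integral>z. z powi (k + j) \<partial>circle_haar)"
      by (intro Bochner_Integration.integral_cong refl power_int_add[symmetric]) auto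
    then show ?thesis by (simp add: integral_circle_power_int)
  qed
  have s: "?t sums ((\<integral>z. z powi k * poisson_kernel r z \<partial>circle_haar) - (if k = 0 then 1 else 0))"
  proof -
    have "cmod (z powi k) \<le> 1" if "cmod z = 1" for z using that by simp
    from integral_poisson_kernel_sums[OF r measurable_power_int_complex this] show ?thesis
      unfolding mult integral_circle_power_int by simp
  qed
  \<comment> \<open>The surviving index is \<open>\<bar>k\<bar> - 1\<close>. For
    \<open>k = 0\<close> truncated subtraction gives the index 0, whose term is 0, as it should
    be.\<close>
  have "?t sums (\<Sum>n\<in>{nat \<bar>k\<bar> - 1}. ?t n)"
    by (rule sums_finite) auto
  then have "(\<integral>z. z powi k * poisson_kernel r z \<partial>circle_haar) - (if k = 0 then 1 else 0) = ?t (nat \<bar>k\<bar> - 1)"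
    using s sums_unique2 by fastforce
  moreover have "?t (nat \<bar>k\<bar> - 1) = (if k = 0 then 0 else complex_of_real r ^ nat \<bar>k\<bar>)"
    by (cases "k > 0"; cases "k = 0") (auto simp: Suc_diff_1)
  ultimately show ?thesis by (auto split: if_splits)
qed

text \<open>Inversion on the circle is conjugation and conjugates \<open>1 - r * z\<close>. This
  symmetry is the source of the reversibility of the walk.\<close>

lemma poisson_kernel_inverse: "cmod z = 1 \<Longrightarrow> poisson_kernel r (inverse z) = poisson_kernel r z"
proof -
  assume z: "cmod z = 1"
  then have cz: "inverse z = cnj z"
    by (metis complex_div_cnj div_by_1 inverse_eq_divide mult_1 of_real_1 power_one)
  have "cmod (1 - complex_of_real r * cnj z) = cmod (cnj (1 - complex_of_real r * z))"
    by simp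
  then show ?thesis unfolding poisson_kernel_def cz complex_mod_cnj by simp
qed

text \<open>Semigroup law by Fourier coefficients: the kernel for \<open>b\<close> is expanded, the
  translated kernel for \<open>a\<close> is integrated against each power, and
  \<open>a^n * b^n = (a * b)^n\<close> lets the series be summed again.\<close>

lemma poisson_kernel_convolution:
  assumes a: "0 \<le> a" "a < 1" and b: "0 \<le> b" "b < 1" and w: "cmod w = 1"
  shows "(\<integral>z. complex_of_real (poisson_kernel a (w * inverse z)) * poisson_kernel b z \<partial>circle_haar) = poisson_kernel (a * b) w"
proof -
  let ?F = "\<lambda>z. complex_of_real (poisson_kernel a (w * inverse z))"
  have w0: "w \<noteq> 0" using w by auto
  have [measurable]: "(\<lambda>z. w * z) \<in> circle_borel \<rightarrow>\<^sub>M circle_borel"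
    using w by (intro measurable_circle_times measurable_const) (auto simp: space_restrict_space)
  have [measurable]: "(\<lambda>z. w * inverse z) \<in> circle_borel \<rightarrow>\<^sub>M circle_borel"
    using measurable_compose[OF measurable_circle_inverse, of "\<lambda>z. w * z"] by simp
  have coef: "(\<integral>z. ?F z * z powi k \<partial>circle_haar) = w powi k * complex_of_real a ^ nat \<bar>k\<bar>" for k
  proof -
    \<comment> \<open>Writing \<open>z^k\<close> as \<open>w^k * (w / z)^-k\<close> makes the
      integrand a function of \<open>w / z\<close> alone; inversion and rotation then remove
      \<open>w\<close>.\<close>
    let ?G = "\<lambda>z. w powi k * (z powi (-k) * poisson_kernel a z)"
    have "(\<integral>z. ?F z * z powi k \<partial>circle_haar) = (\<integral>z. ?G (w * inverse z) \<partial>circle_haar)"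
      using w0 by (intro Bochner_Integration.integral_cong refl)
        (auto simp: power_int_mult_distrib power_int_minus power_int_inverse power_int_divide_distrib field_simps)
    also have "\<dots> = (\<integral>z. ?G (w * z) \<partial>circle_haar)"
      by (rule integral_circle_inverse[of "\<lambda>z. ?G (w * z)"]) measurable
    also have "\<dots> = integral\<^sup>L circle_haar ?G"
      by (rule integral_circle_rotate[of ?G]) (use w in measurable)
    also have "\<dots> = w powi k * complex_of_real a ^ nat \<bar>k\<bar>"
      using poisson_kernel_moment[OF a, of "-k"] by simp
    finally show ?thesis .
  qed
  have coef0: "integral\<^sup>L circle_haar ?F = 1"
    using coef[of 0] by simp
  have ab: "0 \<le> a * b" "a * b < 1"
    using a b mult_strict_mono[of a 1 b 1] by (auto simp: zero_le_mult_iff)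
  have "(\<lambda>n. complex_of_real b ^ Suc n *
      (w powi int (Suc n) * complex_of_real a ^ nat \<bar>int (Suc n)\<bar> + w powi - int (Suc n) * complex_of_real a ^ nat \<bar>- int (Suc n)\<bar>))
     sums ((\<integral>z. ?F z * poisson_kernel b z \<partial>circle_haar) - 1)"
  proof -
    have F: "?F \<in> borel_measurable circle_borel" by measurable
    have "cmod (?F z) \<le> (1 - a\<^sup>2) / (1 - a)\<^sup>2" if "cmod z = 1" for z
      using poisson_kernel_bounded[OF a, of "w * inverse z"] poisson_kernel_nonneg[OF a] w that
      by (simp add: norm_mult norm_inverse)
    from integral_poisson_kernel_sums[OF b F this] show ?thesis
      unfolding coef coef0 .
  qed
  moreover have "complex_of_real b ^ Suc n *
      (w powi int (Suc n) * complex_of_real a ^ nat \<bar>int (Suc n)\<bar> + w powi - int (Suc n) * complex_of_real a ^ nat \<bar>- int (Suc n)\<bar>)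
     = complex_of_real (a * b) ^ Suc n * (w powi int (Suc n) + w powi - int (Suc n))" for n
    by (simp only: abs_minus abs_of_nat nat_int of_real_mult power_mult_distrib algebra_simps)
  ultimately have "(\<integral>z. ?F z * poisson_kernel b z \<partial>circle_haar) - 1 = complex_of_real (poisson_kernel (a * b) w) - 1"
    using poisson_kernel_sums[OF ab w] sums_unique2 by (simp only:) blast
  then show ?thesis by simp
qed

section \<open>Poisson measures on the circle: mass, symmetry, second moment, semigroup law\<close>

lemma sets_poisson_measure [simp, measurable_cong]: "sets (poisson_measure r) = sets circle_borel"
  by (simp add: poisson_measure_def)

lemma space_poisson_measure [simp]: "space (poisson_measure r) = sphere 0 1"
  by (simp add: poisson_measure_def)

lemma nn_integral_poisson_measure:
  assumes [measurable]: "f \<in> borel_measurable circle_borel"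
  shows "integral\<^sup>N (poisson_measure r) f =
    (if r < 1 then \<integral>\<^sup>+z. ennreal (poisson_kernel r z) * f z \<partial>circle_haar else f 1)"
proof (cases "r < 1")
  case True
  have "(\<lambda>z. ennreal (poisson_kernel r z)) \<in> borel_measurable circle_haar"
    "f \<in> borel_measurable circle_haar"
    by measurable
  with True show ?thesis
    by (simp add: poisson_measure_def nn_integral_density flip: poisson_kernel_def)
next
  case False
  have "f \<in> borel_measurable circle_haar" by measurable
  with False show ?thesis
    by (simp add: poisson_measure_def nn_integral_return)
qed

text \<open>Carries a Fourier computation with complex Bochner integrals over to
  \<open>[0,\<infinity>]\<close>-valued integrals; the bound \<open>B\<close> supplies
  integrability.\<close>

lemma nn_integral_poisson_kernel_bounded:
  fixes F :: "complex \<Rightarrow> real"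
  assumes r: "0 \<le> r" "r < 1" and [measurable]: "F \<in> borel_measurable circle_borel"
    and F: "\<And>z. cmod z = 1 \<Longrightarrow> 0 \<le> F z" "\<And>z. cmod z = 1 \<Longrightarrow> F z \<le> B"
    and I: "(\<integral>z. complex_of_real (F z) * poisson_kernel r z \<partial>circle_haar) = complex_of_real c"
  shows "(\<integral>\<^sup>+z. ennreal (F z) * ennreal (poisson_kernel r z) \<partial>circle_haar) = ennreal c"
proof -
  have B: "0 \<le> B" using F[of 1] by simp
  have int: "integrable circle_haar (\<lambda>z. complex_of_real (F z * poisson_kernel r z))"
  proof (rule circle_integrable_bounded)
    show "cmod (F z * poisson_kernel r z) \<le> B * ((1 - r\<^sup>2) / (1 - r)\<^sup>2)" if "cmod z = 1" for z
      unfolding norm_of_real abs_mult using that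
      by (intro mult_mono B) (auto simp: poisson_kernel_nonneg poisson_kernel_bounded r F)
  qed measurable
  have "(\<integral>\<^sup>+z. ennreal (F z) * ennreal (poisson_kernel r z) \<partial>circle_haar) =
      (\<integral>\<^sup>+z. ennreal (F z * poisson_kernel r z) \<partial>circle_haar)"
    by (intro nn_integral_cong) (simp add: ennreal_mult'' poisson_kernel_nonneg r)
  also have "\<dots> = ennreal (\<integral>z. F z * poisson_kernel r z \<partial>circle_haar)"
    using int[unfolded complex_of_real_integrable_eq] by (intro nn_integral_eq_integral AE_I2)
      (auto simp: F poisson_kernel_nonneg r)
  also have "complex_of_real (\<integral>z. F z * poisson_kernel r z \<partial>circle_haar) = complex_of_real c"
    using I by (simp flip: of_real_mult)
  then have "(\<integral>z. F z * poisson_kernel r z \<partial>circle_haar) = c"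
    by simp
  finally show ?thesis .
qed

text \<open>For \<open>r < 1\<close> the total mass is the moment of order 0.\<close>

lemma prob_space_poisson_measure:
  assumes "0 \<le> r" "r \<le> 1"
  shows "prob_space (poisson_measure r)"
proof
  have "emeasure (poisson_measure r) (space (poisson_measure r)) = (\<integral>\<^sup>+z. 1 \<partial>poisson_measure r)"
    by simp
  also have "\<dots> = 1"
  proof (cases "r < 1")
    case True
    then have "(\<integral>\<^sup>+z. ennreal 1 * ennreal (poisson_kernel r z) \<partial>circle_haar) = ennreal 1"
      using poisson_kernel_moment[of r 0] assms
      by (intro nn_integral_poisson_kernel_bounded[where B=1]) auto
    with True show ?thesis
      by (subst nn_integral_poisson_measure) auto
  qed (subst nn_integral_poisson_measure; simp)
  finally show "emeasure (poisson_measure r) (space (poisson_measure r)) = 1" .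
qed

lemma nn_integral_poisson_inverse:
  assumes [measurable]: "f \<in> borel_measurable circle_borel"
  shows "(\<integral>\<^sup>+y. f (inverse y) \<partial>poisson_measure r) = integral\<^sup>N (poisson_measure r) f"
proof (cases "r < 1")
  case True
  have "(\<integral>\<^sup>+y. f (inverse y) \<partial>poisson_measure r) =
      (\<integral>\<^sup>+z. ennreal (poisson_kernel r (inverse z)) * f (inverse z) \<partial>circle_haar)"
    using True by (subst nn_integral_poisson_measure) (auto intro!: nn_integral_cong simp: poisson_kernel_inverse)
  also have "\<dots> = (\<integral>\<^sup>+z. ennreal (poisson_kernel r z) * f z \<partial>circle_haar)"
    by (rule nn_integral_circle_inverse) measurable
  also have "\<dots> = integral\<^sup>N (poisson_measure r) f"
    using True by (subst nn_integral_poisson_measure) auto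
  finally show ?thesis .
next
  case False
  then show ?thesis
    by (subst (1 2) nn_integral_poisson_measure) auto
qed

text \<open>On the circle \<open>\<bar>z - 1\<bar>^2 = 2 - z - inverse z\<close>, and both powers
  have moment \<open>r\<close>. This measures how the measure concentrates at 1 as \<open>r\<close>
  tends to 1.\<close>

lemma nn_integral_poisson_second_moment:
  assumes r: "0 \<le> r" "r \<le> 1"
  shows "(\<integral>\<^sup>+y. ennreal ((cmod (y - 1))\<^sup>2) \<partial>poisson_measure r) = ennreal (2 - 2 * r)"
proof (cases "r < 1")
  case True
  have eq: "complex_of_real ((cmod (z - 1))\<^sup>2) = 2 - z powi 1 - z powi - 1" if z: "cmod z = 1" for z
  proof -
    have z0: "z \<noteq> 0" using z by auto
    have "cnj z * z = 1" using z by (simp add: mult.commute flip: complex_norm_square)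
    then have cz: "cnj z = inverse z"
      using z0 by (simp add: field_simps)
    show ?thesis
      unfolding complex_norm_square using z0 by (simp add: cz algebra_simps power_int_minus)
  qed
  have int: "integrable circle_haar (\<lambda>z. c * (z powi k * poisson_kernel r z))" for c k
  proof (rule circle_integrable_bounded)
    show "cmod (c * (z powi k * poisson_kernel r z)) \<le> cmod c * (1 * ((1 - r\<^sup>2) / (1 - r)\<^sup>2))" if "cmod z = 1" for z
      unfolding norm_mult norm_of_real using that True r
      by (intro mult_mono) (auto simp: poisson_kernel_nonneg poisson_kernel_bounded)
  qed measurable
  have "(\<integral>z. complex_of_real ((cmod (z - 1))\<^sup>2) * poisson_kernel r z \<partial>circle_haar) =
      (\<integral>z. 2 * (z powi 0 * poisson_kernel r z) - 1 * (z powi 1 * poisson_kernel r z) - 1 * (z powi - 1 * poisson_kernel r z) \<partial>circle_haar)"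
    by (intro Bochner_Integration.integral_cong refl) (auto simp: eq algebra_simps simp del: of_real_power)
  also have "\<dots> = 2 * (\<integral>z. z powi 0 * poisson_kernel r z \<partial>circle_haar)
      - 1 * (\<integral>z. z powi 1 * poisson_kernel r z \<partial>circle_haar) - 1 * (\<integral>z. z powi - 1 * poisson_kernel r z \<partial>circle_haar)"
    by (subst Bochner_Integration.integral_diff; (intro Bochner_Integration.integrable_diff int)?)+
      (simp only: integral_mult_right_zero)
  also have "\<dots> = complex_of_real (2 - 2 * r)"
    unfolding poisson_kernel_moment[OF r(1) True] by simp
  finally have "(\<integral>\<^sup>+z. ennreal ((cmod (z - 1))\<^sup>2) * ennreal (poisson_kernel r z) \<partial>circle_haar) = ennreal (2 - 2 * r)"
  proof (intro nn_integral_poisson_kernel_bounded[where B=4] r True)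
    fix z :: complex assume "cmod z = 1"
    then have "cmod (z - 1) \<le> 2"
      using norm_triangle_ineq4[of z 1] by simp
    then have "(cmod (z - 1))\<^sup>2 \<le> 2\<^sup>2"
      by (rule power_mono) simp
    then show "(cmod (z - 1))\<^sup>2 \<le> 4" by simp
  qed auto
  with True show ?thesis
    by (subst nn_integral_poisson_measure) (auto simp: mult.commute)
next
  case False
  with r have "r = 1" by simp
  then show ?thesis
    by (subst nn_integral_poisson_measure) auto
qed

text \<open>A radius 1 gives a point mass and is treated separately. Otherwise rotation invariance
  moves \<open>x\<close> from \<open>f\<close> into the second kernel, and after exchanging the
  integrals the inner one is the convolution of two kernels.\<close>

lemma nn_integral_poisson_convolution:
  assumes a: "0 \<le> a" "a \<le> 1" and b: "0 \<le> b" "b \<le> 1" and [measurable]: "f \<in> borel_measurable circle_borel"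
  shows "(\<integral>\<^sup>+x. (\<integral>\<^sup>+y. f (x * y) \<partial>poisson_measure b) \<partial>poisson_measure a) = integral\<^sup>N (poisson_measure (a * b)) f"
proof -
  interpret A: prob_space "poisson_measure a" by (rule prob_space_poisson_measure[OF a])
  interpret B: prob_space "poisson_measure b" by (rule prob_space_poisson_measure[OF b])
  interpret H: prob_space circle_haar by (rule prob_space_circle_haar)
  interpret HH: pair_sigma_finite circle_haar circle_haar ..
  have 1 [measurable]: "1 \<in> space circle_borel" by (simp add: space_restrict_space)
  have shift [measurable]: "(\<lambda>y. f (x * y)) \<in> borel_measurable circle_borel" if "cmod x = 1" for x
    using that by (intro measurable_compose[OF measurable_circle_times[OF measurable_const measurable_ident_sets]])
      (auto simp: space_restrict_space)
  have [measurable]: "(\<lambda>x. \<integral>\<^sup>+y. f (x * y) \<partial>poisson_measure b) \<in> borel_measurable circle_borel"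
    by measurable
  consider "a = 1" | "b = 1" | "a < 1" "b < 1" using a b by linarith
  then show ?thesis
  proof cases
    case 1
    then show ?thesis by (subst nn_integral_poisson_measure) auto
  next
    case 2
    have "(\<integral>\<^sup>+x. (\<integral>\<^sup>+y. f (x * y) \<partial>poisson_measure b) \<partial>poisson_measure a) = (\<integral>\<^sup>+x. f x \<partial>poisson_measure a)"
      using 2 by (intro nn_integral_cong) (subst nn_integral_poisson_measure; auto intro: shift)
    then show ?thesis using 2 by simp
  next
    case 3
    then have ab: "a * b < 1" using a b mult_strict_mono[of a 1 b 1] by auto
    have "(\<integral>\<^sup>+x. (\<integral>\<^sup>+y. f (x * y) \<partial>poisson_measure b) \<partial>poisson_measure a) =
        (\<integral>\<^sup>+x. ennreal (poisson_kernel a x) * (\<integral>\<^sup>+y. f (x * y) \<partial>poisson_measure b) \<partial>circle_haar)"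
      using 3 by (subst nn_integral_poisson_measure) auto
    also have "\<dots> = (\<integral>\<^sup>+x. ennreal (poisson_kernel a x) * (\<integral>\<^sup>+y. ennreal (poisson_kernel b (inverse x * y)) * f y \<partial>circle_haar) \<partial>circle_haar)"
    proof (intro nn_integral_cong arg_cong2[where f="(*)"] refl)
      fix x :: complex assume "x \<in> space circle_haar"
      then have x: "cmod x = 1" "x \<noteq> 0" by auto
      have [measurable]: "(\<lambda>y. inverse x * y) \<in> circle_borel \<rightarrow>\<^sub>M circle_borel"
        using x by (intro measurable_circle_times measurable_const) (auto simp: space_restrict_space norm_inverse)
      have [measurable]: "(\<lambda>y. f (x * y)) \<in> borel_measurable circle_borel"
        using x by (rule_tac shift)
      have "(\<integral>\<^sup>+y. f (x * y) \<partial>poisson_measure b) = (\<integral>\<^sup>+y. ennreal (poisson_kernel b y) * f (x * y) \<partial>circle_haar)"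
        using 3 by (subst nn_integral_poisson_measure) auto
      also have "\<dots> = (\<integral>\<^sup>+y. (\<lambda>y. ennreal (poisson_kernel b (inverse x * y)) * f y) (x * y) \<partial>circle_haar)"
        using x by (intro nn_integral_cong) (auto simp flip: mult.assoc)
      also have "\<dots> = (\<integral>\<^sup>+y. ennreal (poisson_kernel b (inverse x * y)) * f y \<partial>circle_haar)"
        using x by (intro nn_integral_circle_rotate) measurable
      finally show "(\<integral>\<^sup>+y. f (x * y) \<partial>poisson_measure b) = \<dots>" .
    qed
    also have "\<dots> = (\<integral>\<^sup>+x. (\<integral>\<^sup>+y. ennreal (poisson_kernel a x) * (ennreal (poisson_kernel b (inverse x * y)) * f y) \<partial>circle_haar) \<partial>circle_haar)"
      by (intro nn_integral_cong nn_integral_cmult[symmetric]) measurable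
    also have "\<dots> = (\<integral>\<^sup>+y. (\<integral>\<^sup>+x. ennreal (poisson_kernel a x) * (ennreal (poisson_kernel b (inverse x * y)) * f y) \<partial>circle_haar) \<partial>circle_haar)"
      by (rule HH.Fubini'[symmetric]) measurable
    also have "\<dots> = (\<integral>\<^sup>+y. ennreal (poisson_kernel (a * b) y) * f y \<partial>circle_haar)"
    proof (intro nn_integral_cong)
      fix y :: complex assume "y \<in> space circle_haar"
      then have y: "cmod y = 1" by auto
      have yinv [measurable]: "(\<lambda>x. y * inverse x) \<in> circle_borel \<rightarrow>\<^sub>M circle_borel"
        using y by (intro measurable_circle_times measurable_const) (auto simp: space_restrict_space)
      have "(\<integral>\<^sup>+x. ennreal (poisson_kernel a x) * (ennreal (poisson_kernel b (inverse x * y)) * f y) \<partial>circle_haar) =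
          (\<integral>\<^sup>+x. (ennreal (poisson_kernel b (y * inverse x)) * ennreal (poisson_kernel a x)) * f y \<partial>circle_haar)"
        by (intro nn_integral_cong) (simp add: mult_ac)
      also have "\<dots> = (\<integral>\<^sup>+x. ennreal (poisson_kernel b (y * inverse x)) * ennreal (poisson_kernel a x) \<partial>circle_haar) * f y"
        by (rule nn_integral_multc) measurable
      also have "(\<integral>\<^sup>+x. ennreal (poisson_kernel b (y * inverse x)) * ennreal (poisson_kernel a x) \<partial>circle_haar) =
          ennreal (poisson_kernel (a * b) y)"
      proof (rule nn_integral_poisson_kernel_bounded[where B="(1 - b\<^sup>2) / (1 - b)\<^sup>2"])
        show "(\<integral>x. complex_of_real (poisson_kernel b (y * inverse x)) * poisson_kernel a x \<partial>circle_haar) = poisson_kernel (a * b) y"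
          using poisson_kernel_convolution[of b a y] a b 3 y by (simp add: mult.commute)
      qed (use a b 3 y in \<open>auto simp: norm_mult norm_inverse intro!: poisson_kernel_nonneg poisson_kernel_bounded\<close>)
      finally show "(\<integral>\<^sup>+x. ennreal (poisson_kernel a x) * (ennreal (poisson_kernel b (inverse x * y)) * f y) \<partial>circle_haar) =
          ennreal (poisson_kernel (a * b) y) * f y" .
    qed
    also have "\<dots> = integral\<^sup>N (poisson_measure (a * b)) f"
      using ab by (subst nn_integral_poisson_measure) auto
    finally show ?thesis .
  qed
qed

section \<open>Product measures on the torus\<close>

text \<open>Cylinder sets determine a product measure. Writing their indicators as finite products
  allows the hypothesis to be checked one coordinate at a time.\<close>

lemma distr_PiM_eqI:
  fixes K :: "'i \<Rightarrow> 'a measure"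
  assumes K: "\<And>i. prob_space (K i)" and P: "prob_space P"
    and [measurable]: "\<Phi> \<in> P \<rightarrow>\<^sub>M PiM UNIV K"
    and eq: "\<And>J A. finite J \<Longrightarrow> (\<And>j. j \<in> J \<Longrightarrow> A j \<in> sets (K j)) \<Longrightarrow>
      (\<integral>\<^sup>+\<omega>. (\<Prod>j\<in>J. indicator (A j) (\<Phi> \<omega> j)) \<partial>P) = (\<Prod>j\<in>J. emeasure (K j) (A j))"
  shows "distr P (PiM UNIV K) \<Phi> = PiM UNIV K"
proof -
  interpret P: prob_space P by fact
  interpret K: product_prob_space K UNIV
    by (intro product_prob_spaceI K)
  show ?thesis
  proof (rule K.PiM_eq)
    fix J :: "'i set" and A assume J: "finite J" and A: "\<And>j. j \<in> J \<Longrightarrow> A j \<in> sets (K j)"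
    let ?B = "prod_emb UNIV K J (\<Pi>\<^sub>E j\<in>J. A j)"
    have B: "?B \<in> sets (PiM UNIV K)"
      using J A by (intro sets_PiM_I) auto
    have "emeasure (distr P (PiM UNIV K) \<Phi>) ?B = (\<integral>\<^sup>+\<omega>. indicator ?B (\<Phi> \<omega>) \<partial>P)"
      using B by (subst nn_integral_indicator[symmetric], simp, subst nn_integral_distr) auto
    also have "\<dots> = (\<integral>\<^sup>+\<omega>. (\<Prod>j\<in>J. indicator (A j) (\<Phi> \<omega> j)) \<partial>P)"
    proof (rule nn_integral_cong)
      fix \<omega> assume "\<omega> \<in> space P"
      then have "\<Phi> \<omega> \<in> space (PiM UNIV K)" by (rule measurable_space[rotated]) measurable
      then have "indicator ?B (\<Phi> \<omega>) = (if \<forall>j\<in>J. \<Phi> \<omega> j \<in> A j then 1 else 0 :: ennreal)"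
        by (auto simp: prod_emb_def space_PiM restrict_PiE_iff indicator_def)
      also have "\<dots> = (\<Prod>j\<in>J. indicator (A j) (\<Phi> \<omega> j))"
        using J by (auto simp: indicator_def prod_zero_iff intro!: prod.neutral[symmetric])
      finally show "indicator ?B (\<Phi> \<omega>) = (\<Prod>j\<in>J. indicator (A j) (\<Phi> \<omega> j) :: ennreal)" .
    qed
    finally show "emeasure (distr P (PiM UNIV K) \<Phi>) ?B = (\<Prod>j\<in>J. emeasure (K j) (A j))"
      using eq[OF J A] by simp
  qed simp
qed

text \<open>Independence of the coordinates: only those in \<open>J\<close> occur, so the integral
  descends to the finite product over \<open>J\<close>.\<close>

lemma nn_integral_PiM_prod:
  fixes M :: "'i \<Rightarrow> 'a measure"
  assumes M: "\<And>i. prob_space (M i)" and J: "finite J"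
    and f: "\<And>j. j \<in> J \<Longrightarrow> f j \<in> borel_measurable (M j)"
  shows "(\<integral>\<^sup>+x. (\<Prod>j\<in>J. f j (x j)) \<partial>PiM UNIV M) = (\<Prod>j\<in>J. integral\<^sup>N (M j) (f j))"
proof -
  interpret M: product_prob_space M UNIV by (intro product_prob_spaceI M)
  have [measurable]: "(\<lambda>x. restrict x J) \<in> PiM UNIV M \<rightarrow>\<^sub>M PiM J M"
    by (rule measurable_restrict_subset) auto
  have [measurable]: "(\<lambda>x. \<Prod>j\<in>J. f j (x j)) \<in> borel_measurable (PiM J M)"
  proof (rule borel_measurable_prod_ennreal)
    fix j assume "j \<in> J"
    then show "(\<lambda>x. f j (x j)) \<in> borel_measurable (PiM J M)"
      by (intro measurable_compose[OF _ f, of "\<lambda>x. x j"] measurable_component_singleton)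
  qed
  have "(\<integral>\<^sup>+x. (\<Prod>j\<in>J. f j (x j)) \<partial>PiM UNIV M) = (\<integral>\<^sup>+x. (\<Prod>j\<in>J. f j (restrict x J j)) \<partial>PiM UNIV M)"
    by simp
  also have "\<dots> = (\<integral>\<^sup>+x. (\<Prod>j\<in>J. f j (x j)) \<partial>distr (PiM UNIV M) (PiM J M) (\<lambda>x. restrict x J))"
    by (rule nn_integral_distr[symmetric]) measurable
  also have "\<dots> = (\<Prod>j\<in>J. integral\<^sup>N (M j) (f j))"
    using J f by (simp add: M.distr_PiM_restrict_finite M.product_nn_integral_prod)
  finally show ?thesis .
qed

section \<open>Measurability of the group operations on the torus\<close>

abbreviation torus_borel :: "(nat \<Rightarrow> complex) measure" where
  "torus_borel \<equiv> \<Pi>\<^sub>M n\<in>UNIV. circle_borel"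

lemma sets_torus_haar [simp, measurable_cong]: "sets torus_haar = sets torus_borel"
  unfolding torus_haar_def by (intro sets_PiM_cong) auto

lemma sets_torus_poisson [simp, measurable_cong]: "sets (torus_poisson r) = sets torus_borel"
  unfolding torus_poisson_def by (intro sets_PiM_cong) auto

lemma space_torus_borel: "space torus_borel = {x. \<forall>n. cmod (x n) = 1}"
  by (auto simp: space_PiM space_restrict_space PiE_iff)

lemma space_torus_haar [simp]: "space torus_haar = {x. \<forall>n. cmod (x n) = 1}"
  using sets_eq_imp_space_eq[OF sets_torus_haar] by (simp add: space_torus_borel)

lemma space_torus_poisson [simp]: "space (torus_poisson r) = {x. \<forall>n. cmod (x n) = 1}"
  using sets_eq_imp_space_eq[OF sets_torus_poisson] by (simp add: space_torus_borel)

lemma prob_space_torus_haar: "prob_space torus_haar"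
  unfolding torus_haar_def by (intro prob_space_PiM prob_space_circle_haar)

definition unit_radii :: "(nat \<Rightarrow> real) \<Rightarrow> bool" where
  "unit_radii r \<longleftrightarrow> (\<forall>n. 0 \<le> r n \<and> r n \<le> 1)"

lemma prob_space_torus_poisson: "unit_radii r \<Longrightarrow> prob_space (torus_poisson r)"
  unfolding torus_poisson_def unit_radii_def by (intro prob_space_PiM prob_space_poisson_measure) auto

lemma measurable_torus_component [measurable]: "(\<lambda>x. x n) \<in> torus_borel \<rightarrow>\<^sub>M circle_borel"
  by (rule measurable_component_singleton) simp

lemma measurable_torusI:
  assumes "\<And>n. (\<lambda>\<omega>. f \<omega> n) \<in> M \<rightarrow>\<^sub>M circle_borel"
  shows "f \<in> M \<rightarrow>\<^sub>M torus_borel"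
  using assms measurable_space[OF assms]
  by (intro measurable_PiM_single') (auto simp: space_restrict_space PiE_iff)

lemma measurable_torus_times [measurable (raw)]:
  assumes "f \<in> M \<rightarrow>\<^sub>M torus_borel" "g \<in> M \<rightarrow>\<^sub>M torus_borel"
  shows "(\<lambda>\<omega>. (\<lambda>n. f \<omega> n * g \<omega> n)) \<in> M \<rightarrow>\<^sub>M torus_borel"
  by (intro measurable_torusI measurable_circle_times
      measurable_compose[OF assms(1) measurable_torus_component]
      measurable_compose[OF assms(2) measurable_torus_component])

lemma measurable_torus_inverse [measurable (raw)]:
  assumes "f \<in> M \<rightarrow>\<^sub>M torus_borel"
  shows "(\<lambda>\<omega>. (\<lambda>n. inverse (f \<omega> n))) \<in> M \<rightarrow>\<^sub>M torus_borel"
  by (intro measurable_torusI measurable_compose[OF _ measurable_circle_inverse]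
      measurable_compose[OF assms measurable_torus_component])

section \<open>Invariance, symmetry and semigroup law, lifted from the circle coordinate by
  coordinate\<close>

lemma nn_integral_torus_rotate:
  assumes [measurable]: "f \<in> borel_measurable torus_borel" and w: "w \<in> space torus_borel"
  shows "(\<integral>\<^sup>+x. f (\<lambda>n. w n * x n) \<partial>torus_haar) = integral\<^sup>N torus_haar f"
proof -
  have [measurable]: "(\<lambda>x n. w n * x n) \<in> torus_borel \<rightarrow>\<^sub>M torus_borel"
    using w by measurable
  have "distr torus_haar (PiM UNIV (\<lambda>_. circle_haar)) (\<lambda>x n. w n * x n) = PiM UNIV (\<lambda>_. circle_haar)"
  proof (rule distr_PiM_eqI)
    show "(\<lambda>x n. w n * x n) \<in> torus_haar \<rightarrow>\<^sub>M (\<Pi>\<^sub>M n\<in>UNIV. circle_haar)"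
      unfolding torus_haar_def[symmetric] by measurable
    fix J :: "nat set" and A :: "nat \<Rightarrow> complex set"
    assume J: "finite J" and A: "\<And>j. j \<in> J \<Longrightarrow> A j \<in> sets circle_haar"
    have wm: "(\<lambda>z. w j * z) \<in> circle_borel \<rightarrow>\<^sub>M circle_borel" for j
      using w by (intro measurable_circle_times measurable_const measurable_ident)
        (auto simp: space_restrict_space space_torus_borel)
    have m: "(\<lambda>z. indicator (A j) (w j * z) :: ennreal) \<in> borel_measurable circle_borel" if "j \<in> J" for j
      using A[OF that] by (intro measurable_compose[OF wm borel_measurable_indicator]) simp
    have m': "(\<lambda>z. indicator (A j) (w j * z) :: ennreal) \<in> borel_measurable circle_haar" if "j \<in> J" for j
      using m[OF that] unfolding measurable_cong_sets[OF sets_circle_haar refl] .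
    have "(\<integral>\<^sup>+x. (\<Prod>j\<in>J. indicator (A j) (w j * x j)) \<partial>torus_haar) =
        (\<Prod>j\<in>J. \<integral>\<^sup>+z. indicator (A j) (w j * z) \<partial>circle_haar)"
      unfolding torus_haar_def
      by (rule nn_integral_PiM_prod[OF prob_space_circle_haar J m'])
    also have "\<dots> = (\<Prod>j\<in>J. emeasure circle_haar (A j))"
      using A w by (intro prod.cong refl, subst nn_integral_circle_rotate) (auto simp: space_torus_borel)
    finally show "(\<integral>\<^sup>+x. (\<Prod>j\<in>J. indicator (A j) (w j * x j)) \<partial>torus_haar) = (\<Prod>j\<in>J. emeasure circle_haar (A j))" .
  qed (auto intro: prob_space_circle_haar prob_space_torus_haar)
  then have "distr torus_haar torus_haar (\<lambda>x n. w n * x n) = torus_haar"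
    by (simp add: torus_haar_def)
  then have "integral\<^sup>N torus_haar f = integral\<^sup>N (distr torus_haar torus_haar (\<lambda>x n. w n * x n)) f"
    by simp
  also have "\<dots> = (\<integral>\<^sup>+x. f (\<lambda>n. w n * x n) \<partial>torus_haar)"
    by (rule nn_integral_distr) measurable
  finally show ?thesis by simp
qed

lemma nn_integral_torus_poisson_inverse:
  assumes [measurable]: "f \<in> borel_measurable torus_borel" and r: "unit_radii r"
  shows "(\<integral>\<^sup>+y. f (\<lambda>n. inverse (y n)) \<partial>torus_poisson r) = integral\<^sup>N (torus_poisson r) f"
proof -
  have "distr (torus_poisson r) (PiM UNIV (\<lambda>n. poisson_measure (r n))) (\<lambda>y n. inverse (y n)) = PiM UNIV (\<lambda>n. poisson_measure (r n))"
  proof (rule distr_PiM_eqI)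
    show "(\<lambda>y n. inverse (y n)) \<in> torus_poisson r \<rightarrow>\<^sub>M (\<Pi>\<^sub>M n\<in>UNIV. poisson_measure (r n))"
      unfolding torus_poisson_def[symmetric] by measurable
    fix J :: "nat set" and A :: "nat \<Rightarrow> complex set"
    assume J: "finite J" and A: "\<And>j. j \<in> J \<Longrightarrow> A j \<in> sets (poisson_measure (r j))"
    have m: "(\<lambda>z. indicator (A j) (inverse z) :: ennreal) \<in> borel_measurable (poisson_measure (r j))" if "j \<in> J" for j
      using A[OF that] by measurable
    have "(\<integral>\<^sup>+x. (\<Prod>j\<in>J. indicator (A j) (inverse (x j))) \<partial>torus_poisson r) =
        (\<Prod>j\<in>J. \<integral>\<^sup>+z. indicator (A j) (inverse z) \<partial>poisson_measure (r j))"
      unfolding torus_poisson_def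
      using r by (intro nn_integral_PiM_prod[OF prob_space_poisson_measure J m]) (auto simp: unit_radii_def)
    also have "\<dots> = (\<Prod>j\<in>J. emeasure (poisson_measure (r j)) (A j))"
      using A by (intro prod.cong refl, subst nn_integral_poisson_inverse) auto
    finally show "(\<integral>\<^sup>+x. (\<Prod>j\<in>J. indicator (A j) (inverse (x j))) \<partial>torus_poisson r) =
        (\<Prod>j\<in>J. emeasure (poisson_measure (r j)) (A j))" .
  qed (use r in \<open>auto intro!: prob_space_poisson_measure prob_space_torus_poisson simp: unit_radii_def\<close>)
  then have "distr (torus_poisson r) (torus_poisson r) (\<lambda>y n. inverse (y n)) = torus_poisson r"
    by (simp add: torus_poisson_def)
  then have "integral\<^sup>N (torus_poisson r) f = integral\<^sup>N (distr (torus_poisson r) (torus_poisson r) (\<lambda>y n. inverse (y n))) f"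
    by simp
  also have "\<dots> = (\<integral>\<^sup>+y. f (\<lambda>n. inverse (y n)) \<partial>torus_poisson r)"
    by (rule nn_integral_distr) measurable
  finally show ?thesis by simp
qed

lemma unit_radii_times: "unit_radii a \<Longrightarrow> unit_radii b \<Longrightarrow> unit_radii (\<lambda>n. a n * b n)"
  by (auto simp: unit_radii_def intro: mult_le_one)

text \<open>The coordinatewise product of independent points with laws \<open>a\<close> and
  \<open>b\<close> has independent coordinates, each distributed according to the semigroup law on
  the circle.\<close>

lemma nn_integral_torus_poisson_convolution:
  assumes [measurable]: "f \<in> borel_measurable torus_borel" and a: "unit_radii a" and b: "unit_radii b"
  shows "(\<integral>\<^sup>+x. (\<integral>\<^sup>+y. f (\<lambda>n. x n * y n) \<partial>torus_poisson b) \<partial>torus_poisson a) =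
    integral\<^sup>N (torus_poisson (\<lambda>n. a n * b n)) f"
proof -
  let ?c = "\<lambda>n. a n * b n"
  have c: "unit_radii ?c" using a b by (rule unit_radii_times)
  interpret A: prob_space "torus_poisson a" by (rule prob_space_torus_poisson[OF a])
  interpret B: prob_space "torus_poisson b" by (rule prob_space_torus_poisson[OF b])
  interpret AB: pair_prob_space "torus_poisson a" "torus_poisson b" ..
  have "distr (torus_poisson a \<Otimes>\<^sub>M torus_poisson b) (PiM UNIV (\<lambda>n. poisson_measure (?c n))) (\<lambda>(x, y) n. x n * y n) =
      PiM UNIV (\<lambda>n. poisson_measure (?c n))"
  proof (rule distr_PiM_eqI)
    show "(\<lambda>(x, y) n. x n * y n) \<in> torus_poisson a \<Otimes>\<^sub>M torus_poisson b \<rightarrow>\<^sub>M (\<Pi>\<^sub>M n\<in>UNIV. poisson_measure (?c n))"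
      unfolding torus_poisson_def[symmetric] by measurable
    fix J :: "nat set" and A :: "nat \<Rightarrow> complex set"
    assume J: "finite J" and A: "\<And>j. j \<in> J \<Longrightarrow> A j \<in> sets (poisson_measure (?c j))"
    then have A': "A j \<in> sets circle_borel" if "j \<in> J" for j
      using that by simp
    have AA: "(\<lambda>z. indicator (A j) (fst z * snd z) :: ennreal) \<in> borel_measurable (circle_borel \<Otimes>\<^sub>M circle_borel)" if "j \<in> J" for j
      using A'[OF that] by measurable
    interpret Bj: prob_space "poisson_measure (b j)" for j
      using b by (intro prob_space_poisson_measure) (auto simp: unit_radii_def)
    have m1: "(\<lambda>z. indicator (A j) (w * z) :: ennreal) \<in> borel_measurable (poisson_measure (b j))" if "j \<in> J" "cmod w = 1" for j w
      using A'[OF that(1)] that(2)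
      by (intro measurable_compose[OF measurable_circle_times[OF measurable_const measurable_ident_sets]] borel_measurable_indicator)
         (auto simp: space_restrict_space)
    have m2: "(\<lambda>w. \<integral>\<^sup>+z. indicator (A j) (w * z) \<partial>poisson_measure (b j)) \<in> borel_measurable (poisson_measure (a j))" if "j \<in> J" for j
      using A'[OF that] by measurable
    have m3: "(\<lambda>\<omega>. \<Prod>j\<in>J. indicator (A j) ((case \<omega> of (x, y) \<Rightarrow> \<lambda>n. x n * y n) j) :: ennreal) \<in> borel_measurable (torus_poisson a \<Otimes>\<^sub>M torus_poisson b)"
      using A' unfolding case_prod_beta by measurable
    have "(\<integral>\<^sup>+\<omega>. (\<Prod>j\<in>J. indicator (A j) ((case \<omega> of (x, y) \<Rightarrow> \<lambda>n. x n * y n) j)) \<partial>(torus_poisson a \<Otimes>\<^sub>M torus_poisson b)) =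
        (\<integral>\<^sup>+x. (\<integral>\<^sup>+y. (\<Prod>j\<in>J. indicator (A j) (x j * y j)) \<partial>torus_poisson b) \<partial>torus_poisson a)"
      using B.nn_integral_fst[OF m3] by simp
    also have "\<dots> = (\<integral>\<^sup>+x. (\<Prod>j\<in>J. \<integral>\<^sup>+z. indicator (A j) (x j * z) \<partial>poisson_measure (b j)) \<partial>torus_poisson a)"
    proof (rule nn_integral_cong)
      fix x assume "x \<in> space (torus_poisson a)"
      then show "(\<integral>\<^sup>+y. (\<Prod>j\<in>J. indicator (A j) (x j * y j)) \<partial>torus_poisson b) =
          (\<Prod>j\<in>J. \<integral>\<^sup>+z. indicator (A j) (x j * z) \<partial>poisson_measure (b j))"
        unfolding torus_poisson_def[of b]
        by (intro nn_integral_PiM_prod Bj.prob_space_axioms J m1) auto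
    qed
    also have "\<dots> = (\<Prod>j\<in>J. \<integral>\<^sup>+w. (\<integral>\<^sup>+z. indicator (A j) (w * z) \<partial>poisson_measure (b j)) \<partial>poisson_measure (a j))"
      unfolding torus_poisson_def[of a]
      using a by (intro nn_integral_PiM_prod[OF prob_space_poisson_measure J m2]) (auto simp: unit_radii_def)
    also have "\<dots> = (\<Prod>j\<in>J. emeasure (poisson_measure (?c j)) (A j))"
      using A a b by (intro prod.cong refl, subst nn_integral_poisson_convolution) (auto simp: unit_radii_def)
    finally show "(\<integral>\<^sup>+\<omega>. (\<Prod>j\<in>J. indicator (A j) ((case \<omega> of (x, y) \<Rightarrow> \<lambda>n. x n * y n) j)) \<partial>(torus_poisson a \<Otimes>\<^sub>M torus_poisson b)) =
        (\<Prod>j\<in>J. emeasure (poisson_measure (?c j)) (A j))" .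
  qed (use c in \<open>auto intro!: prob_space_poisson_measure AB.prob_space_axioms simp: unit_radii_def\<close>)
  then have "distr (torus_poisson a \<Otimes>\<^sub>M torus_poisson b) (torus_poisson ?c) (\<lambda>(x, y) n. x n * y n) = torus_poisson ?c"
    by (simp add: torus_poisson_def)
  then have "integral\<^sup>N (torus_poisson ?c) f =
      integral\<^sup>N (distr (torus_poisson a \<Otimes>\<^sub>M torus_poisson b) (torus_poisson ?c) (\<lambda>(x, y) n. x n * y n)) f"
    by simp
  also have "\<dots> = (\<integral>\<^sup>+\<omega>. f (case \<omega> of (x, y) \<Rightarrow> \<lambda>n. x n * y n) \<partial>(torus_poisson a \<Otimes>\<^sub>M torus_poisson b))"
    by (rule nn_integral_distr) measurable
  also have "\<dots> = (\<integral>\<^sup>+x. (\<integral>\<^sup>+y. f (\<lambda>n. x n * y n) \<partial>torus_poisson b) \<partial>torus_poisson a)"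
    by (subst B.nn_integral_fst[symmetric]) (simp_all add: case_prod_beta)
  finally show ?thesis by simp
qed

section \<open>Doob's inequality along a reversible chain\<close>

text \<open>Young's inequality for the conjugate exponents \<open>p\<close> and
  \<open>p / (p - 1)\<close>. It stands in for Hoelder's inequality below, since its two terms can
  be integrated separately.\<close>

lemma young_powr:
  fixes a b p :: real
  assumes p: "1 < p" and ab: "0 \<le> a" "0 \<le> b"
  shows "a * b powr (p - 1) \<le> a powr p / p + b powr p * (p - 1) / p"
proof -
  have "a * b powr (p - 1) \<le> a powr p / p + (b powr (p - 1)) powr (p / (p - 1)) / (p / (p - 1))"
    using p ab by (intro Youngs_inequality) (auto simp: field_simps)
  moreover have "(p - 1) * (p / (p - 1)) = p" using p by simp
  ultimately show ?thesis by (simp add: powr_powr)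
qed

text \<open>One step of a pathwise Doob inequality: for fixed \<open>f\<close>, the function
  \<open>x^p - p / (p - 1) * x^(p - 1) * f\<close> decreases on \<open>[0, f]\<close>, so raising
  \<open>m\<close> to \<open>max m f\<close> does not increase it. The negative terms are moved
  across, for later integration in \<open>[0,\<infinity>]\<close>.\<close>

lemma max_powr_step:
  fixes m f p :: real
  assumes p: "1 < p" and m: "0 \<le> m" and f: "0 \<le> f"
  shows "max m f powr p + p / (p - 1) * (m powr (p - 1) * f) \<le>
    m powr p + p / (p - 1) * (max m f powr (p - 1) * f)"
proof (cases "f \<le> m")
  case False
  have y: "f * m powr (p - 1) \<le> f powr p / p + m powr p * (p - 1) / p"
    using young_powr[OF p f m] .
  have "p / (p - 1) * (f * m powr (p - 1)) \<le> p / (p - 1) * (f powr p / p + m powr p * (p - 1) / p)"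
    using p by (intro mult_left_mono y) auto
  also have "\<dots> = f powr p / (p - 1) + m powr p"
    using p by (simp add: field_simps)
  \<comment> \<open>Uses \<open>p / (p - 1) - 1 = 1 / (p - 1)\<close>.\<close>
  also have "f powr p / (p - 1) = p / (p - 1) * f powr p - f powr p"
    using p by (simp add: field_simps)
  also have "f powr p = f powr (p - 1) * f"
    using f False m by (simp add: powr_diff)
  finally show ?thesis
    using False by (simp add: max_def mult_ac)
       (smt (verit, best) False f m powr_mult_base mult.commute powr_diff powr_one)
qed (simp add: max_def)

section \<open>The chain and its running maximum\<close>

text \<open>The step laws may vary with time, but each step is symmetric in the inner product of
  \<open>H\<close>; \<open>martingale\<close> makes \<open>f k\<close> along the path a martingale.
  The bound \<open>B\<close> keeps every integral finite where a term has to be cancelled.\<close>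

locale reversible_chain = prob_space H
  for H :: "'a measure" +
  fixes \<nu> :: "nat \<Rightarrow> 'b measure" and act :: "'a \<Rightarrow> 'b \<Rightarrow> 'a" and f :: "nat \<Rightarrow> 'a \<Rightarrow> real" and B :: real
  assumes prob_space_step: "\<And>k. prob_space (\<nu> k)"
    and measurable_act: "\<And>k. (\<lambda>(x, y). act x y) \<in> H \<Otimes>\<^sub>M \<nu> k \<rightarrow>\<^sub>M H"
    and reversible: "\<And>k \<phi> h. \<phi> \<in> borel_measurable H \<Longrightarrow> h \<in> borel_measurable H \<Longrightarrow>
      (\<integral>\<^sup>+x. \<phi> x * (\<integral>\<^sup>+y. h (act x y) \<partial>\<nu> k) \<partial>H) = (\<integral>\<^sup>+x. (\<integral>\<^sup>+y. \<phi> (act x y) \<partial>\<nu> k) * h x \<partial>H)"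
    and measurable_f [measurable]: "\<And>k. f k \<in> borel_measurable H"
    and f_bounds: "\<And>k x. 0 \<le> f k x" "\<And>k x. f k x \<le> B"
    and martingale: "\<And>k x. x \<in> space H \<Longrightarrow> (\<integral>\<^sup>+y. ennreal (f (Suc k) (act x y)) \<partial>\<nu> k) = ennreal (f k x)"
begin

sublocale step: prob_space "\<nu> k" for k by (rule prob_space_step)

lemma measurable_act' [measurable (raw)]:
  "g \<in> M \<rightarrow>\<^sub>M H \<Longrightarrow> h \<in> M \<rightarrow>\<^sub>M \<nu> k \<Longrightarrow> (\<lambda>x. act (g x) (h x)) \<in> M \<rightarrow>\<^sub>M H"
  using measurable_compose[OF measurable_Pair measurable_act, of g M h k] by simp

text \<open>The joint law of the position of the chain after \<open>k\<close> steps and of the running maximum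
  of \<open>f\<close> along its path.\<close>

primrec chain :: "nat \<Rightarrow> ('a \<times> real) measure" where
  "chain 0 = distr H (H \<Otimes>\<^sub>M borel) (\<lambda>x. (x, f 0 x))"
| "chain (Suc k) = distr (chain k \<Otimes>\<^sub>M \<nu> k) (H \<Otimes>\<^sub>M borel)
    (\<lambda>z. (act (fst (fst z)) (snd z), max (snd (fst z)) (f (Suc k) (act (fst (fst z)) (snd z)))))"

lemma sets_chain [simp, measurable_cong]: "sets (chain k) = sets (H \<Otimes>\<^sub>M borel)"
  by (cases k) auto

lemma nn_integral_chain_0:
  "F \<in> borel_measurable (H \<Otimes>\<^sub>M borel) \<Longrightarrow> integral\<^sup>N (chain 0) F = (\<integral>\<^sup>+x. F (x, f 0 x) \<partial>H)"
  by (simp add: nn_integral_distr)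

lemma nn_integral_chain_Suc:
  assumes [measurable]: "F \<in> borel_measurable (H \<Otimes>\<^sub>M borel)"
  shows "integral\<^sup>N (chain (Suc k)) F =
    (\<integral>\<^sup>+z. (\<integral>\<^sup>+y. F (act (fst z) y, max (snd z) (f (Suc k) (act (fst z) y))) \<partial>\<nu> k) \<partial>chain k)"
proof -
  have "integral\<^sup>N (chain (Suc k)) F =
      (\<integral>\<^sup>+z. F (act (fst (fst z)) (snd z), max (snd (fst z)) (f (Suc k) (act (fst (fst z)) (snd z)))) \<partial>(chain k \<Otimes>\<^sub>M \<nu> k))"
    unfolding chain.simps by (rule nn_integral_distr) measurable
  also have "\<dots> = (\<integral>\<^sup>+z. (\<integral>\<^sup>+y. F (act (fst z) y, max (snd z) (f (Suc k) (act (fst z) y))) \<partial>\<nu> k) \<partial>chain k)"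
    by (subst step.nn_integral_fst[symmetric]) auto
  finally show ?thesis .
qed

lemma space_chain: "space (chain k) = space H \<times> UNIV"
  using sets_eq_imp_space_eq[OF sets_chain] by (simp add: space_pair_measure)

text \<open>Reversibility tested against the constant 1 is stationarity of \<open>H\<close>.\<close>

lemma nn_integral_step:
  assumes [measurable]: "\<phi> \<in> borel_measurable H"
  shows "(\<integral>\<^sup>+x. (\<integral>\<^sup>+y. \<phi> (act x y) \<partial>\<nu> k) \<partial>H) = integral\<^sup>N H \<phi>"
  using reversible[of \<phi> "\<lambda>_. 1" k] by (simp add: step.emeasure_space_1)

lemma nn_integral_chain_position:
  assumes "\<phi> \<in> borel_measurable H"
  shows "(\<integral>\<^sup>+z. \<phi> (fst z) \<partial>chain k) = integral\<^sup>N H \<phi>"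
  using assms
proof (induction k arbitrary: \<phi>)
  case 0
  then show ?case by (subst nn_integral_chain_0) auto
next
  case (Suc k)
  note [measurable] = Suc.prems
  have "(\<integral>\<^sup>+z. \<phi> (fst z) \<partial>chain (Suc k)) = (\<integral>\<^sup>+z. (\<integral>\<^sup>+y. \<phi> (act (fst z) y) \<partial>\<nu> k) \<partial>chain k)"
    by (subst nn_integral_chain_Suc) auto
  also have "\<dots> = (\<integral>\<^sup>+x. (\<integral>\<^sup>+y. \<phi> (act x y) \<partial>\<nu> k) \<partial>H)"
    by (rule Suc.IH) measurable
  finally show ?case by (simp add: nn_integral_step)
qed

sublocale chain: prob_space "chain k" for k
  using nn_integral_chain_position[of "\<lambda>_. 1" k] by (intro prob_spaceI) (simp add: emeasure_space_1)

lemma AE_chain_bounds: "AE z in chain k. 0 \<le> snd z \<and> snd z \<le> B"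
proof -
  define bad :: "real \<Rightarrow> ennreal" where "bad = indicator (- {0..B})"
  have [measurable]: "bad \<in> borel_measurable borel" by (simp add: bad_def)
  have "(\<integral>\<^sup>+z. bad (snd z) \<partial>chain k) = 0"
  proof (induction k)
    case 0
    then show ?case
      by (subst nn_integral_chain_0) (auto simp: bad_def f_bounds)
  next
    case (Suc k)
    have "(\<integral>\<^sup>+z. bad (snd z) \<partial>chain (Suc k)) =
        (\<integral>\<^sup>+z. (\<integral>\<^sup>+y. bad (max (snd z) (f (Suc k) (act (fst z) y))) \<partial>\<nu> k) \<partial>chain k)"
      by (subst nn_integral_chain_Suc) auto
    \<comment> \<open>A step cannot create a bad maximum, because the new value of \<open>f\<close>
      lies in \<open>[0, B]\<close>.\<close>
    also have "\<dots> \<le> (\<integral>\<^sup>+z. (\<integral>\<^sup>+y. bad (snd z) \<partial>\<nu> k) \<partial>chain k)"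
      by (intro nn_integral_mono) (auto simp: bad_def indicator_def f_bounds le_max_iff_disj)
    also have "\<dots> = 0" using Suc.IH by (simp add: step.emeasure_space_1)
    finally show ?case by simp
  qed
  then have "AE z in chain k. bad (snd z) = 0"
    by (subst (asm) nn_integral_0_iff_AE) auto
  then show ?thesis
    by eventually_elim (auto simp: bad_def indicator_def split: if_splits)
qed

end

context reversible_chain begin

lemma nn_integral_chain_max_powr_finite:
  assumes p: "0 \<le> p"
  shows "(\<integral>\<^sup>+z. ennreal (snd z powr p) \<partial>chain k) < \<top>"
proof -
  have "(\<integral>\<^sup>+z. ennreal (snd z powr p) \<partial>chain k) \<le> (\<integral>\<^sup>+z. ennreal (B powr p) \<partial>chain k)"
    using AE_chain_bounds[of k]
    by (intro nn_integral_mono_AE, eventually_elim) (auto intro!: ennreal_leI powr_mono2 p)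
  also have "\<dots> < \<top>"
    by (simp add: chain.emeasure_space_1)
  finally show ?thesis .
qed

text \<open>With \<open>M\<close> the running maximum, this is what the estimate \<open>\<lambda> *
  P(M \<ge> \<lambda>) \<le> E(f; M \<ge> \<lambda>)\<close> gives after integration against
  \<open>p * \<lambda>^(p - 2)\<close>; here it comes directly by induction from
  \<open>max_powr_step\<close>, without level sets.\<close>

lemma doob_weak_type:
  assumes p: "1 < p"
  shows "(\<integral>\<^sup>+z. ennreal (snd z powr p) \<partial>chain k) \<le>
    (\<integral>\<^sup>+z. ennreal (p / (p - 1) * (snd z powr (p - 1) * f k (fst z))) \<partial>chain k)"
proof (induction k)
  case 0
  \<comment> \<open>At time 0 the running maximum is \<open>f 0\<close> itself, and
    \<open>p / (p - 1)\<close> is at least 1.\<close>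
  have "f 0 x powr p \<le> p / (p - 1) * (f 0 x powr (p - 1) * f 0 x)" for x
  proof -
    have "1 * (f 0 x powr (p - 1) * f 0 x) \<le> p / (p - 1) * (f 0 x powr (p - 1) * f 0 x)"
      using p f_bounds by (intro mult_right_mono) auto
    moreover have "f 0 x powr (p - 1) * f 0 x = f 0 x powr p"
      using f_bounds(1)[of 0 x] p powr_mult_base[of "f 0 x" "p - 1"] by (simp add: mult.commute)
    ultimately show ?thesis by simp
  qed
  then show ?case
    by (subst (1 2) nn_integral_chain_0) (auto intro!: nn_integral_mono ennreal_leI)
next
  case (Suc k)
  define q where "q = p / (p - 1)"
  let ?F = "\<lambda>z y. f (Suc k) (act (fst z) y)"
  let ?a = "\<integral>\<^sup>+z. ennreal (snd z powr p) \<partial>chain k"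
  let ?b = "\<integral>\<^sup>+z. ennreal (q * (snd z powr (p - 1) * f k (fst z))) \<partial>chain k"
  let ?A = "\<integral>\<^sup>+z. ennreal (snd z powr p) \<partial>chain (Suc k)"
  let ?B = "\<integral>\<^sup>+z. ennreal (q * (snd z powr (p - 1) * f (Suc k) (fst z))) \<partial>chain (Suc k)"
  have q: "0 \<le> q" using p by (simp add: q_def)
  have F: "(\<lambda>y. ?F z y) \<in> borel_measurable (\<nu> k)" if "z \<in> space (chain k)" for z
  proof -
    have "fst z \<in> space H" using that by (auto simp: space_chain)
    then show ?thesis by measurable
  qed
  \<comment> \<open>The martingale property: next to a factor that depends only on the past,
    \<open>f k\<close> may be replaced by the next value \<open>f (Suc k)\<close>.\<close>
  have b: "?b = (\<integral>\<^sup>+z. (\<integral>\<^sup>+y. ennreal (q * (snd z powr (p - 1) * ?F z y)) \<partial>\<nu> k) \<partial>chain k)"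
  proof (rule nn_integral_cong)
    fix z assume "z \<in> space (chain k)"
    then have z: "fst z \<in> space H" and [measurable]: "(\<lambda>y. ?F z y) \<in> borel_measurable (\<nu> k)"
      by (auto simp: space_chain intro: F)
    have "(\<integral>\<^sup>+y. ennreal (q * (snd z powr (p - 1) * ?F z y)) \<partial>\<nu> k) =
        (\<integral>\<^sup>+y. ennreal (q * snd z powr (p - 1)) * ennreal (?F z y) \<partial>\<nu> k)"
      using q f_bounds by (intro nn_integral_cong) (simp add: ennreal_mult[symmetric] mult.assoc)
    also have "\<dots> = ennreal (q * snd z powr (p - 1)) * (\<integral>\<^sup>+y. ennreal (?F z y) \<partial>\<nu> k)"
      by (rule nn_integral_cmult) measurable
    also have "\<dots> = ennreal (q * (snd z powr (p - 1) * f k (fst z)))"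
      using z q f_bounds by (simp add: martingale ennreal_mult[symmetric] mult.assoc)
    finally show "ennreal (q * (snd z powr (p - 1) * f k (fst z))) =
        (\<integral>\<^sup>+y. ennreal (q * (snd z powr (p - 1) * ?F z y)) \<partial>\<nu> k)" by simp
  qed
  have A: "?A = (\<integral>\<^sup>+z. (\<integral>\<^sup>+y. ennreal (max (snd z) (?F z y) powr p) \<partial>\<nu> k) \<partial>chain k)"
    by (subst nn_integral_chain_Suc) auto
  have B: "?B = (\<integral>\<^sup>+z. (\<integral>\<^sup>+y. ennreal (q * (max (snd z) (?F z y) powr (p - 1) * ?F z y)) \<partial>\<nu> k) \<partial>chain k)"
    by (subst nn_integral_chain_Suc) auto
  have a: "?a = (\<integral>\<^sup>+z. (\<integral>\<^sup>+y. ennreal (snd z powr p) \<partial>\<nu> k) \<partial>chain k)"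
    by (simp add: step.emeasure_space_1)
  \<comment> \<open>The goal is \<open>?A \<le> ?B\<close>, and the induction hypothesis is
    \<open>?a \<le> ?b\<close>. The pathwise inequality integrates to
    \<open>?A + ?b \<le> ?a + ?B\<close>, which suffices once the finite \<open>?b\<close> is
    cancelled.\<close>
  have "?A + ?b = (\<integral>\<^sup>+z. (\<integral>\<^sup>+y. ennreal (max (snd z) (?F z y) powr p) + ennreal (q * (snd z powr (p - 1) * ?F z y)) \<partial>\<nu> k) \<partial>chain k)"
  proof -
    have "?A + ?b = (\<integral>\<^sup>+z. (\<integral>\<^sup>+y. ennreal (max (snd z) (?F z y) powr p) \<partial>\<nu> k) +
        (\<integral>\<^sup>+y. ennreal (q * (snd z powr (p - 1) * ?F z y)) \<partial>\<nu> k) \<partial>chain k)"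
      unfolding A b by (rule nn_integral_add[symmetric]) measurable
    also have "\<dots> = (\<integral>\<^sup>+z. (\<integral>\<^sup>+y. ennreal (max (snd z) (?F z y) powr p) + ennreal (q * (snd z powr (p - 1) * ?F z y)) \<partial>\<nu> k) \<partial>chain k)"
    proof (rule nn_integral_cong)
      fix z assume "z \<in> space (chain k)"
      then have [measurable]: "(\<lambda>y. ?F z y) \<in> borel_measurable (\<nu> k)" by (rule F)
      show "(\<integral>\<^sup>+y. ennreal (max (snd z) (?F z y) powr p) \<partial>\<nu> k) + (\<integral>\<^sup>+y. ennreal (q * (snd z powr (p - 1) * ?F z y)) \<partial>\<nu> k) =
          (\<integral>\<^sup>+y. ennreal (max (snd z) (?F z y) powr p) + ennreal (q * (snd z powr (p - 1) * ?F z y)) \<partial>\<nu> k)"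
        by (rule nn_integral_add[symmetric]) measurable
    qed
    finally show ?thesis .
  qed
  also have "\<dots> \<le> (\<integral>\<^sup>+z. (\<integral>\<^sup>+y. ennreal (snd z powr p) + ennreal (q * (max (snd z) (?F z y) powr (p - 1) * ?F z y)) \<partial>\<nu> k) \<partial>chain k)"
    using AE_chain_bounds[of k]
  proof (intro nn_integral_mono_AE, eventually_elim)
    fix z :: "'a \<times> real" assume z: "0 \<le> snd z \<and> snd z \<le> B"
    show "(\<integral>\<^sup>+y. ennreal (max (snd z) (?F z y) powr p) + ennreal (q * (snd z powr (p - 1) * ?F z y)) \<partial>\<nu> k)
      \<le> (\<integral>\<^sup>+y. ennreal (snd z powr p) + ennreal (q * (max (snd z) (?F z y) powr (p - 1) * ?F z y)) \<partial>\<nu> k)"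
    proof (rule nn_integral_mono)
      fix y
      show "ennreal (max (snd z) (?F z y) powr p) + ennreal (q * (snd z powr (p - 1) * ?F z y))
        \<le> ennreal (snd z powr p) + ennreal (q * (max (snd z) (?F z y) powr (p - 1) * ?F z y))"
        using max_powr_step[OF p, folded q_def, of "snd z" "?F z y"] z q f_bounds
        by (subst (1 2) ennreal_plus[symmetric]) (auto intro!: ennreal_leI mult_nonneg_nonneg simp del: ennreal_plus times_divide_eq_left)
    qed
  qed
  also have "\<dots> = ?a + ?B"
  proof -
    have "(\<integral>\<^sup>+z. (\<integral>\<^sup>+y. ennreal (snd z powr p) + ennreal (q * (max (snd z) (?F z y) powr (p - 1) * ?F z y)) \<partial>\<nu> k) \<partial>chain k) =
        (\<integral>\<^sup>+z. (\<integral>\<^sup>+y. ennreal (snd z powr p) \<partial>\<nu> k) +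
          (\<integral>\<^sup>+y. ennreal (q * (max (snd z) (?F z y) powr (p - 1) * ?F z y)) \<partial>\<nu> k) \<partial>chain k)"
    proof (rule nn_integral_cong)
      fix z assume "z \<in> space (chain k)"
      then have [measurable]: "(\<lambda>y. ?F z y) \<in> borel_measurable (\<nu> k)" by (rule F)
      show "(\<integral>\<^sup>+y. ennreal (snd z powr p) + ennreal (q * (max (snd z) (?F z y) powr (p - 1) * ?F z y)) \<partial>\<nu> k) =
          (\<integral>\<^sup>+y. ennreal (snd z powr p) \<partial>\<nu> k) + (\<integral>\<^sup>+y. ennreal (q * (max (snd z) (?F z y) powr (p - 1) * ?F z y)) \<partial>\<nu> k)"
        by (rule nn_integral_add) measurable
    qed
    also have "\<dots> = ?a + ?B"
      unfolding a B by (rule nn_integral_add) measurable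
    finally show ?thesis .
  qed
  also have "\<dots> \<le> ?b + ?B"
    by (intro add_right_mono Suc.IH[folded q_def])
  finally have "?b + ?A \<le> ?b + ?B"
    by (simp only: add.commute)
  moreover have "?b < \<top>"
  proof -
    have "?b \<le> (\<integral>\<^sup>+z. ennreal (q * (B powr (p - 1) * B)) \<partial>chain k)"
    proof (intro nn_integral_mono_AE eventually_mono[OF AE_chain_bounds] ennreal_leI mult_left_mono q)
      fix z :: "'a \<times> real" assume z: "0 \<le> snd z \<and> snd z \<le> B"
      then show "snd z powr (p - 1) * f k (fst z) \<le> B powr (p - 1) * B"
        using p f_bounds by (intro mult_mono powr_mono2) auto
    qed
    also have "\<dots> < \<top>" by (simp add: chain.emeasure_space_1 ennreal_mult_less_top)
    finally show ?thesis .
  qed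
  ultimately show ?case
    unfolding q_def[symmetric] ennreal_add_left_cancel_le by (auto simp del: chain.simps)
qed

text \<open>Young's inequality for \<open>q * f k\<close> and the running maximum bounds the right
  side of \<open>doob_weak_type\<close> by \<open>q^p / p\<close> times the integral of
  \<open>f k ^ p\<close> plus \<open>(p - 1) / p\<close> times the left side. The latter is finite
  and can be absorbed, which multiplies by \<open>p\<close> and leaves exactly
  \<open>q^p\<close>.\<close>

lemma doob_maximal_inequality:
  assumes p: "1 < p"
  shows "(\<integral>\<^sup>+z. ennreal (snd z powr p) \<partial>chain k) \<le>
    ennreal ((p / (p - 1)) powr p) * (\<integral>\<^sup>+x. ennreal (f k x powr p) \<partial>H)"
proof -
  define q where "q = p / (p - 1)"
  let ?a = "\<integral>\<^sup>+z. ennreal (snd z powr p) \<partial>chain k"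
  let ?g = "\<integral>\<^sup>+x. ennreal (f k x powr p) \<partial>H"
  have q: "0 \<le> q" using p by (simp add: q_def)
  have "?g \<le> (\<integral>\<^sup>+x. ennreal (B powr p) \<partial>H)"
    using p f_bounds by (intro nn_integral_mono ennreal_leI powr_mono2) auto
  also have "\<dots> < \<top>" by (simp add: emeasure_space_1)
  finally have "?g < \<top>" .
  moreover have "?a < \<top>" using p by (intro nn_integral_chain_max_powr_finite) simp
  moreover define \<alpha> \<gamma> where "\<alpha> = enn2real ?a" and "\<gamma> = enn2real ?g"
  ultimately have \<alpha>: "?a = ennreal \<alpha>" "0 \<le> \<alpha>" and \<gamma>: "?g = ennreal \<gamma>" "0 \<le> \<gamma>"
    by simp_all
  define c d where "c = q powr p / p" and "d = (p - 1) / p"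
  have cd: "0 \<le> c" "0 \<le> d" using p by (simp_all add: c_def d_def)
  have "?a \<le> (\<integral>\<^sup>+z. ennreal (q * (snd z powr (p - 1) * f k (fst z))) \<partial>chain k)"
    unfolding q_def by (rule doob_weak_type[OF p])
  also have "\<dots> \<le> (\<integral>\<^sup>+z. ennreal c * ennreal (f k (fst z) powr p) + ennreal d * ennreal (snd z powr p) \<partial>chain k)"
    using AE_chain_bounds[of k]
  proof (intro nn_integral_mono_AE, eventually_elim)
    fix z :: "'a \<times> real" assume z: "0 \<le> snd z \<and> snd z \<le> B"
    have "(q * f k (fst z)) * snd z powr (p - 1) \<le> (q * f k (fst z)) powr p / p + snd z powr p * (p - 1) / p"
      using z f_bounds p q by (intro young_powr mult_nonneg_nonneg) auto
    also have "\<dots> = c * f k (fst z) powr p + d * snd z powr p"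
      using f_bounds q p by (simp add: powr_mult c_def d_def mult_ac)
    finally have "ennreal (q * (snd z powr (p - 1) * f k (fst z))) \<le> ennreal (c * f k (fst z) powr p + d * snd z powr p)"
      by (intro ennreal_leI) (simp only: mult_ac)
    also have "\<dots> = ennreal c * ennreal (f k (fst z) powr p) + ennreal d * ennreal (snd z powr p)"
      using cd by (simp add: ennreal_mult')
    finally show "ennreal (q * (snd z powr (p - 1) * f k (fst z))) \<le> \<dots>" .
  qed
  also have "\<dots> = ennreal c * (\<integral>\<^sup>+z. ennreal (f k (fst z) powr p) \<partial>chain k) + ennreal d * ?a"
    by (subst nn_integral_add) (auto simp: nn_integral_cmult)
  also have "(\<integral>\<^sup>+z. ennreal (f k (fst z) powr p) \<partial>chain k) = ?g"
    by (rule nn_integral_chain_position) measurable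
  also have "ennreal c * ?g + ennreal d * ?a = ennreal (c * \<gamma> + d * \<alpha>)"
    using cd \<alpha> \<gamma> by (simp add: ennreal_mult')
  finally have "\<alpha> \<le> c * \<gamma> + d * \<alpha>"
    using cd \<alpha> \<gamma> by (simp add: \<alpha>(1) del: ennreal_plus)
  then have "\<alpha> \<le> q powr p * \<gamma>"
    using p by (simp add: c_def d_def field_simps)
  then show ?thesis
    unfolding \<alpha> \<gamma> q_def[symmetric] using \<gamma>(2) by (simp flip: ennreal_mult)
qed

end

lemma measurable_ennreal_powr [measurable]:
  "(\<lambda>x. ennreal_powr x a) \<in> borel_measurable borel"
  unfolding ennreal_powr_def by measurable

lemma ennreal_powr_ennreal [simp]: "0 \<le> x \<Longrightarrow> ennreal_powr (ennreal x) a = ennreal (x powr a)"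
  by (simp add: ennreal_powr_def)

section \<open>Functions of the position dominated by the running maximum\<close>

context reversible_chain begin

text \<open>A weak form of: \<open>h\<close> is at most the conditional expectation of the running maximum given the
  position after \<open>k\<close> steps.\<close>

definition dominated :: "nat \<Rightarrow> ('a \<Rightarrow> ennreal) \<Rightarrow> bool" where
  "dominated k h \<longleftrightarrow> h \<in> borel_measurable H \<and> (\<forall>\<phi>\<in>borel_measurable H.
     (\<integral>\<^sup>+x. \<phi> x * h x \<partial>H) \<le> (\<integral>\<^sup>+z. \<phi> (fst z) * ennreal (snd z) \<partial>chain k))"

lemma dominatedD:
  "dominated k h \<Longrightarrow> \<phi> \<in> borel_measurable H \<Longrightarrow>
    (\<integral>\<^sup>+x. \<phi> x * h x \<partial>H) \<le> (\<integral>\<^sup>+z. \<phi> (fst z) * ennreal (snd z) \<partial>chain k)"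
  by (simp add: dominated_def)

lemma dominated_cong:
  assumes "dominated k h" "\<And>x. x \<in> space H \<Longrightarrow> h x = h' x"
  shows "dominated k h'"
proof -
  have "(\<integral>\<^sup>+x. \<phi> x * h x \<partial>H) = (\<integral>\<^sup>+x. \<phi> x * h' x \<partial>H)" for \<phi>
    by (intro nn_integral_cong) (simp add: assms(2))
  moreover have "h' \<in> borel_measurable H"
    using assms by (simp add: dominated_def cong: measurable_cong)
  ultimately show ?thesis using assms(1) by (simp add: dominated_def)
qed

text \<open>Test functions may be restricted to a measurable set: on \<open>S\<close> the supremum
  is \<open>h\<close>, off \<open>S\<close> it is \<open>h'\<close>, and the two restricted
  inequalities add up.\<close>

lemma dominated_sup:
  assumes "dominated k h" "dominated k h'"
  shows "dominated k (\<lambda>x. sup (h x) (h' x))"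
  unfolding dominated_def
proof safe
  have [measurable]: "h \<in> borel_measurable H" "h' \<in> borel_measurable H"
    using assms by (simp_all add: dominated_def)
  then show "(\<lambda>x. sup (h x) (h' x)) \<in> borel_measurable H" by measurable
  fix \<phi> :: "'a \<Rightarrow> ennreal" assume [measurable]: "\<phi> \<in> borel_measurable H"
  define S where "S = {x \<in> space H. h' x \<le> h x}"
  have [measurable]: "S \<in> sets H" unfolding S_def by measurable
  let ?\<phi>1 = "\<lambda>x. \<phi> x * indicator S x" and ?\<phi>2 = "\<lambda>x. \<phi> x * indicator (space H - S) x"
  have "(\<integral>\<^sup>+x. \<phi> x * sup (h x) (h' x) \<partial>H) = (\<integral>\<^sup>+x. ?\<phi>1 x * h x + ?\<phi>2 x * h' x \<partial>H)"
    by (intro nn_integral_cong) (auto simp: S_def indicator_def sup_absorb1 sup_absorb2)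
  also have "\<dots> = (\<integral>\<^sup>+x. ?\<phi>1 x * h x \<partial>H) + (\<integral>\<^sup>+x. ?\<phi>2 x * h' x \<partial>H)"
    by (rule nn_integral_add) measurable
  also have "\<dots> \<le> (\<integral>\<^sup>+z. ?\<phi>1 (fst z) * ennreal (snd z) \<partial>chain k) + (\<integral>\<^sup>+z. ?\<phi>2 (fst z) * ennreal (snd z) \<partial>chain k)"
    using assms unfolding dominated_def by (intro add_mono) (auto intro!: borel_measurable_times borel_measurable_indicator)
  also have "\<dots> = (\<integral>\<^sup>+z. ?\<phi>1 (fst z) * ennreal (snd z) + ?\<phi>2 (fst z) * ennreal (snd z) \<partial>chain k)"
    by (rule nn_integral_add[symmetric]) measurable
  also have "\<dots> = (\<integral>\<^sup>+z. \<phi> (fst z) * ennreal (snd z) \<partial>chain k)"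
    by (intro nn_integral_cong) (auto simp: indicator_def space_chain S_def)
  finally show "(\<integral>\<^sup>+x. \<phi> x * sup (h x) (h' x) \<partial>H) \<le> (\<integral>\<^sup>+z. \<phi> (fst z) * ennreal (snd z) \<partial>chain k)" .
qed

text \<open>The running maximum includes the current value, which becomes visible once the last step
  of \<open>chain\<close> is unfolded.\<close>

lemma dominated_value: "dominated k (\<lambda>x. ennreal (f k x))"
  unfolding dominated_def
proof safe
  fix \<phi> :: "'a \<Rightarrow> ennreal" assume [measurable]: "\<phi> \<in> borel_measurable H"
  have "(\<integral>\<^sup>+x. \<phi> x * ennreal (f k x) \<partial>H) = (\<integral>\<^sup>+z. \<phi> (fst z) * ennreal (f k (fst z)) \<partial>chain k)"
    by (rule nn_integral_chain_position[symmetric]) measurable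
  also have "\<dots> \<le> (\<integral>\<^sup>+z. \<phi> (fst z) * ennreal (snd z) \<partial>chain k)"
  proof (cases k)
    case 0
    then show ?thesis by (simp only:) (subst (1 2) nn_integral_chain_0; simp)
  next
    case (Suc j)
    show ?thesis
      unfolding Suc
      by (subst (1 2) nn_integral_chain_Suc)
        (auto intro!: nn_integral_mono mult_left_mono ennreal_leI simp del: chain.simps)
  qed
  finally show "(\<integral>\<^sup>+x. \<phi> x * ennreal (f k x) \<partial>H) \<le> (\<integral>\<^sup>+z. \<phi> (fst z) * ennreal (snd z) \<partial>chain k)" .
qed measurable

text \<open>Reversibility moves the average from \<open>h\<close> to the test function. The averaged
  test function at time \<open>k\<close> is the expectation of the test function at time
  \<open>Suc k\<close>, and the running maximum only grows in between.\<close>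

lemma dominated_step:
  assumes h: "dominated k h"
  shows "dominated (Suc k) (\<lambda>x. \<integral>\<^sup>+y. h (act x y) \<partial>\<nu> k)"
  unfolding dominated_def
proof safe
  have [measurable]: "h \<in> borel_measurable H"
    using h by (simp add: dominated_def)
  then show "(\<lambda>x. \<integral>\<^sup>+y. h (act x y) \<partial>\<nu> k) \<in> borel_measurable H" by measurable
  fix \<phi> :: "'a \<Rightarrow> ennreal" assume [measurable]: "\<phi> \<in> borel_measurable H"
  have "(\<integral>\<^sup>+x. \<phi> x * (\<integral>\<^sup>+y. h (act x y) \<partial>\<nu> k) \<partial>H) = (\<integral>\<^sup>+x. (\<integral>\<^sup>+y. \<phi> (act x y) \<partial>\<nu> k) * h x \<partial>H)"
    by (rule reversible) measurable
  also have "\<dots> \<le> (\<integral>\<^sup>+z. (\<integral>\<^sup>+y. \<phi> (act (fst z) y) \<partial>\<nu> k) * ennreal (snd z) \<partial>chain k)"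
  proof -
    have "(\<lambda>x. \<integral>\<^sup>+y. \<phi> (act x y) \<partial>\<nu> k) \<in> borel_measurable H" by measurable
    from dominatedD[OF h this] show ?thesis .
  qed
  also have "\<dots> \<le> (\<integral>\<^sup>+z. (\<integral>\<^sup>+y. \<phi> (act (fst z) y) * ennreal (max (snd z) (f (Suc k) (act (fst z) y))) \<partial>\<nu> k) \<partial>chain k)"
  proof (rule nn_integral_mono)
    fix z assume "z \<in> space (chain k)"
    then have "fst z \<in> space H" by (auto simp: space_chain)
    then have [measurable]: "(\<lambda>y. \<phi> (act (fst z) y)) \<in> borel_measurable (\<nu> k)" by measurable
    have "(\<integral>\<^sup>+y. \<phi> (act (fst z) y) \<partial>\<nu> k) * ennreal (snd z) = (\<integral>\<^sup>+y. \<phi> (act (fst z) y) * ennreal (snd z) \<partial>\<nu> k)"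
      by (rule nn_integral_multc[symmetric]) measurable
    also have "\<dots> \<le> (\<integral>\<^sup>+y. \<phi> (act (fst z) y) * ennreal (max (snd z) (f (Suc k) (act (fst z) y))) \<partial>\<nu> k)"
      by (intro nn_integral_mono mult_left_mono ennreal_leI) auto
    finally show "(\<integral>\<^sup>+y. \<phi> (act (fst z) y) \<partial>\<nu> k) * ennreal (snd z) \<le> \<dots>" .
  qed
  also have "\<dots> = (\<integral>\<^sup>+z. \<phi> (fst z) * ennreal (snd z) \<partial>chain (Suc k))"
    by (subst nn_integral_chain_Suc) (auto simp del: chain.simps)
  finally show "(\<integral>\<^sup>+x. \<phi> x * (\<integral>\<^sup>+y. h (act x y) \<partial>\<nu> k) \<partial>H) \<le> (\<integral>\<^sup>+z. \<phi> (fst z) * ennreal (snd z) \<partial>chain (Suc k))" .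
qed

text \<open>In effect Jensen's inequality for the conditional expectation of the maximum: test with
  \<open>h^(p - 1)\<close>, split by Young and absorb the finite \<open>h\<close> term. Because
  \<open>c + d = 1\<close>, no constant is lost to the one in Doob's inequality.\<close>

lemma dominated_maximal_inequality:
  assumes p: "1 < p" and h: "dominated k h" and bound: "\<And>x. h x \<le> ennreal C"
  shows "(\<integral>\<^sup>+x. ennreal_powr (h x) p \<partial>H) \<le>
    ennreal ((p / (p - 1)) powr p) * (\<integral>\<^sup>+x. ennreal (f k x powr p) \<partial>H)"
proof -
  define c d where "c = 1 / p" and "d = (p - 1) / p"
  have cd: "0 < c" "0 \<le> d" "c + d = 1" using p by (auto simp: c_def d_def field_simps)
  have [measurable]: "h \<in> borel_measurable H" using h by (simp add: dominated_def)
  define g where "g x = enn2real (h x)" for x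
  have [measurable]: "g \<in> borel_measurable H" unfolding g_def by measurable
  have g: "h x = ennreal (g x)" "0 \<le> g x" "g x \<le> \<bar>C\<bar>" for x
  proof -
    have hx: "h x < \<top>" using bound[of x] by (meson ennreal_less_top le_less_trans)
    then show 1: "h x = ennreal (g x)" and "0 \<le> g x" by (simp_all add: g_def)
    \<comment> \<open>\<open>C\<close> may be negative, in which case \<open>ennreal C\<close> is 0;
      its absolute value is a valid real bound in either case.\<close>
    have "ennreal (g x) \<le> ennreal \<bar>C\<bar>"
      using bound[of x] 1 by (metis abs_ge_self ennreal_leI order_trans)
    then show "g x \<le> \<bar>C\<bar>" by (simp add: ennreal_le_iff)
  qed
  let ?G = "\<integral>\<^sup>+x. ennreal (g x powr p) \<partial>H"
  let ?M = "\<integral>\<^sup>+z. ennreal (snd z powr p) \<partial>chain k"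
  have "?G \<le> (\<integral>\<^sup>+x. ennreal (\<bar>C\<bar> powr p) \<partial>H)"
    using p g by (intro nn_integral_mono ennreal_leI powr_mono2) auto
  also have "\<dots> < \<top>" by (simp add: emeasure_space_1)
  finally have "?G < \<top>" .
  moreover have "?M < \<top>" using p by (intro nn_integral_chain_max_powr_finite) simp
  moreover define \<gamma> \<mu> where "\<gamma> = enn2real ?G" and "\<mu> = enn2real ?M"
  ultimately have \<gamma>: "?G = ennreal \<gamma>" "0 \<le> \<gamma>" and \<mu>: "?M = ennreal \<mu>" "0 \<le> \<mu>"
    by simp_all
  have "?G = (\<integral>\<^sup>+x. ennreal (g x powr (p - 1)) * h x \<partial>H)"
  proof (intro nn_integral_cong)
    fix x
    have "g x powr p = g x powr (p - 1) * g x"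
      using g(2)[of x] p powr_mult_base[of "g x" "p - 1"] by (simp add: mult.commute)
    then show "ennreal (g x powr p) = ennreal (g x powr (p - 1)) * h x"
      by (simp add: g ennreal_mult')
  qed
  also have "\<dots> \<le> (\<integral>\<^sup>+z. ennreal (g (fst z) powr (p - 1)) * ennreal (snd z) \<partial>chain k)"
  proof -
    have "(\<lambda>x. ennreal (g x powr (p - 1))) \<in> borel_measurable H" by measurable
    from dominatedD[OF h this] show ?thesis .
  qed
  also have "\<dots> \<le> (\<integral>\<^sup>+z. ennreal c * ennreal (snd z powr p) + ennreal d * ennreal (g (fst z) powr p) \<partial>chain k)"
  proof (intro nn_integral_mono_AE eventually_mono[OF AE_chain_bounds])
    fix z :: "'a \<times> real" assume z: "0 \<le> snd z \<and> snd z \<le> B"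
    then have "snd z * g (fst z) powr (p - 1) \<le> c * snd z powr p + d * g (fst z) powr p"
      using young_powr[OF p, of "snd z" "g (fst z)"] g by (simp add: c_def d_def mult_ac)
    then have "ennreal (g (fst z) powr (p - 1) * snd z) \<le> ennreal (c * snd z powr p + d * g (fst z) powr p)"
      by (intro ennreal_leI) (simp add: mult.commute)
    then show "ennreal (g (fst z) powr (p - 1)) * ennreal (snd z) \<le>
        ennreal c * ennreal (snd z powr p) + ennreal d * ennreal (g (fst z) powr p)"
      using cd z by (simp add: ennreal_mult')
  qed
  also have "\<dots> = ennreal c * ?M + ennreal d * (\<integral>\<^sup>+z. ennreal (g (fst z) powr p) \<partial>chain k)"
    by (subst nn_integral_add) (auto simp: nn_integral_cmult)
  also have "(\<integral>\<^sup>+z. ennreal (g (fst z) powr p) \<partial>chain k) = ?G"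
    by (rule nn_integral_chain_position) measurable
  also have "ennreal c * ?M + ennreal d * ?G = ennreal (c * \<mu> + d * \<gamma>)"
    using cd \<mu> \<gamma> by (simp add: ennreal_mult')
  finally have "\<gamma> \<le> c * \<mu> + d * \<gamma>"
    using cd \<mu> \<gamma> by (simp add: \<gamma>(1) del: ennreal_plus)
  moreover have "d = 1 - c" using cd by simp
  ultimately have "\<gamma> \<le> \<mu>"
    using cd by (simp add: algebra_simps)
  then have "?G \<le> ?M" using \<gamma> \<mu> by (simp add: ennreal_leI)
  also have "\<dots> \<le> ennreal ((p / (p - 1)) powr p) * (\<integral>\<^sup>+x. ennreal (f k x powr p) \<partial>H)"
    by (rule doob_maximal_inequality[OF p])
  finally show ?thesis by (simp add: g)
qed

end

section \<open>The maximal inequality on the torus\<close>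

text \<open>The convolution for \<open>[0,\<infinity>]\<close>-valued functions, free of
  integrability conditions. It multiplies by \<open>y n\<close> instead of its inverse, which agrees
  with \<open>poisson_op\<close> by the symmetry of the measure.\<close>

definition poisson_avg :: "(nat \<Rightarrow> real) \<Rightarrow> ((nat \<Rightarrow> complex) \<Rightarrow> ennreal) \<Rightarrow> (nat \<Rightarrow> complex) \<Rightarrow> ennreal" where
  "poisson_avg r f x = (\<integral>\<^sup>+y. f (\<lambda>n. x n * y n) \<partial>torus_poisson r)"

lemma measurable_poisson_avg:
  assumes r: "unit_radii r" and [measurable]: "f \<in> borel_measurable torus_borel"
  shows "poisson_avg r f \<in> borel_measurable torus_borel"
proof -
  interpret prob_space "torus_poisson r" by (rule prob_space_torus_poisson[OF r])
  show ?thesis unfolding poisson_avg_def by measurable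
qed

lemma poisson_avg_avg:
  assumes [measurable]: "f \<in> borel_measurable torus_borel" and a: "unit_radii a" and b: "unit_radii b"
    and x: "x \<in> space torus_borel"
  shows "poisson_avg a (poisson_avg b f) x = poisson_avg (\<lambda>n. a n * b n) f x"
proof -
  have "(\<lambda>y. f (\<lambda>n. x n * y n)) \<in> borel_measurable torus_borel"
    using x by measurable
  from nn_integral_torus_poisson_convolution[OF this a b] show ?thesis
    by (simp add: poisson_avg_def mult.assoc)
qed

text \<open>For each fixed \<open>y\<close>, invariance of Haar measure shifts the translation from
  \<open>h\<close> to \<open>\<phi>\<close>, where it appears as the inverse of \<open>y\<close>;
  symmetry of the Poisson measure removes the inverse.\<close>

lemma poisson_avg_reversible:
  assumes r: "unit_radii r" and [measurable]: "\<phi> \<in> borel_measurable torus_borel" "h \<in> borel_measurable torus_borel"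
  shows "(\<integral>\<^sup>+x. \<phi> x * poisson_avg r h x \<partial>torus_haar) = (\<integral>\<^sup>+x. poisson_avg r \<phi> x * h x \<partial>torus_haar)"
proof -
  interpret P: prob_space "torus_poisson r" by (rule prob_space_torus_poisson[OF r])
  interpret H: prob_space torus_haar by (rule prob_space_torus_haar)
  interpret pair_sigma_finite torus_haar "torus_poisson r" ..
  have m: "(\<lambda>y. f (\<lambda>n. x n * y n)) \<in> borel_measurable torus_borel"
    if "x \<in> space torus_borel" "f \<in> borel_measurable torus_borel" for x and f :: "(nat \<Rightarrow> complex) \<Rightarrow> ennreal"
    using that by measurable
  have "(\<integral>\<^sup>+x. \<phi> x * poisson_avg r h x \<partial>torus_haar) =
      (\<integral>\<^sup>+x. (\<integral>\<^sup>+y. \<phi> x * h (\<lambda>n. x n * y n) \<partial>torus_poisson r) \<partial>torus_haar)"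
  proof (rule nn_integral_cong)
    fix x assume "x \<in> space torus_haar"
    then have [measurable]: "(\<lambda>y. h (\<lambda>n. x n * y n)) \<in> borel_measurable torus_borel"
      by (intro m) (auto simp: space_torus_borel)
    show "\<phi> x * poisson_avg r h x = (\<integral>\<^sup>+y. \<phi> x * h (\<lambda>n. x n * y n) \<partial>torus_poisson r)"
      unfolding poisson_avg_def by (intro nn_integral_cmult[symmetric]) measurable
  qed
  also have "\<dots> = (\<integral>\<^sup>+y. (\<integral>\<^sup>+x. \<phi> x * h (\<lambda>n. x n * y n) \<partial>torus_haar) \<partial>torus_poisson r)"
    by (rule Fubini'[symmetric]) measurable
  also have "\<dots> = (\<integral>\<^sup>+y. (\<integral>\<^sup>+x. \<phi> (\<lambda>n. x n * inverse (y n)) * h x \<partial>torus_haar) \<partial>torus_poisson r)"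
  proof (rule nn_integral_cong)
    fix y assume "y \<in> space (torus_poisson r)"
    then have y: "y \<in> space torus_borel" by (simp add: space_torus_borel)
    then have ne: "y n \<noteq> 0" for n by (auto simp: space_torus_borel dest: spec[of _ n])
    let ?F = "\<lambda>x. \<phi> (\<lambda>n. x n * inverse (y n)) * h x"
    have [measurable]: "?F \<in> borel_measurable torus_borel" using y by measurable
    have "integral\<^sup>N torus_haar ?F = (\<integral>\<^sup>+x. ?F (\<lambda>n. y n * x n) \<partial>torus_haar)"
      by (rule nn_integral_torus_rotate[symmetric]) (use y in measurable)
    also have "\<dots> = (\<integral>\<^sup>+x. \<phi> x * h (\<lambda>n. x n * y n) \<partial>torus_haar)"
    proof -
      have "(\<lambda>n. y n * x n * inverse (y n)) = x" for x using ne by auto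
      then show ?thesis by (simp only:) (simp only: mult.commute)
    qed
    finally show "(\<integral>\<^sup>+x. \<phi> x * h (\<lambda>n. x n * y n) \<partial>torus_haar) = integral\<^sup>N torus_haar ?F" by simp
  qed
  also have "\<dots> = (\<integral>\<^sup>+x. (\<integral>\<^sup>+y. \<phi> (\<lambda>n. x n * inverse (y n)) * h x \<partial>torus_poisson r) \<partial>torus_haar)"
    by (rule Fubini') measurable
  also have "\<dots> = (\<integral>\<^sup>+x. poisson_avg r \<phi> x * h x \<partial>torus_haar)"
  proof (rule nn_integral_cong)
    fix x assume "x \<in> space torus_haar"
    then have x: "x \<in> space torus_borel" by (simp add: space_torus_borel)
    have [measurable]: "(\<lambda>y. \<phi> (\<lambda>n. x n * y n)) \<in> borel_measurable torus_borel"
      using x by (intro m) measurable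
    have [measurable]: "(\<lambda>y. \<phi> (\<lambda>n. x n * inverse (y n))) \<in> borel_measurable torus_borel"
      using x by measurable
    have "(\<integral>\<^sup>+y. \<phi> (\<lambda>n. x n * inverse (y n)) * h x \<partial>torus_poisson r) =
        (\<integral>\<^sup>+y. \<phi> (\<lambda>n. x n * inverse (y n)) \<partial>torus_poisson r) * h x"
      by (rule nn_integral_multc) measurable
    also have "(\<integral>\<^sup>+y. \<phi> (\<lambda>n. x n * inverse (y n)) \<partial>torus_poisson r) = poisson_avg r \<phi> x"
      unfolding poisson_avg_def
      by (rule nn_integral_torus_poisson_inverse[OF _ r, of "\<lambda>y. \<phi> (\<lambda>n. x n * y n)"]) measurable
    finally show "(\<integral>\<^sup>+y. \<phi> (\<lambda>n. x n * inverse (y n)) * h x \<partial>torus_poisson r) = poisson_avg r \<phi> x * h x" .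
  qed
  finally show ?thesis .
qed

text \<open>Each coordinate is almost surely 1, hence all of the countably many are. Thus the chain
  ends in \<open>g\<close> itself.\<close>

lemma poisson_avg_one:
  assumes [measurable]: "f \<in> borel_measurable torus_borel" and x: "x \<in> space torus_borel"
  shows "poisson_avg (\<lambda>_. 1) f x = f x"
proof -
  have r: "unit_radii (\<lambda>_. 1)" by (simp add: unit_radii_def)
  interpret T: prob_space "torus_poisson (\<lambda>_. 1)" by (rule prob_space_torus_poisson[OF r])
  interpret product_prob_space "\<lambda>n::nat. poisson_measure 1" UNIV
    by (intro product_prob_spaceI prob_space_poisson_measure) auto
  have "AE z in poisson_measure 1. z = 1"
  proof -
    have "{z \<in> space circle_haar. z = 1} = sphere 0 1 \<inter> {1}" by auto
    also have "\<dots> \<in> sets circle_haar" by (auto simp: sets_restrict_space)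
    finally have "Measurable.pred circle_haar (\<lambda>z. z = 1)" by (simp add: pred_def)
    then show ?thesis unfolding poisson_measure_def by (simp add: AE_return)
  qed
  then have "AE y in torus_poisson (\<lambda>_. 1). y n = 1" for n
    unfolding torus_poisson_def by (intro AE_component) auto
  then have "AE y in torus_poisson (\<lambda>_. 1). \<forall>n. y n = 1"
    by (simp add: AE_all_countable)
  then have "(\<integral>\<^sup>+y. f (\<lambda>n. x n * y n) \<partial>torus_poisson (\<lambda>_. 1)) = (\<integral>\<^sup>+y. f x \<partial>torus_poisson (\<lambda>_. 1))"
    by (intro nn_integral_cong_AE) (auto elim!: eventually_mono)
  then show ?thesis using T.emeasure_space_1 by (simp add: poisson_avg_def)
qed

lemma poisson_avg_le_const:
  assumes r: "unit_radii r" and g: "\<And>x. g x \<le> c"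
  shows "poisson_avg r g x \<le> c"
proof -
  interpret prob_space "torus_poisson r" by (rule prob_space_torus_poisson[OF r])
  have "poisson_avg r g x \<le> (\<integral>\<^sup>+y. c \<partial>torus_poisson r)"
    unfolding poisson_avg_def by (intro nn_integral_mono g)
  then show ?thesis using emeasure_space_1 by simp
qed

lemma torus_maximal_bounded:
  assumes r: "\<And>s. unit_radii (r s)" and mono: "\<And>n. incseq (\<lambda>s. r s n)" and p: "1 < p"
    and [measurable]: "g \<in> borel_measurable torus_borel" and g: "\<And>x. g x \<le> ennreal C"
  shows "(\<integral>\<^sup>+x. ennreal_powr (SUP s\<in>{..<N}. poisson_avg (r s) g x) p \<partial>torus_haar) \<le>
    ennreal ((p / (p - 1)) powr p) * (\<integral>\<^sup>+x. ennreal_powr (g x) p \<partial>torus_haar)"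
proof -
  \<comment> \<open>From time \<open>N\<close> on all radii are 1, so that \<open>f N\<close> is
    \<open>g\<close> and dividing by \<open>\<rho> N\<close> changes nothing.\<close>
  define \<rho> where "\<rho> k n = (if k < N then sqrt (r k n) else 1)" for k n
  \<comment> \<open>\<open>\<rho> k\<close> increases with \<open>k\<close>, so the value \<open>0 / 0 = 0\<close> does not affect \<open>q k n * \<rho> (Suc k) n = \<rho> k n\<close>.\<close>
  define q where "q k n = \<rho> k n / \<rho> (Suc k) n" for k n
  have r01: "0 \<le> r k n" "r k n \<le> 1" for k n
    using r[of k] by (auto simp: unit_radii_def)
  have \<rho>01: "0 \<le> \<rho> k n" "\<rho> k n \<le> 1" for k n
    using r01 by (auto simp: \<rho>_def)
  have \<rho>_le: "\<rho> k n \<le> \<rho> l n" if "k \<le> l" for k l n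
    using that incseqD[OF mono that, of n] r01 by (auto simp: \<rho>_def)
  have \<rho>: "unit_radii (\<rho> k)" for k
    using \<rho>01 by (auto simp: unit_radii_def)
  have q: "unit_radii (q k)" for k
    using \<rho>01 \<rho>_le[of k "Suc k"] by (auto simp: unit_radii_def q_def divide_le_eq_1 zero_le_divide_iff less_le)
  have q_\<rho>: "q k n * \<rho> (Suc k) n = \<rho> k n" for k n
    using \<rho>01[of k n] \<rho>_le[of k "Suc k" n] by (auto simp: q_def)
  define f where "f k x = enn2real (poisson_avg (\<rho> k) g x)" for k x
  have fin: "poisson_avg (\<rho> k) g x \<le> ennreal C" for k x
    by (rule poisson_avg_le_const[OF \<rho> g])
  have f: "ennreal (f k x) = poisson_avg (\<rho> k) g x" for k x
    using le_less_trans[OF fin[of k x] ennreal_less_top] by (simp add: f_def)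
  have [measurable]: "poisson_avg (\<rho> k) g \<in> borel_measurable torus_borel" for k
    by (intro measurable_poisson_avg \<rho>) measurable
  interpret reversible_chain torus_haar "\<lambda>k. torus_poisson (q k)" "\<lambda>x y n. x n * y n" f "\<bar>C\<bar>"
  proof (intro reversible_chain.intro reversible_chain_axioms.intro)
    show "prob_space torus_haar" by (rule prob_space_torus_haar)
    show "prob_space (torus_poisson (q k))" for k by (rule prob_space_torus_poisson[OF q])
    show "(\<lambda>(x, y) n. x n * y n) \<in> torus_haar \<Otimes>\<^sub>M torus_poisson (q k) \<rightarrow>\<^sub>M torus_haar" for k
      by measurable
    show "f k \<in> borel_measurable torus_haar" for k
      unfolding f_def by measurable
    show "0 \<le> f k x" for k x by (simp add: f_def)
    show "f k x \<le> \<bar>C\<bar>" for k x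
    proof -
      have "ennreal (f k x) \<le> ennreal \<bar>C\<bar>"
        unfolding f by (rule order_trans[OF fin]) (simp add: ennreal_leI)
      then show ?thesis by simp
    qed
    fix k and \<phi> h :: "(nat \<Rightarrow> complex) \<Rightarrow> ennreal"
    assume "\<phi> \<in> borel_measurable torus_haar" "h \<in> borel_measurable torus_haar"
    then have "\<phi> \<in> borel_measurable torus_borel" "h \<in> borel_measurable torus_borel" by measurable
    from poisson_avg_reversible[OF q[of k] this]
    show "(\<integral>\<^sup>+x. \<phi> x * (\<integral>\<^sup>+y. h (\<lambda>n. x n * y n) \<partial>torus_poisson (q k)) \<partial>torus_haar) =
      (\<integral>\<^sup>+x. (\<integral>\<^sup>+y. \<phi> (\<lambda>n. x n * y n) \<partial>torus_poisson (q k)) * h x \<partial>torus_haar)"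
      by (simp add: poisson_avg_def)
  next
    fix k x assume "x \<in> space torus_haar"
    then have "x \<in> space torus_borel" by (simp add: space_torus_borel)
    then have "poisson_avg (q k) (poisson_avg (\<rho> (Suc k)) g) x = poisson_avg (\<rho> k) g x"
      by (subst poisson_avg_avg[OF _ q \<rho>]) (simp_all add: q_\<rho>)
    then show "(\<integral>\<^sup>+y. ennreal (f (Suc k) (\<lambda>n. x n * y n)) \<partial>torus_poisson (q k)) = ennreal (f k x)"
      unfolding f by (simp only: poisson_avg_def[of "q k"])
  qed
  \<comment> \<open>The radii interpolate between \<open>\<rho> s\<close> at \<open>k = s\<close>,
    where the function is \<open>f s\<close>, and \<open>\<rho> s\<close> squared, that is
    \<open>r s\<close>, at \<open>k = N\<close>; each step multiplies them by \<open>q k\<close>. If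
    \<open>\<rho> k n = 0\<close>, then \<open>\<rho> s n = 0\<close> as well, and the quotient 0 is
    the right one.\<close>
  have dom: "dominated k (poisson_avg (\<lambda>n. \<rho> s n * \<rho> s n / \<rho> k n) g)" if "s \<le> k" for s k
    using that
  proof (induction k rule: dec_induct)
    case base
    have "\<rho> s n * \<rho> s n / \<rho> s n = \<rho> s n" for n by simp
    then show ?case using dominated_value[of s] by (simp add: f)
  next
    case (step k)
    have u: "unit_radii (\<lambda>n. \<rho> s n * \<rho> s n / \<rho> k n)"
      unfolding unit_radii_def
    proof (intro allI conjI)
      fix n
      have "\<rho> s n * \<rho> s n \<le> 1 * \<rho> k n"
        using \<rho>01 \<rho>_le[OF step.hyps(1)] by (intro mult_mono) auto
      then show "\<rho> s n * \<rho> s n / \<rho> k n \<le> 1"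
        using \<rho>01[of k n] by (cases "\<rho> k n = 0") (auto simp: divide_le_eq_1)
      show "0 \<le> \<rho> s n * \<rho> s n / \<rho> k n"
        using \<rho>01 by simp
    qed
    have *: "q k n * (\<rho> s n * \<rho> s n / \<rho> k n) = \<rho> s n * \<rho> s n / \<rho> (Suc k) n" for n
      using \<rho>_le[OF step.hyps(1), of n] \<rho>01[of s n] by (cases "\<rho> k n = 0") (auto simp: q_def)
    show ?case
    proof (rule dominated_cong[OF dominated_step[OF step.IH]])
      fix x assume "x \<in> space torus_haar"
      then have "x \<in> space torus_borel" by (simp add: space_torus_borel)
      then show "(\<integral>\<^sup>+y. poisson_avg (\<lambda>n. \<rho> s n * \<rho> s n / \<rho> k n) g (\<lambda>n. x n * y n) \<partial>torus_poisson (q k)) =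
          poisson_avg (\<lambda>n. \<rho> s n * \<rho> s n / \<rho> (Suc k) n) g x"
        using poisson_avg_avg[OF _ q u, of g x k] by (simp add: poisson_avg_def[of "q k"] * del: times_divide_eq_right)
    qed
  qed
  have dom_r: "dominated N (poisson_avg (r s) g)" if "s < N" for s
  proof -
    have "(\<lambda>n. \<rho> s n * \<rho> s n / \<rho> N n) = r s"
      using that r01 by (auto simp: \<rho>_def)
    then show ?thesis using dom[of s N] that by simp
  qed
  \<comment> \<open>The supremum is built up one radius at a time; over the empty set it is
    0.\<close>
  have "dominated N (\<lambda>x. SUP s\<in>{..<m}. poisson_avg (r s) g x)" if "m \<le> N" for m
    using that
  proof (induction m)
    case 0
    then show ?case by (simp add: dominated_def bot_ennreal)
  next
    case (Suc m)
    then show ?case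
      using dominated_sup[OF dom_r[of m] Suc.IH] by (simp add: lessThan_Suc)
  qed
  from this[OF order_refl]
  have "(\<integral>\<^sup>+x. ennreal_powr (SUP s\<in>{..<N}. poisson_avg (r s) g x) p \<partial>torus_haar) \<le>
      ennreal ((p / (p - 1)) powr p) * (\<integral>\<^sup>+x. ennreal (f N x powr p) \<partial>torus_haar)"
    using poisson_avg_le_const[OF r g] by (intro dominated_maximal_inequality[OF p, where C=C] SUP_least)
  also have "(\<integral>\<^sup>+x. ennreal (f N x powr p) \<partial>torus_haar) = (\<integral>\<^sup>+x. ennreal_powr (g x) p \<partial>torus_haar)"
  proof (rule nn_integral_cong)
    fix x assume "x \<in> space torus_haar"
    then have "x \<in> space torus_borel" by (simp add: space_torus_borel)
    then have "g x = ennreal (f N x)"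
      unfolding f by (simp add: \<rho>_def[abs_def] poisson_avg_one)
    then show "ennreal (f N x powr p) = ennreal_powr (g x) p"
      by (simp add: f_def)
  qed
  finally show ?thesis .
qed

section \<open>From finitely many radii and bounded functions to the general case\<close>

lemma ennreal_powr_mono: "0 < a \<Longrightarrow> x \<le> y \<Longrightarrow> ennreal_powr x a \<le> ennreal_powr y a"
  by (cases x; cases y) (auto simp: ennreal_powr_def top_unique intro!: ennreal_leI powr_mono2)

lemma ennreal_powr_powr_inverse:
  assumes "0 < a"
  shows "ennreal_powr (ennreal_powr x a) (1 / a) = x" "ennreal_powr (ennreal_powr x (1 / a)) a = x"
  using assms by (cases x; simp add: ennreal_powr_def powr_powr)+

lemma ennreal_powr_SUP_le:
  fixes u :: "nat \<Rightarrow> ennreal"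
  assumes "0 < a"
  shows "ennreal_powr (SUP n. u n) a \<le> (SUP n. ennreal_powr (u n) a)"
proof -
  have "(SUP n. u n) \<le> ennreal_powr (SUP n. ennreal_powr (u n) a) (1 / a)"
  proof (rule SUP_least)
    fix n
    have "ennreal_powr (ennreal_powr (u n) a) (1 / a) \<le> ennreal_powr (SUP n. ennreal_powr (u n) a) (1 / a)"
      using assms by (intro ennreal_powr_mono SUP_upper) auto
    then show "u n \<le> ennreal_powr (SUP n. ennreal_powr (u n) a) (1 / a)"
      by (simp add: ennreal_powr_powr_inverse[OF assms])
  qed
  from ennreal_powr_mono[OF assms this] show ?thesis
    by (simp add: ennreal_powr_powr_inverse[OF assms])
qed

text \<open>One index \<open>n\<close> both truncates \<open>g\<close> at height \<open>n\<close>
  and limits the supremum to the first \<open>n\<close> radii. The resulting maximal functions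
  \<open>G n\<close> increase, so monotone convergence applies with a constant independent of
  \<open>n\<close>.\<close>

lemma torus_maximal_inequality:
  assumes r: "\<And>s. unit_radii (r s)" and mono: "\<And>n. incseq (\<lambda>s. r s n)" and p: "1 < p"
    and [measurable]: "g \<in> borel_measurable torus_borel"
  shows "(\<integral>\<^sup>+x. ennreal_powr (SUP s. poisson_avg (r s) g x) p \<partial>torus_haar) \<le>
    ennreal ((p / (p - 1)) powr p) * (\<integral>\<^sup>+x. ennreal_powr (g x) p \<partial>torus_haar)"
proof -
  define g' where "g' n x = min (g x) (of_nat n)" for n x
  define G where "G n x = (SUP s\<in>{..<n}. poisson_avg (r s) (g' n) x)" for n x
  have g'_meas [measurable]: "g' n \<in> borel_measurable torus_borel" for n
    unfolding g'_def by measurable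
  have avg_meas [measurable]: "poisson_avg (r s) (g' n) \<in> borel_measurable torus_borel" for s n
    by (rule measurable_poisson_avg[OF r]) measurable
  have [measurable]: "G n \<in> borel_measurable torus_borel" for n
    unfolding G_def by measurable
  have g'_mono: "g' m x \<le> g' n x" if "m \<le> n" for m n x
    using that unfolding g'_def by (intro min.mono) auto
  have g'_SUP: "(SUP n. g' n x) = g x" for x
  proof (rule antisym)
    show "(SUP n. g' n x) \<le> g x" by (rule SUP_least) (simp add: g'_def)
    show "g x \<le> (SUP n. g' n x)"
    proof (cases "g x = \<top>")
      case True
      then have "(SUP n. g' n x) = (SUP n. of_nat n)" by (simp add: g'_def)
      then show ?thesis by (simp only: ennreal_SUP_of_nat_eq_top top_greatest)
    next
      case False
      then obtain n :: nat where "g x \<le> of_nat n"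
        by (metis ennreal_Ex_less_of_nat less_imp_le top.not_eq_extremum)
      then have "g x \<le> g' n x" by (simp add: g'_def)
      also have "\<dots> \<le> (SUP n. g' n x)" by (rule SUP_upper) simp
      finally show ?thesis .
    qed
  qed
  have avg_mono: "poisson_avg (r s) (g' m) x \<le> poisson_avg (r s) (g' n) x" if "m \<le> n" for s m n x
    unfolding poisson_avg_def by (intro nn_integral_mono g'_mono that)
  have G_mono: "incseq G"
    unfolding G_def by (intro incseq_SucI le_funI SUP_mono') (auto intro!: SUP_subset_mono avg_mono)
  have le: "(SUP s. poisson_avg (r s) g x) \<le> (SUP n. G n x)" if x: "x \<in> space torus_borel" for x
  proof (rule SUP_least)
    fix s
    have m: "(\<lambda>y. g' n (\<lambda>i. x i * y i)) \<in> borel_measurable (torus_poisson (r s))" for n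
      using x by measurable
    have "poisson_avg (r s) g x = (\<integral>\<^sup>+y. (SUP n. g' n (\<lambda>i. x i * y i)) \<partial>torus_poisson (r s))"
      by (simp add: poisson_avg_def g'_SUP)
    also have "\<dots> = (SUP n. poisson_avg (r s) (g' n) x)"
      unfolding poisson_avg_def
      by (rule nn_integral_monotone_convergence_SUP[OF _ m]) (auto simp: incseq_def le_fun_def g'_mono)
    also have "\<dots> \<le> (SUP n. G n x)"
    proof (rule SUP_mono)
      fix n
      \<comment> \<open>The index must reach \<open>Suc s\<close> for the radius \<open>s\<close> to
        be among those counted in \<open>G\<close>.\<close>
      have "poisson_avg (r s) (g' n) x \<le> poisson_avg (r s) (g' (max n (Suc s))) x"
        by (rule avg_mono) simp
      also have "\<dots> \<le> G (max n (Suc s)) x"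
        unfolding G_def by (rule SUP_upper) auto
      finally show "\<exists>m\<in>UNIV. poisson_avg (r s) (g' n) x \<le> G m x" by blast
    qed
    finally show "poisson_avg (r s) g x \<le> (SUP n. G n x)" .
  qed
  have "(\<integral>\<^sup>+x. ennreal_powr (SUP s. poisson_avg (r s) g x) p \<partial>torus_haar) \<le>
      (\<integral>\<^sup>+x. (SUP n. ennreal_powr (G n x) p) \<partial>torus_haar)"
  proof (rule nn_integral_mono)
    fix x assume "x \<in> space torus_haar"
    then have "x \<in> space torus_borel" by (simp add: space_torus_borel)
    then have "ennreal_powr (SUP s. poisson_avg (r s) g x) p \<le> ennreal_powr (SUP n. G n x) p"
      using p by (intro ennreal_powr_mono le) auto
    also have "\<dots> \<le> (SUP n. ennreal_powr (G n x) p)"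
      using p by (intro ennreal_powr_SUP_le) auto
    finally show "ennreal_powr (SUP s. poisson_avg (r s) g x) p \<le> \<dots>" .
  qed
  also have "\<dots> = (SUP n. \<integral>\<^sup>+x. ennreal_powr (G n x) p \<partial>torus_haar)"
    using G_mono p
    by (intro nn_integral_monotone_convergence_SUP) (auto simp: incseq_def le_fun_def intro!: ennreal_powr_mono)
  also have "\<dots> \<le> ennreal ((p / (p - 1)) powr p) * (\<integral>\<^sup>+x. ennreal_powr (g x) p \<partial>torus_haar)"
  proof (rule SUP_least)
    fix n
    have "(\<integral>\<^sup>+x. ennreal_powr (G n x) p \<partial>torus_haar) \<le>
        ennreal ((p / (p - 1)) powr p) * (\<integral>\<^sup>+x. ennreal_powr (g' n x) p \<partial>torus_haar)"
      unfolding G_def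
      by (rule torus_maximal_bounded[OF r mono p g'_meas, where C="real n"]) (simp add: g'_def ennreal_of_nat_eq_real_of_nat)
    also have "\<dots> \<le> ennreal ((p / (p - 1)) powr p) * (\<integral>\<^sup>+x. ennreal_powr (g x) p \<partial>torus_haar)"
      using p by (intro mult_left_mono nn_integral_mono ennreal_powr_mono) (auto simp: g'_def)
    finally show "(\<integral>\<^sup>+x. ennreal_powr (G n x) p \<partial>torus_haar) \<le>
        ennreal ((p / (p - 1)) powr p) * (\<integral>\<^sup>+x. ennreal_powr (g x) p \<partial>torus_haar)" .
  qed
  finally show ?thesis .
qed

section \<open>Almost everywhere convergence\<close>

lemma measurable_torus_shift:
  assumes [measurable]: "g \<in> torus_borel \<rightarrow>\<^sub>M N" and x: "x \<in> space torus_borel"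
  shows "(\<lambda>y. g (\<lambda>n. x n * inverse (y n))) \<in> torus_borel \<rightarrow>\<^sub>M N"
  using x by measurable

lemma poisson_op_altdef:
  "poisson_op r g x = (\<integral>y. g (\<lambda>n. x n * inverse (y n)) \<partial>torus_poisson r)"
  by (simp add: poisson_op_def torus_convolution_def)

lemma nn_integral_torus_shift:
  assumes r: "unit_radii r" and [measurable]: "g \<in> borel_measurable torus_borel" and x: "x \<in> space torus_borel"
  shows "(\<integral>\<^sup>+y. g (\<lambda>n. x n * inverse (y n)) \<partial>torus_poisson r) = poisson_avg r g x"
proof -
  have "(\<lambda>y. g (\<lambda>n. x n * y n)) \<in> borel_measurable torus_borel"
    using x by measurable
  from nn_integral_torus_poisson_inverse[OF this r] show ?thesis
    by (simp add: poisson_avg_def)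
qed

lemma integrable_torus_shift:
  fixes g :: "(nat \<Rightarrow> complex) \<Rightarrow> complex"
  assumes r: "unit_radii r" and [measurable]: "g \<in> borel_measurable torus_borel" and x: "x \<in> space torus_borel"
    and fin: "poisson_avg r (\<lambda>x. ennreal (cmod (g x))) x < \<top>"
  shows "integrable (torus_poisson r) (\<lambda>y. g (\<lambda>n. x n * inverse (y n)))"
proof (rule integrableI_bounded)
  have "(\<lambda>y. g (\<lambda>n. x n * inverse (y n))) \<in> borel_measurable torus_borel"
    by (rule measurable_torus_shift[OF _ x]) measurable
  then show "(\<lambda>y. g (\<lambda>n. x n * inverse (y n))) \<in> borel_measurable (torus_poisson r)"
    by measurable
  show "(\<integral>\<^sup>+y. ennreal (cmod (g (\<lambda>n. x n * inverse (y n)))) \<partial>torus_poisson r) < \<infinity>"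
    using fin nn_integral_torus_shift[OF r, of "\<lambda>x. ennreal (cmod (g x))" x] x by simp
qed

text \<open>Valid at every point: where the integrand is not integrable, the right side is
  infinite.\<close>

lemma poisson_op_bound:
  fixes g :: "(nat \<Rightarrow> complex) \<Rightarrow> complex"
  assumes r: "unit_radii r" and [measurable]: "g \<in> borel_measurable torus_borel" and x: "x \<in> space torus_borel"
  shows "ennreal (cmod (poisson_op r g x)) \<le> poisson_avg r (\<lambda>x. ennreal (cmod (g x))) x"
proof (cases "poisson_avg r (\<lambda>x. ennreal (cmod (g x))) x = \<top>")
  case False
  then have "integrable (torus_poisson r) (\<lambda>y. g (\<lambda>n. x n * inverse (y n)))"
    by (intro integrable_torus_shift r x) (auto simp: less_top)
  from integral_norm_bound_ennreal[OF this] show ?thesis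
    using nn_integral_torus_shift[OF r, of "\<lambda>x. ennreal (cmod (g x))" x] x
    by (simp add: poisson_op_altdef)
qed simp

lemma measurable_poisson_op:
  fixes g :: "(nat \<Rightarrow> complex) \<Rightarrow> complex"
  assumes r: "unit_radii r" and [measurable]: "g \<in> borel_measurable torus_borel"
  shows "poisson_op r g \<in> borel_measurable torus_borel"
proof -
  interpret prob_space "torus_poisson r" by (rule prob_space_torus_poisson[OF r])
  show ?thesis
    unfolding poisson_op_altdef[abs_def] by (rule borel_measurable_lebesgue_integral) measurable
qed

lemma ennreal_power2_le_imp_le:
  assumes "x\<^sup>2 \<le> (ennreal c)\<^sup>2" "0 \<le> c"
  shows "x \<le> ennreal c"
proof (cases x)
  case (real a)
  with assms have "a\<^sup>2 \<le> c\<^sup>2" by (simp add: ennreal_power)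
  then have "a \<le> c" using assms(2) by (rule power2_le_imp_le)
  then show ?thesis using real by (simp add: ennreal_leI)
next
  case top
  then have "x\<^sup>2 = \<top>" by (simp add: power2_eq_square)
  moreover have "(ennreal c)\<^sup>2 < \<top>" using assms(2) by (simp add: ennreal_power)
  ultimately show ?thesis using assms(1) by (simp add: top_unique)
qed

text \<open>The marginal in coordinate \<open>j\<close> is \<open>poisson_measure (r j)\<close>, and
  Cauchy-Schwarz reduces the first moment to the second.\<close>

lemma nn_integral_torus_component_distance:
  assumes r: "unit_radii r"
  shows "(\<integral>\<^sup>+y. ennreal (cmod (y j - 1)) \<partial>torus_poisson r) \<le> ennreal (sqrt (2 - 2 * r j))"
proof -
  have rj: "0 \<le> r j" "r j \<le> 1" using r by (auto simp: unit_radii_def)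
  interpret prob_space "poisson_measure (r j)" by (rule prob_space_poisson_measure[OF rj])
  let ?I = "\<integral>\<^sup>+z. ennreal (cmod (z - 1)) \<partial>poisson_measure (r j)"
  have [measurable]: "(\<lambda>z. ennreal (cmod (z - 1))) \<in> borel_measurable circle_borel" by measurable
  have m: "(\<lambda>z. cmod (z - 1)) \<in> borel_measurable (poisson_measure (r j))"
    unfolding measurable_cong_sets[OF sets_poisson_measure refl]
    by (rule measurable_compose[OF measurable_circle_id]) measurable
  have "(\<integral>\<^sup>+y. ennreal (cmod (y j - 1)) \<partial>torus_poisson r) = ?I"
    using nn_integral_PiM_prod[of "\<lambda>n. poisson_measure (r n)" "{j}" "\<lambda>_ z. ennreal (cmod (z - 1))"] r m
    by (simp add: torus_poisson_def prob_space_poisson_measure unit_radii_def)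
  moreover have "?I\<^sup>2 \<le> (ennreal (sqrt (2 - 2 * r j)))\<^sup>2"
  proof -
    have "(\<integral>\<^sup>+z. ennreal (cmod (z - 1)) * 1 \<partial>poisson_measure (r j))\<^sup>2 \<le>
        (\<integral>\<^sup>+z. (ennreal (cmod (z - 1)))\<^sup>2 \<partial>poisson_measure (r j)) * (\<integral>\<^sup>+z. 1\<^sup>2 \<partial>poisson_measure (r j))"
      using m by (intro Cauchy_Schwarz_nn_integral) simp_all
    also have "\<dots> = ennreal (2 - 2 * r j)"
      using emeasure_space_1 nn_integral_poisson_second_moment[OF rj] by (simp add: ennreal_power)
    also have "\<dots> = (ennreal (sqrt (2 - 2 * r j)))\<^sup>2"
      using rj by (simp add: ennreal_power)
    finally show ?thesis by simp
  qed
  then have "?I \<le> ennreal (sqrt (2 - 2 * r j))"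
    using rj by (intro ennreal_power2_le_imp_le) auto
  ultimately show ?thesis by simp
qed

locale increasing_radii =
  fixes r :: "nat \<Rightarrow> nat \<Rightarrow> real" and p :: real
  assumes unit: "\<And>s. unit_radii (r s)"
    and mono: "\<And>n. incseq (\<lambda>s. r s n)"
    and lim: "\<And>n. (\<lambda>s. r s n) \<longlonglongrightarrow> 1"
    and p: "1 < p"
begin

text \<open>For factors of modulus at most 1, the difference of two products is at most the sum of
  the differences of factors. Translation by the inverse of \<open>y\<close> moves coordinate
  \<open>j\<close> by exactly the distance of \<open>y j\<close> from 1, whose mean tends to 0.
  Convergence holds at every point.\<close>

lemma poisson_op_tendsto_cylinder:
  fixes h :: "nat \<Rightarrow> complex \<Rightarrow> complex"
  assumes J: "finite J" and h: "\<And>j. h j \<in> borel_measurable borel" "\<And>j z. cmod (h j z) \<le> 1"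
    and lip: "\<And>j z w. cmod (h j z - h j w) \<le> L * cmod (z - w)" and L: "0 \<le> L" and x: "x \<in> space torus_borel"
  shows "(\<lambda>s. poisson_op (r s) (\<lambda>x. \<Prod>j\<in>J. h j (x j)) x) \<longlonglongrightarrow> (\<Prod>j\<in>J. h j (x j))"
proof -
  let ?g = "\<lambda>x. \<Prod>j\<in>J. h j (x j)"
  have bound: "cmod (poisson_op (r s) ?g x - ?g x) \<le> (\<Sum>j\<in>J. L * sqrt (2 - 2 * r s j))" for s
  proof -
    interpret prob_space "torus_poisson (r s)" by (rule prob_space_torus_poisson[OF unit])
    note [measurable] = h(1)
    have [measurable]: "?g \<in> borel_measurable torus_borel"
      by (intro borel_measurable_prod measurable_compose[OF measurable_compose[OF measurable_torus_component measurable_circle_id] h(1)])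
    have [measurable]: "(\<lambda>y. ?g (\<lambda>n. x n * inverse (y n))) \<in> borel_measurable torus_borel"
      by (rule measurable_torus_shift[OF _ x]) measurable
    have g1: "cmod (?g z) \<le> 1" for z
      using h(2) by (auto simp: prod_norm[symmetric] intro!: prod_le_1)
    have int: "integrable (torus_poisson (r s)) (\<lambda>y. ?g (\<lambda>n. x n * inverse (y n)))"
    proof (rule integrable_const_bound[where B=1])
      show "(\<lambda>y. ?g (\<lambda>n. x n * inverse (y n))) \<in> borel_measurable (torus_poisson (r s))" by measurable
    qed (use g1 in auto)
    have "poisson_op (r s) ?g x - ?g x = (\<integral>y. ?g (\<lambda>n. x n * inverse (y n)) - ?g x \<partial>torus_poisson (r s))"
      unfolding poisson_op_altdef using int by (simp add: prob_space[simplified])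
    also have "ennreal (cmod \<dots>) \<le> (\<integral>\<^sup>+y. ennreal (cmod (?g (\<lambda>n. x n * inverse (y n)) - ?g x)) \<partial>torus_poisson (r s))"
      using int by (intro integral_norm_bound_ennreal) auto
    also have "\<dots> \<le> (\<integral>\<^sup>+y. (\<Sum>j\<in>J. ennreal L * ennreal (cmod (y j - 1))) \<partial>torus_poisson (r s))"
    proof (rule nn_integral_mono)
      fix y assume "y \<in> space (torus_poisson (r s))"
      then have y: "cmod (y j) = 1" "y j \<noteq> 0" for j by (auto dest: spec[of _ j])
      have "cmod (?g (\<lambda>n. x n * inverse (y n)) - ?g x) \<le> (\<Sum>j\<in>J. cmod (h j (x j * inverse (y j)) - h j (x j)))"
        by (intro norm_prod_diff h(2))
      also have "\<dots> \<le> (\<Sum>j\<in>J. L * cmod (y j - 1))"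
      proof (intro sum_mono)
        fix j
        have "x j * inverse (y j) - x j = x j * inverse (y j) * (1 - y j)"
          using y(2)[of j] by (simp add: field_simps)
        then have "cmod (x j * inverse (y j) - x j) = cmod (y j - 1)"
          using x y(1)[of j] by (simp add: norm_mult norm_inverse space_torus_borel norm_minus_commute)
        then show "cmod (h j (x j * inverse (y j)) - h j (x j)) \<le> L * cmod (y j - 1)"
          using lip[of j "x j * inverse (y j)" "x j"] by simp
      qed
      finally show "ennreal (cmod (?g (\<lambda>n. x n * inverse (y n)) - ?g x)) \<le> (\<Sum>j\<in>J. ennreal L * ennreal (cmod (y j - 1)))"
        using L by (simp add: ennreal_mult[symmetric] sum_ennreal ennreal_leI)
    qed
    also have "\<dots> = (\<Sum>j\<in>J. ennreal L * (\<integral>\<^sup>+y. ennreal (cmod (y j - 1)) \<partial>torus_poisson (r s)))"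
    proof -
      have m [measurable]: "(\<lambda>y. ennreal (cmod (y j - 1))) \<in> borel_measurable torus_borel" for j
        using measurable_compose[OF measurable_torus_component measurable_circle_id] by measurable
      show ?thesis
        by (subst nn_integral_sum) (auto simp: nn_integral_cmult)
    qed
    also have "\<dots> \<le> (\<Sum>j\<in>J. ennreal L * ennreal (sqrt (2 - 2 * r s j)))"
      by (intro sum_mono mult_left_mono nn_integral_torus_component_distance unit) simp
    also have "\<dots> = ennreal (\<Sum>j\<in>J. L * sqrt (2 - 2 * r s j))"
      using L unit[of s] by (simp add: ennreal_mult[symmetric] sum_ennreal unit_radii_def)
    finally show ?thesis
      using L unit[of s] by (subst (asm) ennreal_le_iff) (auto intro!: sum_nonneg simp: unit_radii_def)
  qed
  have "(\<lambda>s. \<Sum>j\<in>J. L * sqrt (2 - 2 * r s j)) \<longlonglongrightarrow> (\<Sum>j\<in>J. L * sqrt (2 - 2 * 1))"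
    by (intro tendsto_intros lim)
  then have "(\<lambda>s. \<Sum>j\<in>J. L * sqrt (2 - 2 * r s j)) \<longlonglongrightarrow> 0" by simp
  from Lim_null_comparison[OF _ this, of "\<lambda>s. poisson_op (r s) ?g x - ?g x"] bound
  show ?thesis by (subst LIM_zero_iff[symmetric]) simp
qed

end

lemma ennreal_powr_top [simp]: "ennreal_powr \<top> a = \<top>"
  by (simp add: ennreal_powr_def)

lemma ennreal_powr_zero [simp]: "ennreal_powr 0 a = 0"
  by (simp add: ennreal_powr_def)

lemma ennreal_powr_eq_top_iff [simp]: "ennreal_powr x a = \<top> \<longleftrightarrow> x = \<top>"
  by (simp add: ennreal_powr_def)

lemma ennreal_powr_eq_zero_iff [simp]: "ennreal_powr x a = 0 \<longleftrightarrow> x = 0"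
  by (cases x) (auto simp: ennreal_powr_def)

lemma ennreal_powr_mult_left:
  assumes "0 < c" shows "ennreal_powr (ennreal c * x) a = ennreal (c powr a) * ennreal_powr x a"
proof (cases x)
  case (real b)
  then show ?thesis using assms by (simp add: ennreal_mult[symmetric] powr_mult)
next
  case top
  then show ?thesis using assms by (simp add: ennreal_mult_top)
qed

lemma ennreal_powr_sup_le:
  "ennreal_powr (sup x y) a \<le> ennreal_powr x a + ennreal_powr y a"
  by (cases x y rule: linorder_le_cases) (auto simp: sup_absorb1 sup_absorb2 add_increasing add_increasing2)

lemma ennreal_cmod_diff_le:
  assumes "ennreal (cmod a) \<le> W" "ennreal (cmod b) \<le> W"
  shows "ennreal (cmod (a - b)) \<le> ennreal 2 * W"
proof -
  have "ennreal (cmod (a - b)) \<le> ennreal (cmod a + cmod b)"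
    by (intro ennreal_leI norm_triangle_ineq4)
  also have "\<dots> = ennreal (cmod a) + ennreal (cmod b)" by simp
  also have "\<dots> \<le> W + W" by (intro add_mono assms)
  finally show ?thesis by (simp add: mult_2)
qed

text \<open>Dominated convergence with the majorant \<open>(2 * W)^p\<close>. It serves both the
  approximation arguments and the final convergence in \<open>L^p\<close>.\<close>

lemma nn_integral_powr_tendsto_zero:
  fixes u :: "nat \<Rightarrow> 'a \<Rightarrow> complex"
  assumes p: "0 < p" and [measurable]: "\<And>n. u n \<in> borel_measurable M" "v \<in> borel_measurable M" "W \<in> borel_measurable M"
    and W: "(\<integral>\<^sup>+x. ennreal_powr (W x) p \<partial>M) < \<top>"
    and bound: "\<And>n. AE x in M. ennreal (cmod (u n x)) \<le> W x" "AE x in M. ennreal (cmod (v x)) \<le> W x"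
    and lim: "AE x in M. (\<lambda>n. u n x) \<longlonglongrightarrow> v x"
  shows "(\<lambda>n. \<integral>\<^sup>+x. ennreal_powr (ennreal (cmod (u n x - v x))) p \<partial>M) \<longlonglongrightarrow> 0"
proof -
  have "(\<lambda>n. \<integral>\<^sup>+x. ennreal_powr (ennreal (cmod (u n x - v x))) p \<partial>M) \<longlonglongrightarrow> (\<integral>\<^sup>+x. 0 \<partial>M)"
  proof (rule nn_integral_dominated_convergence)
    show "AE x in M. ennreal_powr (ennreal (cmod (u n x - v x))) p \<le> ennreal_powr (ennreal 2 * W x) p" for n
      using bound(1)[of n] bound(2)
      by eventually_elim (intro ennreal_powr_mono p ennreal_cmod_diff_le)
    have "(\<integral>\<^sup>+x. ennreal_powr (ennreal 2 * W x) p \<partial>M) = ennreal (2 powr p) * (\<integral>\<^sup>+x. ennreal_powr (W x) p \<partial>M)"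
      by (simp only: ennreal_powr_mult_left zero_less_numeral) (rule nn_integral_cmult, measurable)
    also have "\<dots> < \<infinity>" using W by (simp add: ennreal_mult_less_top)
    finally show "(\<integral>\<^sup>+x. ennreal_powr (ennreal 2 * W x) p \<partial>M) < \<infinity>" .
    show "AE x in M. (\<lambda>n. ennreal_powr (ennreal (cmod (u n x - v x))) p) \<longlonglongrightarrow> 0"
      using lim
    proof eventually_elim
      fix x assume "(\<lambda>n. u n x) \<longlonglongrightarrow> v x"
      then have "(\<lambda>n. cmod (u n x - v x)) \<longlonglongrightarrow> 0"
        using LIM_zero tendsto_norm_zero by blast
      then have "(\<lambda>n. cmod (u n x - v x) powr p) \<longlonglongrightarrow> 0"
        using p by (intro tendsto_zero_powrI[OF _ tendsto_const]) auto
      then have "(\<lambda>n. ennreal (cmod (u n x - v x) powr p)) \<longlonglongrightarrow> ennreal 0"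
        by (rule tendsto_ennrealI)
      then show "(\<lambda>n. ennreal_powr (ennreal (cmod (u n x - v x))) p) \<longlonglongrightarrow> 0"
        by simp
    qed
  qed measurable
  then show ?thesis by simp
qed

lemma poisson_avg_mono:
  assumes "x \<in> space torus_borel" "\<And>y. y \<in> space torus_borel \<Longrightarrow> f y \<le> f' y"
  shows "poisson_avg r f x \<le> poisson_avg r f' x"
  unfolding poisson_avg_def using assms
  by (intro nn_integral_mono) (auto simp: space_torus_borel norm_mult)

lemma torus_shift_in_space:
  "x \<in> space torus_borel \<Longrightarrow> y \<in> space (torus_poisson r) \<Longrightarrow> (\<lambda>n. x n * inverse (y n)) \<in> space torus_borel"
  by (simp add: space_torus_borel norm_mult norm_inverse)

lemma AE_torus_haarI:
  "(\<And>x. x \<in> space torus_borel \<Longrightarrow> P x) \<Longrightarrow> AE x in torus_haar. P x"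
  by (rule AE_I2) (simp add: space_torus_borel)

section \<open>Dominated limits and sums of functions with almost everywhere convergence\<close>

context increasing_radii
begin

lemma measurable_maximal [measurable]:
  assumes "W \<in> borel_measurable torus_borel"
  shows "(\<lambda>x. SUP s. poisson_avg (r s) W x) \<in> borel_measurable torus_borel"
  using measurable_poisson_avg[OF unit assms] by (intro borel_measurable_SUP) auto

text \<open>The maximal inequality gives one null set for all \<open>s\<close>. Off it, the
  convolutions of every function dominated by \<open>W\<close> are genuine integrals, hence
  linear.\<close>

lemma AE_poisson_avg_finite:
  assumes [measurable]: "W \<in> borel_measurable torus_borel" and W: "(\<integral>\<^sup>+x. ennreal_powr (W x) p \<partial>torus_haar) < \<top>"
  shows "AE x in torus_haar. \<forall>s. poisson_avg (r s) W x < \<top>"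
proof -
  have "(\<integral>\<^sup>+x. ennreal_powr (SUP s. poisson_avg (r s) W x) p \<partial>torus_haar) \<le>
      ennreal ((p / (p - 1)) powr p) * (\<integral>\<^sup>+x. ennreal_powr (W x) p \<partial>torus_haar)"
    by (rule torus_maximal_inequality[OF unit mono p]) measurable
  also have "\<dots> < \<top>" using W by (simp add: ennreal_mult_less_top)
  finally have "AE x in torus_haar. ennreal_powr (SUP s. poisson_avg (r s) W x) p \<noteq> \<infinity>"
    by (intro nn_integral_PInf_AE) auto
  then show ?thesis
  proof eventually_elim
    fix x assume "ennreal_powr (SUP s. poisson_avg (r s) W x) p \<noteq> \<infinity>"
    then have "(SUP s. poisson_avg (r s) W x) < \<top>"
      by (simp only: infinity_ennreal_def ennreal_powr_eq_top_iff not_False_eq_True top.not_eq_extremum)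
    then show "\<forall>s. poisson_avg (r s) W x < \<top>"
      by (meson SUP_upper UNIV_I le_less_trans)
  qed
qed

definition converges_ae :: "((nat \<Rightarrow> complex) \<Rightarrow> complex) \<Rightarrow> bool" where
  "converges_ae g \<longleftrightarrow> g \<in> borel_measurable torus_borel \<and>
     (AE x in torus_haar. (\<lambda>s. poisson_op (r s) g x) \<longlonglongrightarrow> g x)"

lemma converges_ae_cong:
  assumes f: "converges_ae f" and eq: "\<And>x. x \<in> space torus_borel \<Longrightarrow> f x = g x"
  shows "converges_ae g"
  unfolding converges_ae_def
proof
  show "g \<in> borel_measurable torus_borel"
    using f eq by (simp add: converges_ae_def cong: measurable_cong)
  have op: "poisson_op (r s) f x = poisson_op (r s) g x" if "x \<in> space torus_borel" for s x
    unfolding poisson_op_altdef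
    using torus_shift_in_space[OF that] by (intro Bochner_Integration.integral_cong refl eq)
  have "AE x in torus_haar. x \<in> space torus_borel" by (rule AE_torus_haarI)
  moreover have "AE x in torus_haar. (\<lambda>s. poisson_op (r s) f x) \<longlonglongrightarrow> f x"
    using f by (simp add: converges_ae_def)
  ultimately show "AE x in torus_haar. (\<lambda>s. poisson_op (r s) g x) \<longlonglongrightarrow> g x"
    by eventually_elim (simp add: op eq)
qed

text \<open>Banach's principle: the errors \<open>D n\<close> tend to 0 in \<open>L^p\<close>, the
  maximal inequality passes this on to the suprema over \<open>s\<close>, and a three-epsilon
  argument concludes at almost every point.\<close>

lemma converges_ae_dominated_limit:
  fixes h :: "nat \<Rightarrow> (nat \<Rightarrow> complex) \<Rightarrow> complex"
  assumes h: "\<And>n. converges_ae (h n)" and [measurable]: "g \<in> borel_measurable torus_borel" "W \<in> borel_measurable torus_borel"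
    and W: "(\<integral>\<^sup>+x. ennreal_powr (W x) p \<partial>torus_haar) < \<top>"
    and lim: "\<And>x. x \<in> space torus_borel \<Longrightarrow> (\<lambda>n. h n x) \<longlonglongrightarrow> g x"
    and hW: "\<And>n x. x \<in> space torus_borel \<Longrightarrow> ennreal (cmod (h n x)) \<le> W x"
    and gW: "\<And>x. x \<in> space torus_borel \<Longrightarrow> ennreal (cmod (g x)) \<le> W x"
  shows "converges_ae g"
proof -
  have [measurable]: "h n \<in> borel_measurable torus_borel" for n
    using h by (simp add: converges_ae_def)
  define D where "D n x = ennreal (cmod (h n x - g x))" for n x
  have [measurable]: "D n \<in> borel_measurable torus_borel" for n
    unfolding D_def by measurable
  \<comment> \<open>Collects both errors that are uniform in \<open>s\<close>. Its infimum over
    \<open>n\<close> vanishes almost everywhere, since the \<open>p\<close>th power of that infimum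
    has an integral below every member of a null sequence; no almost everywhere convergent
    subsequence has to be chosen.\<close>
  define Z where "Z n x = sup (SUP s. poisson_avg (r s) (D n) x) (D n x)" for n x
  have [measurable]: "Z n \<in> borel_measurable torus_borel" for n
    unfolding Z_def by measurable
  let ?c = "ennreal ((p / (p - 1)) powr p)"
  have D0: "(\<lambda>n. \<integral>\<^sup>+x. ennreal_powr (D n x) p \<partial>torus_haar) \<longlonglongrightarrow> 0"
    unfolding D_def using p W
    by (intro nn_integral_powr_tendsto_zero[where W=W] AE_torus_haarI lim hW gW) measurable
  have "(\<lambda>n. (?c + 1) * (\<integral>\<^sup>+x. ennreal_powr (D n x) p \<partial>torus_haar)) \<longlonglongrightarrow> (?c + 1) * 0"
    by (rule ennreal_tendsto_cmult[OF _ D0]) (simp add: less_top)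
  moreover have "(\<integral>\<^sup>+x. ennreal_powr (INF n. Z n x) p \<partial>torus_haar) \<le>
      (?c + 1) * (\<integral>\<^sup>+x. ennreal_powr (D n x) p \<partial>torus_haar)" for n
  proof -
    have "(\<integral>\<^sup>+x. ennreal_powr (INF n. Z n x) p \<partial>torus_haar) \<le> (\<integral>\<^sup>+x. ennreal_powr (Z n x) p \<partial>torus_haar)"
      using p by (intro nn_integral_mono ennreal_powr_mono INF_lower) auto
    also have "\<dots> \<le> (\<integral>\<^sup>+x. ennreal_powr (SUP s. poisson_avg (r s) (D n) x) p + ennreal_powr (D n x) p \<partial>torus_haar)"
      unfolding Z_def by (intro nn_integral_mono ennreal_powr_sup_le)
    also have "\<dots> = (\<integral>\<^sup>+x. ennreal_powr (SUP s. poisson_avg (r s) (D n) x) p \<partial>torus_haar) + (\<integral>\<^sup>+x. ennreal_powr (D n x) p \<partial>torus_haar)"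
      by (rule nn_integral_add) measurable
    also have "\<dots> \<le> ?c * (\<integral>\<^sup>+x. ennreal_powr (D n x) p \<partial>torus_haar) + (\<integral>\<^sup>+x. ennreal_powr (D n x) p \<partial>torus_haar)"
      by (intro add_right_mono torus_maximal_inequality unit mono p) measurable
    finally show ?thesis by (simp add: distrib_right)
  qed
  ultimately have "(\<integral>\<^sup>+x. ennreal_powr (INF n. Z n x) p \<partial>torus_haar) \<le> 0"
    by (intro LIMSEQ_le_const[where X="\<lambda>n. (?c + 1) * (\<integral>\<^sup>+x. ennreal_powr (D n x) p \<partial>torus_haar)"]) auto
  then have "AE x in torus_haar. ennreal_powr (INF n. Z n x) p = 0"
    by (subst nn_integral_0_iff_AE[symmetric]) auto
  moreover have "AE x in torus_haar. \<forall>n. (\<lambda>s. poisson_op (r s) (h n) x) \<longlonglongrightarrow> h n x"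
    using h by (simp add: converges_ae_def AE_all_countable)
  moreover have "AE x in torus_haar. x \<in> space torus_borel" by (rule AE_torus_haarI)
  moreover have "AE x in torus_haar. \<forall>s. poisson_avg (r s) W x < \<top>"
    by (rule AE_poisson_avg_finite[OF _ W]) measurable
  ultimately have "AE x in torus_haar. (\<lambda>s. poisson_op (r s) g x) \<longlonglongrightarrow> g x"
  proof eventually_elim
    fix x assume Z: "ennreal_powr (INF n. Z n x) p = 0"
      and hx: "\<forall>n. (\<lambda>s. poisson_op (r s) (h n) x) \<longlonglongrightarrow> h n x"
      and x: "x \<in> space torus_borel" and fin: "\<forall>s. poisson_avg (r s) W x < \<top>"
    have int: "integrable (torus_poisson (r s)) (\<lambda>y. u (\<lambda>n. x n * inverse (y n)))"
      if "u \<in> borel_measurable torus_borel" "\<And>x. x \<in> space torus_borel \<Longrightarrow> ennreal (cmod (u x)) \<le> W x" for u :: "(nat \<Rightarrow> complex) \<Rightarrow> complex" and s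
    proof (rule integrable_torus_shift[OF unit that(1) x])
      have "poisson_avg (r s) (\<lambda>x. ennreal (cmod (u x))) x \<le> poisson_avg (r s) W x"
        by (rule poisson_avg_mono[OF x that(2)])
      also have "\<dots> < \<top>" using fin by simp
      finally show "poisson_avg (r s) (\<lambda>x. ennreal (cmod (u x))) x < \<top>" .
    qed
    show "(\<lambda>s. poisson_op (r s) g x) \<longlonglongrightarrow> g x"
    proof (rule LIMSEQ_I)
      fix \<epsilon> :: real assume \<epsilon>: "0 < \<epsilon>"
      have "(INF n. Z n x) < ennreal (\<epsilon> / 3)" using Z \<epsilon> by simp
      then obtain n where n: "Z n x < ennreal (\<epsilon> / 3)" by (auto simp: INF_less_iff)
      obtain S where S: "\<And>s. S \<le> s \<Longrightarrow> cmod (poisson_op (r s) (h n) x - h n x) < \<epsilon> / 3"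
        using LIMSEQ_D[OF hx[rule_format, of n], of "\<epsilon> / 3"] \<epsilon> by auto
      have d: "cmod (h n x - g x) < \<epsilon> / 3"
      proof -
        have "D n x \<le> Z n x" by (simp add: Z_def)
        then have "ennreal (cmod (h n x - g x)) < ennreal (\<epsilon> / 3)"
          using n unfolding D_def by (rule le_less_trans)
        then show ?thesis by (simp add: ennreal_less_iff)
      qed
      have m: "cmod (poisson_op (r s) (h n) x - poisson_op (r s) g x) < \<epsilon> / 3" for s
      proof -
        have "poisson_op (r s) (\<lambda>x. h n x - g x) x = poisson_op (r s) (h n) x - poisson_op (r s) g x"
          unfolding poisson_op_altdef by (intro Bochner_Integration.integral_diff int hW gW) auto
        then have "ennreal (cmod (poisson_op (r s) (h n) x - poisson_op (r s) g x)) \<le> poisson_avg (r s) (D n) x"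
          using poisson_op_bound[OF unit _ x, of "\<lambda>x. h n x - g x" s] by (simp add: D_def[abs_def])
        also have "\<dots> \<le> (SUP s. poisson_avg (r s) (D n) x)" by (rule SUP_upper) simp
        also have "\<dots> \<le> Z n x" by (simp add: Z_def)
        also note n
        finally show ?thesis by (simp add: ennreal_less_iff)
      qed
      have "norm (poisson_op (r s) g x - g x) < \<epsilon>" if "S \<le> s" for s
      proof -
        \<comment> \<open>Shaped for the identity
          \<open>P g - g = (P h - h) + (h - g) - (P h - P g)\<close>.\<close>
        have tri: "cmod (a + b - c) \<le> cmod a + cmod b + cmod c" for a b c
          using norm_triangle_ineq4[of "a + b" c] norm_triangle_ineq[of a b] by linarith
        show ?thesis
          using tri[of "poisson_op (r s) (h n) x - h n x" "h n x - g x" "poisson_op (r s) (h n) x - poisson_op (r s) g x"]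
            S[OF that] d m[of s] by simp
      qed
      then show "\<exists>no. \<forall>s\<ge>no. norm (poisson_op (r s) g x - g x) < \<epsilon>" by blast
    qed
  qed
  then show ?thesis by (simp add: converges_ae_def)
qed

lemma converges_ae_sum:
  assumes I: "finite I" and f: "\<And>i. i \<in> I \<Longrightarrow> converges_ae (f i)" and B: "\<And>i x. i \<in> I \<Longrightarrow> cmod (f i x) \<le> B"
  shows "converges_ae (\<lambda>x. \<Sum>i\<in>I. c i * f i x)"
  unfolding converges_ae_def
proof
  have m: "f i \<in> borel_measurable torus_borel" if "i \<in> I" for i
    using f[OF that] by (simp add: converges_ae_def)
  then show "(\<lambda>x. \<Sum>i\<in>I. c i * f i x) \<in> borel_measurable torus_borel"
    by (intro borel_measurable_sum borel_measurable_times) auto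
  have "AE x in torus_haar. \<forall>i\<in>I. (\<lambda>s. poisson_op (r s) (f i) x) \<longlonglongrightarrow> f i x"
    using f by (intro AE_finite_allI[OF I]) (simp add: converges_ae_def)
  moreover have "AE x in torus_haar. x \<in> space torus_borel" by (rule AE_torus_haarI)
  ultimately show "AE x in torus_haar. (\<lambda>s. poisson_op (r s) (\<lambda>x. \<Sum>i\<in>I. c i * f i x) x) \<longlonglongrightarrow> (\<Sum>i\<in>I. c i * f i x)"
  proof eventually_elim
    fix x assume lim: "\<forall>i\<in>I. (\<lambda>s. poisson_op (r s) (f i) x) \<longlonglongrightarrow> f i x" and x: "x \<in> space torus_borel"
    have int: "integrable (torus_poisson (r s)) (\<lambda>y. f i (\<lambda>n. x n * inverse (y n)))" if "i \<in> I" for i s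
    proof (rule integrable_torus_shift[OF unit m[OF that] x])
      have "poisson_avg (r s) (\<lambda>x. ennreal (cmod (f i x))) x \<le> ennreal B"
        by (intro poisson_avg_le_const unit ennreal_leI B that)
      also have "\<dots> < \<top>" by simp
      finally show "poisson_avg (r s) (\<lambda>x. ennreal (cmod (f i x))) x < \<top>" .
    qed
    have "poisson_op (r s) (\<lambda>x. \<Sum>i\<in>I. c i * f i x) x = (\<Sum>i\<in>I. c i * poisson_op (r s) (f i) x)" for s
      unfolding poisson_op_altdef
      by (subst Bochner_Integration.integral_sum) (auto intro!: integrable_mult_right int)
    then show "(\<lambda>s. poisson_op (r s) (\<lambda>x. \<Sum>i\<in>I. c i * f i x) x) \<longlonglongrightarrow> (\<Sum>i\<in>I. c i * f i x)"
      using lim by (auto intro!: tendsto_intros)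
  qed
qed

end

section \<open>Open boxes and the passage to all of \<open>L^p\<close>\<close>

text \<open>The distance to the complement. The whole plane is separate, because
  \<open>infdist\<close> to the empty set is 0 by convention.\<close>

lemma open_lipschitz_support:
  fixes U :: "complex set"
  assumes "open U"
  obtains u :: "complex \<Rightarrow> real" where "\<And>z. 0 \<le> u z" "\<And>z w. \<bar>u z - u w\<bar> \<le> cmod (z - w)" "U = {z. 0 < u z}"
proof (cases "U = UNIV")
  case True
  then show ?thesis by (intro that[of "\<lambda>_. 1"]) auto
next
  case False
  have "0 < infdist z (- U) \<longleftrightarrow> z \<in> U" for z
    using False assms in_closed_iff_infdist_zero[of "- U" z] infdist_nonneg[of z "- U"]
    by (auto simp: less_le)
  then show ?thesis
    using infdist_triangle_abs[of _ "- U"] by (intro that[of "\<lambda>z. infdist z (- U)"]) (auto simp: dist_norm infdist_nonneg)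
qed

text \<open>A generator suited to both needs of Dynkin's lemma: closed under intersection, with
  indicators that are limits of products of Lipschitz functions of finitely many
  coordinates.\<close>

definition open_boxes :: "(nat \<Rightarrow> complex) set set" where
  "open_boxes = {{x \<in> space torus_borel. \<forall>j\<in>J. x j \<in> U j} | J U. finite J \<and> (\<forall>j. open (U j))}"

lemma Int_stable_open_boxes: "Int_stable open_boxes"
proof (rule Int_stableI)
  fix A B assume "A \<in> open_boxes" "B \<in> open_boxes"
  then obtain J U K V where A: "A = {x \<in> space torus_borel. \<forall>j\<in>J. x j \<in> U j}" "finite J" "\<forall>j. open (U j)"
    and B: "B = {x \<in> space torus_borel. \<forall>j\<in>K. x j \<in> V j}" "finite K" "\<forall>j. open (V j)"
    by (auto simp: open_boxes_def)
  \<comment> \<open>Coordinates constrained by only one of the two boxes are padded with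
    \<open>UNIV\<close>.\<close>
  let ?W = "\<lambda>j. (if j \<in> J then U j else UNIV) \<inter> (if j \<in> K then V j else UNIV)"
  have "A \<inter> B = {x \<in> space torus_borel. \<forall>j\<in>J \<union> K. x j \<in> ?W j}"
    using A B by auto
  moreover have "finite (J \<union> K)" "\<forall>j. open (?W j)" using A B by auto
  ultimately show "A \<inter> B \<in> open_boxes"
    unfolding open_boxes_def by (intro CollectI exI[of _ "J \<union> K"] exI[of _ ?W] conjI)
qed

lemma sets_torus_borel_open_boxes: "sets torus_borel = sigma_sets (space torus_borel) open_boxes"
proof
  have sub: "open_boxes \<subseteq> Pow (space torus_borel)" by (auto simp: open_boxes_def)
  show "sigma_sets (space torus_borel) open_boxes \<subseteq> sets torus_borel"
  proof (rule sets.sigma_sets_subset, rule subsetI)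
    fix A assume "A \<in> open_boxes"
    then obtain J U where A: "A = {x \<in> space torus_borel. \<forall>j\<in>J. x j \<in> U j}" "finite J" "\<forall>j. open (U j)"
      by (auto simp: open_boxes_def)
    have "{x \<in> space torus_borel. x j \<in> U j} \<in> sets torus_borel" for j
      using A(3) by (intro measurable_sets_Collect[OF measurable_compose[OF measurable_torus_component measurable_circle_id]]) auto
    then show "A \<in> sets torus_borel"
      unfolding A(1) by (intro sets.sets_Collect_finite_All A(2)) auto
  qed
  let ?M = "sigma (space torus_borel) open_boxes"
  \<comment> \<open>The nontrivial inclusion amounts to measurability of the identity, and thus of
    each coordinate; the preimage of an open set under a coordinate is a box with one
    constraint.\<close>
  have "(\<lambda>x. x) \<in> ?M \<rightarrow>\<^sub>M torus_borel"
  proof (rule measurable_torusI, rule measurable_restrict_space2)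
    fix n
    show "(\<lambda>x. x n) \<in> space ?M \<rightarrow> sphere 0 1"
      using sub by (simp add: space_torus_borel)
    show "(\<lambda>x. x n) \<in> borel_measurable ?M"
    proof (rule borel_measurableI)
      fix S :: "complex set" assume "open S"
      then have "{x \<in> space torus_borel. \<forall>j\<in>{n}. x j \<in> (\<lambda>_. S) j} \<in> open_boxes"
        unfolding open_boxes_def by (intro CollectI exI[of _ "{n}"] exI[of _ "\<lambda>_. S"]) auto
      moreover have "{x \<in> space torus_borel. \<forall>j\<in>{n}. x j \<in> (\<lambda>_. S) j} = (\<lambda>x. x n) -` S \<inter> space ?M"
        using sub by auto
      ultimately show "(\<lambda>x. x n) -` S \<inter> space ?M \<in> sets ?M"
        using sub by (simp add: sigma_sets.Basic)
    qed
  qed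
  show "sets torus_borel \<subseteq> sigma_sets (space torus_borel) open_boxes"
  proof
    fix A assume A: "A \<in> sets torus_borel"
    from measurable_sets[OF \<open>(\<lambda>x. x) \<in> ?M \<rightarrow>\<^sub>M torus_borel\<close> A] sets.sets_into_space[OF A]
    show "A \<in> sigma_sets (space torus_borel) open_boxes"
      using sub by (simp add: Int_absorb2)
  qed
qed

context increasing_radii
begin

lemma converges_ae_bounded_limit:
  fixes h :: "nat \<Rightarrow> (nat \<Rightarrow> complex) \<Rightarrow> complex"
  assumes "\<And>n. converges_ae (h n)" "g \<in> borel_measurable torus_borel"
    and "\<And>x. x \<in> space torus_borel \<Longrightarrow> (\<lambda>n. h n x) \<longlonglongrightarrow> g x"
    and "\<And>n x. x \<in> space torus_borel \<Longrightarrow> cmod (h n x) \<le> 1"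
    and "\<And>x. x \<in> space torus_borel \<Longrightarrow> cmod (g x) \<le> 1"
  shows "converges_ae g"
proof (rule converges_ae_dominated_limit[where W="\<lambda>_. ennreal 1"])
  interpret prob_space torus_haar by (rule prob_space_torus_haar)
  show "(\<integral>\<^sup>+x. ennreal_powr (ennreal 1) p \<partial>torus_haar) < \<top>"
    using emeasure_space_1 by (simp add: top.not_eq_extremum[symmetric])
qed (use assms in \<open>auto intro: ennreal_leI simp del: ennreal_1\<close>)

lemma converges_ae_box:
  assumes "A \<in> open_boxes"
  shows "converges_ae (indicator A)"
proof -
  obtain J U where A: "A = {x \<in> space torus_borel. \<forall>j\<in>J. x j \<in> U j}" and J: "finite J" and U: "\<And>j. open (U j)"
    using assms by (auto simp: open_boxes_def)
  have "\<exists>u. (\<forall>z. 0 \<le> u z) \<and> (\<forall>z w. \<bar>u z - u w\<bar> \<le> cmod (z - w)) \<and> U j = {z. 0 < u z}" for j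
    by (rule open_lipschitz_support[OF U[of j]]) blast
  then obtain u :: "nat \<Rightarrow> complex \<Rightarrow> real" where u: "\<And>j z. 0 \<le> u j z" "\<And>j z w. \<bar>u j z - u j w\<bar> \<le> cmod (z - w)"
    "\<And>j. U j = {z. 0 < u j z}"
    by metis
  \<comment> \<open>Lipschitz with constant \<open>k\<close> and bounded by 1; as \<open>k\<close>
    grows, it tends to the indicator of \<open>U j\<close>, the set where \<open>u j\<close> is
    positive.\<close>
  define h where "h k j z = complex_of_real (min 1 (real k * u j z))" for k j z
  have h1: "cmod (h k j z) \<le> 1" for k j z
    using u(1) by (simp add: h_def min_def)
  have lip: "cmod (h k j z - h k j w) \<le> real k * cmod (z - w)" for k j z w
  proof -
    have "\<bar>min 1 (real k * u j z) - min 1 (real k * u j w)\<bar> \<le> \<bar>real k * u j z - real k * u j w\<bar>"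
      by (auto simp: min_def)
    also have "\<dots> = real k * \<bar>u j z - u j w\<bar>"
      by (simp add: abs_mult flip: right_diff_distrib)
    also have "\<dots> \<le> real k * cmod (z - w)"
      using u(2) by (intro mult_left_mono) auto
    finally show ?thesis by (simp add: h_def flip: of_real_diff)
  qed
  have hm: "h k j \<in> borel_measurable borel" for k j
  proof (rule borel_measurable_continuous_onI, rule lipschitz_on_continuous_on)
    show "(real k)-lipschitz_on UNIV (h k j)"
      using lip by (intro lipschitz_onI) (auto simp: dist_norm)
  qed
  have gm: "(\<lambda>x. \<Prod>j\<in>J. h k j (x j)) \<in> borel_measurable torus_borel" for k
    by (intro borel_measurable_prod measurable_compose[OF measurable_compose[OF measurable_torus_component measurable_circle_id] hm])
  have A_sets: "A \<in> sets torus_borel"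
    using assms by (simp add: sets_torus_borel_open_boxes sigma_sets.Basic)
  show ?thesis
  proof (rule converges_ae_bounded_limit)
    show "converges_ae (\<lambda>x. \<Prod>j\<in>J. h k j (x j))" for k
      unfolding converges_ae_def
      using gm poisson_op_tendsto_cylinder[OF J hm h1 lip] by (auto intro!: AE_torus_haarI)
    show "cmod (\<Prod>j\<in>J. h k j (x j)) \<le> 1" for k x
      using h1 by (auto simp: prod_norm[symmetric] intro!: prod_le_1)
    fix x assume x: "x \<in> space torus_borel"
    have "(\<lambda>k. h k j z) \<longlonglongrightarrow> indicator (U j) z" for j z
    proof (cases "0 < u j z")
      case True
      obtain N :: nat where N: "1 < real N * u j z" using reals_Archimedean3[OF True] by blast
      have "h k j z = 1" if "N \<le> k" for k
      proof -
        have "real N * u j z \<le> real k * u j z" using that True by (intro mult_right_mono) auto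
        then show ?thesis using N by (simp add: h_def)
      qed
      then have "eventually (\<lambda>k. h k j z = indicator (U j) z) sequentially"
        using True by (auto simp: u(3) eventually_sequentially)
      then show ?thesis by (rule tendsto_eventually)
    next
      case False
      then have "u j z = 0" using u(1)[of j z] by simp
      then show ?thesis by (simp add: h_def u(3))
    qed
    then have "(\<lambda>k. \<Prod>j\<in>J. h k j (x j)) \<longlonglongrightarrow> (\<Prod>j\<in>J. indicator (U j) (x j))"
      by (intro tendsto_prod)
    also have "(\<Prod>j\<in>J. indicator (U j) (x j)) = (indicator A x :: complex)"
      using J x by (auto simp: A indicator_def prod_zero_iff intro!: prod.neutral)
    finally show "(\<lambda>k. \<Prod>j\<in>J. h k j (x j)) \<longlonglongrightarrow> indicator A x" .
  qed (use A_sets in \<open>auto simp: indicator_def\<close>)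
qed

lemma converges_ae_indicator:
  assumes "A \<in> sets torus_borel"
  shows "converges_ae (indicator A)"
proof -
  have "open_boxes \<subseteq> Pow (space torus_borel)" by (auto simp: open_boxes_def)
  from Int_stable_open_boxes this assms[unfolded sets_torus_borel_open_boxes] show ?thesis
  proof (induction rule: sigma_sets_induct_disjoint)
    case (basic A)
    then show ?case by (rule converges_ae_box)
  next
    case empty
    then show ?case
      by (simp add: converges_ae_def poisson_op_altdef)
  next
    case (compl A)
    \<comment> \<open>The complement is a difference of two indicators, indexed by the booleans to
      fit \<open>converges_ae_sum\<close>.\<close>
    let ?f = "\<lambda>i. if i then indicator (space torus_borel) else indicator A :: (nat \<Rightarrow> complex) \<Rightarrow> complex"
    have "space torus_borel \<in> open_boxes"
      unfolding open_boxes_def by (rule CollectI, rule exI[of _ "{}"], rule exI[of _ "\<lambda>_. UNIV"]) auto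
    then have "converges_ae (indicator (space torus_borel))" by (rule converges_ae_box)
    then have "converges_ae (\<lambda>x. \<Sum>i\<in>UNIV. (if i then 1 else - 1) * ?f i x)"
    proof (intro converges_ae_sum[where B=1])
      show "converges_ae (?f i)" for i
        using compl.IH \<open>converges_ae (indicator (space torus_borel))\<close> by (cases i) (simp_all only: if_True if_False)
    qed (auto simp: indicator_def)
    then show ?case
      by (rule converges_ae_cong) (auto simp: UNIV_bool indicator_def)
  next
    case (union A)
    have A: "A i \<in> sets torus_borel" for i
      using union.hyps by (simp add: sets_torus_borel_open_boxes image_subset_iff)
    have sums: "(\<lambda>i. indicator (A i) x) sums (indicator (\<Union>i. A i) x :: complex)" for x
    proof (cases "x \<in> (\<Union>i. A i)")
      case True
      then obtain k where k: "x \<in> A k" by auto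
      then have "indicator (A i) x = (if i = k then 1 else 0 :: complex)" for i
        using union.hyps(1) by (auto simp: disjoint_family_on_def indicator_def)
      then show ?thesis using sums_single[of k "\<lambda>_. 1 :: complex"] True by simp
    next
      case False
      then show ?thesis by (auto simp: indicator_def)
    qed
    \<comment> \<open>By disjointness the partial sums are again indicators, which gives the uniform
      bound 1. The factor 1 matches the form of \<open>converges_ae_sum\<close>.\<close>
    have partial: "(\<Sum>i<n. 1 * indicator (A i) x) = (indicator (\<Union>i<n. A i) x :: complex)" for n x
    proof -
      have "disjoint_family_on A {..<n}"
        using union.hyps(1) by (rule disjoint_family_on_mono[rotated]) simp
      then show ?thesis by (simp add: indicator_UN_disjoint)
    qed
    show ?case
    proof (rule converges_ae_bounded_limit)
      show "converges_ae (\<lambda>x. \<Sum>i<n. 1 * indicator (A i) x)" for n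
      proof (rule converges_ae_sum[where B=1])
        show "converges_ae (indicator (A i))" for i by (rule union.IH)
      qed (simp_all add: indicator_def)
      show "(\<lambda>n. \<Sum>i<n. 1 * indicator (A i) x) \<longlonglongrightarrow> (indicator (\<Union>i. A i) x :: complex)" for x
        using sums[of x] unfolding sums_def mult_1 .
      show "cmod (\<Sum>i<n. 1 * indicator (A i) x) \<le> 1" for n x
        unfolding partial by (simp add: indicator_def)
      show "indicator (\<Union>i. A i) \<in> borel_measurable torus_borel"
        by (intro borel_measurable_indicator sets.countable_UN) (auto simp: A)
      show "cmod (indicator (\<Union>i. A i) x) \<le> 1" for x
        by (simp add: indicator_def)
    qed
  qed
qed

text \<open>Simple functions converge pointwise to \<open>g\<close> and are dominated by twice its
  modulus, which is the \<open>L^p\<close> majorant required for the limit.\<close>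

lemma converges_ae_Lp:
  assumes [measurable]: "g \<in> borel_measurable torus_borel"
    and g: "(\<integral>\<^sup>+x. ennreal_powr (ennreal (cmod (g x))) p \<partial>torus_haar) < \<top>"
  shows "converges_ae g"
proof -
  obtain F where "\<forall>i. simple_function torus_borel (F i)"
    "\<forall>x\<in>space torus_borel. (\<lambda>i. F i x) \<longlonglongrightarrow> g x"
    "\<forall>i. \<forall>x\<in>space torus_borel. dist (F i x) 0 \<le> 2 * dist (g x) 0"
    using borel_measurable_implies_sequence_metric[OF assms(1), of 0] by blast
  then have F: "\<And>i. simple_function torus_borel (F i)"
    and lim: "\<And>x. x \<in> space torus_borel \<Longrightarrow> (\<lambda>i. F i x) \<longlonglongrightarrow> g x"
    and bound: "\<And>i x. x \<in> space torus_borel \<Longrightarrow> cmod (F i x) \<le> 2 * cmod (g x)"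
    by simp_all
  have conv: "converges_ae (F i)" for i
  proof -
    let ?A = "\<lambda>y. F i -` {y} \<inter> space torus_borel"
    have "converges_ae (\<lambda>x. \<Sum>y\<in>F i ` space torus_borel. y * indicator (?A y) x)"
      using F[of i] by (intro converges_ae_sum[where B=1] converges_ae_indicator)
        (auto simp: simple_function_def indicator_def)
    then show ?thesis
    proof (rule converges_ae_cong)
      fix x assume "x \<in> space torus_borel"
      have "(\<Sum>y\<in>F i ` space torus_borel. y * indicator (?A y) x) =
          (\<Sum>y\<in>F i ` space torus_borel. if y = F i x then F i x else 0)"
        using \<open>x \<in> space torus_borel\<close> by (intro sum.cong) (auto simp: indicator_def)
      also have "\<dots> = F i x"
        using F[of i] \<open>x \<in> space torus_borel\<close> by (subst sum.delta) (auto simp: simple_function_def)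
      finally show "(\<Sum>y\<in>F i ` space torus_borel. y * indicator (?A y) x) = F i x" .
    qed
  qed
  show ?thesis
  proof (rule converges_ae_dominated_limit[where h=F and W="\<lambda>x. ennreal 2 * ennreal (cmod (g x))"])
    have "(\<integral>\<^sup>+x. ennreal_powr (ennreal 2 * ennreal (cmod (g x))) p \<partial>torus_haar) =
        ennreal (2 powr p) * (\<integral>\<^sup>+x. ennreal_powr (ennreal (cmod (g x))) p \<partial>torus_haar)"
      by (simp only: ennreal_powr_mult_left zero_less_numeral) (rule nn_integral_cmult, measurable)
    also have "\<dots> < \<top>" using g by (simp only: ennreal_mult_less_top ennreal_less_top) simp
    finally show "(\<integral>\<^sup>+x. ennreal_powr (ennreal 2 * ennreal (cmod (g x))) p \<partial>torus_haar) < \<top>" .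
    show "ennreal (cmod (F n x)) \<le> ennreal 2 * ennreal (cmod (g x))" if "x \<in> space torus_borel" for n x
      using ennreal_leI[OF bound[OF that, of n]] by (simp only: ennreal_mult zero_le_numeral norm_ge_zero)
    show "ennreal (cmod (g x)) \<le> ennreal 2 * ennreal (cmod (g x))" for x
    proof -
      have "cmod (g x) \<le> 2 * cmod (g x)" by simp
      from ennreal_leI[OF this] show ?thesis
        by (simp only: ennreal_mult zero_le_numeral norm_ge_zero)
    qed
  qed (auto intro: conv lim)
qed

end

lemma ennreal_powr_tendsto_zero:
  assumes a: "0 < a" and u: "(u \<longlonglongrightarrow> (0 :: ennreal))"
  shows "(\<lambda>n. ennreal_powr (u n) a) \<longlonglongrightarrow> 0"
proof (rule order_tendstoI)
  fix e :: ennreal assume "0 < e"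
  then have "0 < ennreal_powr e (1 / a)"
    using ennreal_powr_eq_zero_iff[of e "1 / a"] by (simp add: zero_less_iff_neq_zero)
  with u have "eventually (\<lambda>n. u n < ennreal_powr e (1 / a)) sequentially"
    by (rule order_tendstoD)
  then show "eventually (\<lambda>n. ennreal_powr (u n) a < e) sequentially"
  proof eventually_elim
    fix n assume n: "u n < ennreal_powr e (1 / a)"
    then have "ennreal_powr (u n) a \<le> e"
      using ennreal_powr_mono[OF a less_imp_le[OF n]] by (simp add: ennreal_powr_powr_inverse[OF a])
    moreover have "ennreal_powr (u n) a \<noteq> e"
      using n ennreal_powr_powr_inverse(1)[OF a, of "u n"] by auto
    ultimately show "ennreal_powr (u n) a < e" by simp
  qed
qed simp

theorem theorem3p7:
  fixes r :: "nat \<Rightarrow> nat \<Rightarrow> real"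
    and p :: real
    and g :: "(nat \<Rightarrow> complex) \<Rightarrow> complex"
  assumes "\<And>s n. 0 \<le> r s n"
    and "\<And>n. incseq (\<lambda>s. r s n)"
    and "\<And>n. (\<lambda>s. r s n) \<longlonglongrightarrow> 1"
    and "1 < p"
    and "g \<in> Lp_space torus_haar p"
  shows "Lp_norm torus_haar p (\<lambda>x. SUP s. ennreal (cmod (poisson_op (r s) g x)))
           \<le> ennreal (p / (p - 1)) * Lp_norm torus_haar p (\<lambda>x. ennreal (cmod (g x)))
       \<and> (AE x in torus_haar. (\<lambda>s. poisson_op (r s) g x) \<longlonglongrightarrow> g x)
       \<and> tendsto_Lp torus_haar p (\<lambda>s. poisson_op (r s) g) g"
proof -
  interpret increasing_radii r p
  proof
    \<comment> \<open>The upper bound 1 comes from an increasing sequence staying below its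
      limit.\<close>
    show "unit_radii (r s)" for s
      using assms(1) incseq_le[OF assms(2,3)] by (simp add: unit_radii_def)
  qed (rule assms)+
  define c where "c = p / (p - 1)"
  have p0: "0 < p" and c: "0 < c" using p by (simp_all add: c_def)
  have g_haar: "g \<in> borel_measurable torus_haar" and norm_g: "Lp_norm torus_haar p (\<lambda>x. ennreal (cmod (g x))) < \<top>"
    using assms(5) by (simp_all add: Lp_space_def)
  have g_meas [measurable]: "g \<in> borel_measurable torus_borel"
    using g_haar unfolding measurable_cong_sets[OF sets_torus_haar refl] .
  let ?I = "\<integral>\<^sup>+x. ennreal_powr (ennreal (cmod (g x))) p \<partial>torus_haar"
  let ?M = "\<lambda>x. SUP s. poisson_avg (r s) (\<lambda>x. ennreal (cmod (g x))) x"
  let ?S = "\<lambda>x. SUP s. ennreal (cmod (poisson_op (r s) g x))"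
  have M_meas [measurable]: "?M \<in> borel_measurable torus_borel"
    by (rule measurable_maximal) measurable
  have op_meas: "poisson_op (r s) g \<in> borel_measurable torus_borel" for s
    by (rule measurable_poisson_op[OF unit g_meas])
  have I: "?I < \<top>"
    using norm_g unfolding Lp_norm_def by (metis ennreal_powr_eq_top_iff top.not_eq_extremum)
  have S_le: "?S x \<le> ?M x" if "x \<in> space torus_borel" for x
    by (intro SUP_mono' poisson_op_bound unit g_meas that)
  have M: "(\<integral>\<^sup>+x. ennreal_powr (?M x) p \<partial>torus_haar) \<le> ennreal (c powr p) * ?I"
    unfolding c_def by (rule torus_maximal_inequality[OF unit mono p]) measurable
  have maximal: "Lp_norm torus_haar p ?S \<le> ennreal c * Lp_norm torus_haar p (\<lambda>x. ennreal (cmod (g x)))"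
  proof -
    have "(\<integral>\<^sup>+x. ennreal_powr (?S x) p \<partial>torus_haar) \<le> (\<integral>\<^sup>+x. ennreal_powr (?M x) p \<partial>torus_haar)"
      using p0 by (intro nn_integral_mono ennreal_powr_mono S_le) (simp_all add: space_torus_borel)
    also note M
    finally have "Lp_norm torus_haar p ?S \<le> ennreal_powr (ennreal (c powr p) * ?I) (1 / p)"
      unfolding Lp_norm_def using p0 by (intro ennreal_powr_mono) auto
    \<comment> \<open>Taking the \<open>p\<close>th root turns \<open>c^p\<close> into
      \<open>c\<close>.\<close>
    also have "\<dots> = ennreal c * ennreal_powr ?I (1 / p)"
      using c p0 by (simp add: ennreal_powr_mult_left powr_powr)
    finally show ?thesis by (simp add: Lp_norm_def)
  qed
  have ae: "AE x in torus_haar. (\<lambda>s. poisson_op (r s) g x) \<longlonglongrightarrow> g x"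
    using converges_ae_Lp[OF g_meas I] by (simp add: converges_ae_def)
  have "tendsto_Lp torus_haar p (\<lambda>s. poisson_op (r s) g) g"
    unfolding tendsto_Lp_def
  proof (intro conjI allI)
    show "poisson_op (r s) g \<in> Lp_space torus_haar p" for s
    proof -
      \<comment> \<open>Each single convolution lies below the supremum, so the maximal inequality
        also places it in \<open>L^p\<close>.\<close>
      have "Lp_norm torus_haar p (\<lambda>x. ennreal (cmod (poisson_op (r s) g x))) \<le> Lp_norm torus_haar p ?S"
        unfolding Lp_norm_def using p0 by (intro ennreal_powr_mono nn_integral_mono SUP_upper) auto
      also note maximal
      also have "ennreal c * Lp_norm torus_haar p (\<lambda>x. ennreal (cmod (g x))) < \<top>"
        using norm_g by (simp add: ennreal_mult_less_top)
      finally show ?thesis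
        using op_meas[of s] unfolding Lp_space_def measurable_cong_sets[OF sets_torus_haar refl] by simp
    qed
    show "g \<in> Lp_space torus_haar p" by (rule assms)
    \<comment> \<open>The majorant combines the maximal function, which bounds every convolution,
      with the modulus of \<open>g\<close>; both lie in \<open>L^p\<close>.\<close>
    have "(\<lambda>s. \<integral>\<^sup>+x. ennreal_powr (ennreal (cmod (poisson_op (r s) g x - g x))) p \<partial>torus_haar) \<longlonglongrightarrow> 0"
    proof (rule nn_integral_powr_tendsto_zero[where W="\<lambda>x. sup (?M x) (ennreal (cmod (g x)))"])
      have "(\<integral>\<^sup>+x. ennreal_powr (sup (?M x) (ennreal (cmod (g x)))) p \<partial>torus_haar) \<le>
          (\<integral>\<^sup>+x. ennreal_powr (?M x) p + ennreal_powr (ennreal (cmod (g x))) p \<partial>torus_haar)"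
        by (intro nn_integral_mono ennreal_powr_sup_le)
      also have "\<dots> = (\<integral>\<^sup>+x. ennreal_powr (?M x) p \<partial>torus_haar) + ?I"
        by (rule nn_integral_add) measurable
      also have "\<dots> \<le> ennreal (c powr p) * ?I + ?I"
        by (intro add_right_mono M)
      also have "\<dots> < \<top>" using I by (simp add: ennreal_mult_less_top)
      finally show "(\<integral>\<^sup>+x. ennreal_powr (sup (?M x) (ennreal (cmod (g x)))) p \<partial>torus_haar) < \<top>" .
      show "AE x in torus_haar. ennreal (cmod (poisson_op (r s) g x)) \<le> sup (?M x) (ennreal (cmod (g x)))" for s
      proof (rule AE_torus_haarI)
        fix x assume "x \<in> space torus_borel"
        then have "ennreal (cmod (poisson_op (r s) g x)) \<le> poisson_avg (r s) (\<lambda>x. ennreal (cmod (g x))) x"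
          by (rule poisson_op_bound[OF unit g_meas])
        also have "\<dots> \<le> ?M x" by (rule SUP_upper) simp
        finally show "ennreal (cmod (poisson_op (r s) g x)) \<le> sup (?M x) (ennreal (cmod (g x)))"
          by (rule le_supI1)
      qed
      show "poisson_op (r s) g \<in> borel_measurable torus_haar" for s
        using op_meas unfolding measurable_cong_sets[OF sets_torus_haar refl] .
    qed (use ae p0 g_haar in \<open>simp_all, measurable\<close>)
    then show "(\<lambda>s. Lp_norm torus_haar p (\<lambda>x. ennreal (cmod (poisson_op (r s) g x - g x)))) \<longlonglongrightarrow> 0"
      unfolding Lp_norm_def using p0 by (intro ennreal_powr_tendsto_zero) simp_all
  qed
  with maximal ae show ?thesis by (simp add: c_def)
qed

end
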